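(* Let $\lambda>0$ and let $(U,\varphi)$ be a $\lambda$-structured chart of dimension $n$ in a metric measure space $(X,d,\mu)$. Then there exists a countable Borel decomposition $U=\bigcup_iU_i$ such that each $\mu\llcorner U_i$ has $n$ $\varphi$-independent Alberti representations if and only if, for every $S\in\widetilde A(\varphi)$ with $S\subset U$, $\mu(S)=0$.
   Context: Metric measure space: $(X,d)$ is a complete separable metric space, $\mu$ a finite Borel regular measure on $X$, and the set of isolated points of $X$ is $\mu$-null. Pointwise Lipschitz constant: $\operatorname{Lip}(f,x)=\limsup_{y\to x,\,y\ne x} d(f(x),f(y))/d(x,y)$ for a map $f$ between metric spaces (Euclidean norm in $\mathbb R^n$). Structured charts: for $\lambda>0$, $U\subset X$ and a Lipschitz $\varphi\colon X\to\mathbb R^n$ form a $\lambda$-structured chart of dimension $n$ if $U$ is compact and there is $U'\subset U$ of full measure such that, for every $R>0$, there exists $r>0$ such that for every $x_0\in U'$ there are $x_1,\dots,x_n\in U$ with $r<d(x_i,x_0)<R$ for each $i$ and $\max_{1\le i\le n}|(\varphi(x_i)-\varphi(x_0))\cdot v|/d(x_i,x_0)\ge\lambda$ for every $v\in\mathbb S^{n-1}$. Curves: $\Gamma(X)$ is the set of bi-Lipschitz maps $\gamma\colon\operatorname{Dom}\gamma\to X$ with $\operatorname{Dom}\gamma\subset\mathbb R$ non-empty and compact, with the Hausdorff metric between graphs in $\mathbb R\times X$. For Lipschitz $f\colon X\to\mathbb R^n$, $(f\circ\gamma)'$ is defined almost everywhere on $\operatorname{Dom}\gamma$ as the derivative of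 any Lipschitz extension of $f\circ\gamma$ to an interval. Write $\mathcal H^1(\gamma\cap S)=\mathcal H^1(\operatorname{Im}\gamma\cap S)$. Alberti representations: for measurable $A\subset X$, an Alberti representation of $\mu\llcorner A$ is a pair $\mathcal A=(\mathbb P,\{\mu_\gamma\})$ with $\mathbb P$ a Borel probability measure on $\Gamma(X)$ and, for each $\gamma$, $\mu_\gamma$ a Borel measure on $X$ absolutely continuous with respect to $\mathcal H^1\llcorner\operatorname{Im}\gamma$, such that for every Borel $Y\subset A$ the map $\gamma\mapsto\mu_\gamma(Y)$ is Borel and $\mu(Y)=\int_{\Gamma(X)}\mu_\gamma(Y)\,d\mathbb P(\gamma)$. "Almost every $\gamma\in\mathcal A$" means $\mathbb P$-almost every $\gamma$. In a statement about an Alberti representation, "almost every $t\in\operatorname{Dom}\gamma$" means almost every with respect to the pushforward $\gamma^{-1}_\#\mu_\gamma$; for a curve not attached to a representation it means Lebesgue-almost every. Cones and directions: for $w\in\mathbb S^{n-1}$, $0<\theta<1$, the closed cone of width $\theta$ centred on $w$ is $C(w,\theta)=\{v\in\mathbb R^n: v\cdot w\ge(1-\theta)\|v\|\}$. $\gamma\in\Gamma(X)$ is in the $\varphi$-direction of $C$ if $(\varphi\circ\gamma)'(t)\in C\setminus\{0\}$ for almost every $t\in\operatorname{Dom}\gamma$; an Alberti representation is in the $\varphi$-direction of $C$ if almost every $\gamma\in\mathcal A$ is. Closed cones $C_1,\dots,C_m\subset\mathbb R^n$ are independent if any choice of $v_i\in C_i\setminus\{0\}$ is linearly independent; Alberti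 representations $\mathcal A_1,\dots,\mathcal A_m$ are $\varphi$-independent if there are independent cones $C_1,\dots,C_m$ with each $\mathcal A_i$ in the $\varphi$-direction of $C_i$. Speed: $\gamma\in\Gamma(X)$ has $\varphi$-speed $\delta$ if $\|(\varphi\circ\gamma)'(t_0)\|\ge\delta\operatorname{Lip}(\varphi,\gamma(t_0))\operatorname{Lip}(\gamma,t_0)$ for almost every $t_0\in\operatorname{Dom}\gamma$. The class $\widetilde A(\varphi)$: for $\delta,\lambda'>0$, $0<\theta<1$, $\widetilde A(\varphi;\delta,\theta,\lambda')$ is the set of $S\subset X$ such that (i) for every $x_0\in S$ and every $v\in\mathbb S^{n-1}$, $\operatorname{Lip}(v\cdot\varphi,x_0)>\lambda'\operatorname{Lip}(\varphi,x_0)$; (ii) there are a countable Borel decomposition $S=\bigcup_kS_k$ and closed cones $C_k\subset\mathbb R^n$ of width $1-\theta$ such that, for each $k$, $\mathcal H^1(\gamma\cap S_k)=0$ for every $\gamma\in\Gamma(X)$ in the $\varphi$-direction of $C_k$ with $\varphi$-speed $\delta$. $\widetilde A(\varphi)$ is the set of $S\subset X$ for which there is $\lambda'>0$ with $S\in\widetilde A(\varphi;\delta,\theta,\lambda')$ for every $\delta>0$ and $0<\theta<1$. *)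

theory Defs
  imports "HOL-Probability.Probability"
begin

text \<open>
  The metric space \<open>X\<close> is the carrier of a type \<open>'a\<close> of class \<open>polish_space\<close> (complete, second
  countable metric space), and \<open>\<real>\<^sup>n\<close> is \<open>real ^ 'n\<close>, so that \<open>n = CARD('n) \<ge> 1\<close>.
\<close>

definition metric_measure_space :: "'a::polish_space measure \<Rightarrow> bool" where
  "metric_measure_space \<mu> \<longleftrightarrow>
     finite_measure \<mu> \<and> sets \<mu> = sets borel \<and> {x. x isolated_in UNIV} \<in> null_sets \<mu>"

text \<open>
  A countable decomposition is indexed by \<open>nat\<close>; finite decompositions are padded with empty sets.
\<close>

definition borel_decomposition :: "'a::topological_space set \<Rightarrow> (nat \<Rightarrow> 'a set) \<Rightarrow> bool" where
  "borel_decomposition S V \<longleftrightarrow>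
     (\<forall>k. V k \<in> sets borel) \<and> disjoint_family V \<and> (\<Union>k. V k) = S"


subsection \<open>Pointwise Lipschitz constants and structured charts\<close>

text \<open>
  The domain \<open>D\<close> of \<open>f\<close> is explicit because curves are defined on subsets of the line. The filter
  \<open>at x within D\<close> excludes \<open>x\<close>, and the value at an isolated point of \<open>D\<close> is \<open>0\<close>.
\<close>

definition Lip_on :: "'a::metric_space set \<Rightarrow> ('a \<Rightarrow> 'b::metric_space) \<Rightarrow> 'a \<Rightarrow> ennreal" where
  "Lip_on D f x = Limsup (at x within D) (\<lambda>y. ennreal (dist (f x) (f y) / dist x y))"

abbreviation Lip :: "('a::metric_space \<Rightarrow> 'b::metric_space) \<Rightarrow> 'a \<Rightarrow> ennreal" where
  "Lip \<equiv> Lip_on UNIV"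

text \<open>
  The set \<open>U'\<close> of full measure in \<open>U\<close> need not be Borel: \<open>U - U'\<close> is contained in a null set.
\<close>

definition structured_chart ::
    "'a::polish_space measure \<Rightarrow> real \<Rightarrow> 'a set \<Rightarrow> ('a \<Rightarrow> real ^ 'n) \<Rightarrow> bool" where
  "structured_chart \<mu> l U \<phi> \<longleftrightarrow>
     compact U \<and> (\<exists>L. L-lipschitz_on UNIV \<phi>) \<and>
     (\<exists>U'\<subseteq>U. (AE x in \<mu>. x \<in> U \<longrightarrow> x \<in> U') \<and>
        (\<forall>R>0. \<exists>r>0. \<forall>x0\<in>U'. \<exists>x :: 'n \<Rightarrow> 'a.
           (\<forall>i. x i \<in> U \<and> r < dist (x i) x0 \<and> dist (x i) x0 < R) \<and>
           (\<forall>v. norm v = 1 \<longrightarrow>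
              (MAX i\<in>UNIV. \<bar>(\<phi> (x i) - \<phi> x0) \<bullet> v\<bar> / dist (x i) x0) \<ge> l)))"


subsection \<open>Curves\<close>

definition bilipschitz_on :: "'a::metric_space set \<Rightarrow> ('a \<Rightarrow> 'b::metric_space) \<Rightarrow> bool" where
  "bilipschitz_on K f \<longleftrightarrow>
     (\<exists>L>0. \<forall>s\<in>K. \<forall>t\<in>K. dist s t / L \<le> dist (f s) (f t) \<and> dist (f s) (f t) \<le> L * dist s t)"

text \<open>
  An element of \<open>\<Gamma>(X)\<close> is a partial map, represented by its domain together with a total function
  that is \<open>undefined\<close> outside that domain.
\<close>

typedef (overloaded) 'a curve =
  "{(K :: real set, f :: real \<Rightarrow> 'a::metric_space).
      compact K \<and> K \<noteq> {} \<and> f \<in> extensional K \<and> bilipschitz_on K f}"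
proof
  show "({0}, restrict (\<lambda>_. undefined) {0}) \<in>
    {(K :: real set, f :: real \<Rightarrow> 'a).
      compact K \<and> K \<noteq> {} \<and> f \<in> extensional K \<and> bilipschitz_on K f}"
    by (auto simp: bilipschitz_on_def intro!: exI[of _ 1])
qed

definition curve_dom :: "'a::metric_space curve \<Rightarrow> real set" where
  "curve_dom \<gamma> = fst (Rep_curve \<gamma>)"

definition curve_fun :: "'a::metric_space curve \<Rightarrow> real \<Rightarrow> 'a" where
  "curve_fun \<gamma> = snd (Rep_curve \<gamma>)"

definition curve_image :: "'a::metric_space curve \<Rightarrow> 'a set" where
  "curve_image \<gamma> = curve_fun \<gamma> ` curve_dom \<gamma>"

definition curve_graph :: "'a::metric_space curve \<Rightarrow> (real \<times> 'a) set" where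
  "curve_graph \<gamma> = (\<lambda>t. (t, curve_fun \<gamma> t)) ` curve_dom \<gamma>"

lemma curve_props:
  "compact (curve_dom \<gamma>)" "curve_dom \<gamma> \<noteq> {}"
  "curve_fun \<gamma> \<in> extensional (curve_dom \<gamma>)" "bilipschitz_on (curve_dom \<gamma>) (curve_fun \<gamma>)"
  using Rep_curve[of \<gamma>] by (auto simp: curve_dom_def curve_fun_def split: prod.splits)

lemma bilipschitz_on_continuous_on:
  assumes "bilipschitz_on K f" shows "continuous_on K f"
proof -
  obtain L where "L > 0" "\<forall>s\<in>K. \<forall>t\<in>K. dist (f s) (f t) \<le> L * dist s t"
    using assms by (auto simp: bilipschitz_on_def)
  then have "L-lipschitz_on K f" by (auto simp: lipschitz_on_def)
  then show ?thesis by (rule lipschitz_on_continuous_on)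
qed

lemma curve_graph_compact: "compact (curve_graph \<gamma>)"
  unfolding curve_graph_def
  by (intro compact_continuous_image continuous_intros bilipschitz_on_continuous_on curve_props)

lemma curve_graph_nonempty: "curve_graph \<gamma> \<noteq> {}"
  by (simp add: curve_graph_def curve_props)

lemma curve_graph_eq_iff: "curve_graph \<gamma> = curve_graph \<eta> \<longleftrightarrow> \<gamma> = \<eta>"
proof
  assume eq: "curve_graph \<gamma> = curve_graph \<eta>"
  have "fst ` curve_graph \<gamma> = fst ` curve_graph \<eta>" using eq by simp
  then have dom: "curve_dom \<gamma> = curve_dom \<eta>" by (simp add: curve_graph_def image_image)
  have "curve_fun \<gamma> = curve_fun \<eta>"
  proof (rule extensionalityI[OF curve_props(3)])
    show "curve_fun \<eta> \<in> extensional (curve_dom \<gamma>)" using dom curve_props(3) by metis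
    show "curve_fun \<gamma> t = curve_fun \<eta> t" if "t \<in> curve_dom \<gamma>" for t
      using eq that unfolding curve_graph_def by (auto simp: set_eq_iff image_iff)
  qed
  with dom show "\<gamma> = \<eta>"
    by (simp add: curve_dom_def curve_fun_def prod_eq_iff flip: Rep_curve_inject)
qed simp

definition hausdorff_dist :: "'a::metric_space set \<Rightarrow> 'a set \<Rightarrow> real" where
  "hausdorff_dist A B = max (SUP a\<in>A. infdist a B) (SUP b\<in>B. infdist b A)"

lemma hausdorff_dist_commute: "hausdorff_dist A B = hausdorff_dist B A"
  by (simp add: hausdorff_dist_def max.commute)

lemma infdist_le_hausdorff_dist:
  assumes "compact A" "a \<in> A" shows "infdist a B \<le> hausdorff_dist A B"
proof -
  have "compact ((\<lambda>a. infdist a B) ` A)"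
    by (intro compact_continuous_image continuous_intros assms)
  then have "bdd_above ((\<lambda>a. infdist a B) ` A)"
    by (intro bounded_imp_bdd_above compact_imp_bounded)
  then have "infdist a B \<le> (SUP a\<in>A. infdist a B)" by (rule cSUP_upper[OF assms(2)])
  then show ?thesis by (simp add: hausdorff_dist_def)
qed

lemma hausdorff_dist_le:
  assumes "A \<noteq> {}" "B \<noteq> {}" "\<And>a. a \<in> A \<Longrightarrow> infdist a B \<le> e" "\<And>b. b \<in> B \<Longrightarrow> infdist b A \<le> e"
  shows "hausdorff_dist A B \<le> e"
  using assms by (auto simp: hausdorff_dist_def intro!: cSUP_least)

lemma hausdorff_dist_eq_0_iff:
  assumes "compact A" "compact B" "A \<noteq> {}" "B \<noteq> {}"
  shows "hausdorff_dist A B = 0 \<longleftrightarrow> A = B"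
proof
  assume 0: "hausdorff_dist A B = 0"
  have "infdist a B = 0" if "a \<in> A" for a
    using infdist_le_hausdorff_dist[OF assms(1) that, of B] 0 infdist_nonneg[of a B] by linarith
  moreover have "infdist b A = 0" if "b \<in> B" for b
    using infdist_le_hausdorff_dist[OF assms(2) that, of A] 0 infdist_nonneg[of b A]
      hausdorff_dist_commute[of A B] by linarith
  ultimately show "A = B"
    using assms compact_imp_closed in_closed_iff_infdist_zero by (metis subsetI subset_antisym)
next
  assume "A = B"
  then show "hausdorff_dist A B = 0" using assms by (simp add: hausdorff_dist_def)
qed

lemma infdist_hausdorff_triangle:
  assumes "compact A" "compact C" "C \<noteq> {}" "a \<in> A"
  shows "infdist a B \<le> hausdorff_dist A C + hausdorff_dist C B"
proof -
  have "infdist a B - hausdorff_dist C B \<le> dist a c" if "c \<in> C" for c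
    using infdist_triangle[of a B c] infdist_le_hausdorff_dist[OF assms(2) that, of B] by linarith
  then have "infdist a B - hausdorff_dist C B \<le> infdist a C"
    using assms(3) by (simp add: infdist_notempty cINF_greatest)
  then show ?thesis using infdist_le_hausdorff_dist[OF assms(1,4), of C] by linarith
qed

lemma hausdorff_dist_triangle:
  assumes "compact A" "compact B" "compact C" "A \<noteq> {}" "B \<noteq> {}" "C \<noteq> {}"
  shows "hausdorff_dist A B \<le> hausdorff_dist A C + hausdorff_dist B C"
proof (rule hausdorff_dist_le[OF assms(4,5)])
  show "infdist a B \<le> hausdorff_dist A C + hausdorff_dist B C" if "a \<in> A" for a
    using infdist_hausdorff_triangle[OF assms(1,3,6) that, of B]
    by (simp add: hausdorff_dist_commute[of B C])
  show "infdist b A \<le> hausdorff_dist A C + hausdorff_dist B C" if "b \<in> B" for b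
    using infdist_hausdorff_triangle[OF assms(2,3,6) that, of A]
    by (simp add: hausdorff_dist_commute[of C A])
qed

instantiation curve :: (metric_space) metric_space
begin

definition dist_curve :: "'a curve \<Rightarrow> 'a curve \<Rightarrow> real" where
  "dist_curve \<gamma> \<eta> = hausdorff_dist (curve_graph \<gamma>) (curve_graph \<eta>)"

definition uniformity_curve :: "('a curve \<times> 'a curve) filter" where
  "uniformity_curve = (INF e\<in>{0<..}. principal {(\<gamma>, \<eta>). dist \<gamma> \<eta> < e})"

definition open_curve :: "'a curve set \<Rightarrow> bool" where
  "open_curve G \<longleftrightarrow> (\<forall>\<gamma>\<in>G. \<forall>\<^sub>F (\<gamma>', \<eta>) in uniformity. \<gamma>' = \<gamma> \<longrightarrow> \<eta> \<in> G)"

instance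
proof
  fix \<gamma> \<eta> \<zeta> :: "'a curve"
  show "dist \<gamma> \<eta> = 0 \<longleftrightarrow> \<gamma> = \<eta>"
    by (simp add: dist_curve_def hausdorff_dist_eq_0_iff curve_graph_compact curve_graph_nonempty
        curve_graph_eq_iff)
  show "dist \<gamma> \<eta> \<le> dist \<gamma> \<zeta> + dist \<eta> \<zeta>"
    by (simp add: dist_curve_def hausdorff_dist_triangle curve_graph_compact curve_graph_nonempty)
qed (simp_all add: uniformity_curve_def open_curve_def)

end

text \<open>
  \<open>(f \<circ> \<gamma>)'\<close> is the derivative of a chosen Lipschitz extension of \<open>f \<circ> \<gamma>\<close> to the real line. The choice
  matters only on a Lebesgue null subset of the domain, and this is also where the value of
  \<open>vector_derivative\<close> may be arbitrary.
\<close>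

definition lipschitz_extension ::
    "(real \<Rightarrow> 'b) \<Rightarrow> ('a::metric_space \<Rightarrow> 'b::real_normed_vector) \<Rightarrow> 'a curve \<Rightarrow> bool" where
  "lipschitz_extension g f \<gamma> \<longleftrightarrow>
     (\<exists>L. L-lipschitz_on UNIV g) \<and> (\<forall>t\<in>curve_dom \<gamma>. g t = f (curve_fun \<gamma> t))"

definition curve_deriv ::
    "('a::metric_space \<Rightarrow> 'b::real_normed_vector) \<Rightarrow> 'a curve \<Rightarrow> real \<Rightarrow> 'b" where
  "curve_deriv f \<gamma> t = vector_derivative (SOME g. lipschitz_extension g f \<gamma>) (at t)"

definition hausdorff1 :: "'a::metric_space set \<Rightarrow> ennreal" where
  "hausdorff1 E =
     (SUP d\<in>{0<..}. INF F\<in>{F :: nat \<Rightarrow> 'a set.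
          E \<subseteq> (\<Union>i. F i) \<and> (\<forall>i. bounded (F i) \<and> diameter (F i) \<le> d)}.
        \<Sum>i. ennreal (diameter (F i)))"


subsection \<open>Cones, directions and speed\<close>

definition closed_cone :: "real ^ 'n \<Rightarrow> real \<Rightarrow> (real ^ 'n) set" where
  "closed_cone w \<theta> = {v. v \<bullet> w \<ge> (1 - \<theta>) * norm v}"

definition is_closed_cone_of_width :: "real \<Rightarrow> (real ^ 'n) set \<Rightarrow> bool" where
  "is_closed_cone_of_width \<theta> C \<longleftrightarrow> 0 < \<theta> \<and> \<theta> < 1 \<and> (\<exists>w. norm w = 1 \<and> C = closed_cone w \<theta>)"

definition independent_cones :: "nat \<Rightarrow> (nat \<Rightarrow> (real ^ 'n) set) \<Rightarrow> bool" where
  "independent_cones m C \<longleftrightarrow>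
     (\<forall>i<m. \<exists>\<theta>. is_closed_cone_of_width \<theta> (C i)) \<and>
     (\<forall>v. (\<forall>i<m. v i \<in> C i - {0}) \<longrightarrow> inj_on v {..<m} \<and> independent (v ` {..<m}))"

text \<open>
  The measure \<open>N\<close> on the line says what ``almost every \<open>t\<close> in the domain of \<open>\<gamma>\<close>'' means: it is
  \<open>lebesgue_on (curve_dom \<gamma>)\<close> for a curve on its own, and the measure \<open>pullback_measure\<close>
  below for a curve that belongs to an Alberti representation.
\<close>

definition in_direction ::
    "real measure \<Rightarrow> ('a::metric_space \<Rightarrow> real ^ 'n) \<Rightarrow> (real ^ 'n) set \<Rightarrow> 'a curve \<Rightarrow> bool" where
  "in_direction N \<phi> C \<gamma> \<longleftrightarrow> (AE t in N. curve_deriv \<phi> \<gamma> t \<in> C - {0})"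

definition has_speed ::
    "real measure \<Rightarrow> ('a::metric_space \<Rightarrow> real ^ 'n) \<Rightarrow> real \<Rightarrow> 'a curve \<Rightarrow> bool" where
  "has_speed N \<phi> \<delta> \<gamma> \<longleftrightarrow>
     (AE t in N. ennreal (norm (curve_deriv \<phi> \<gamma> t)) \<ge>
        ennreal \<delta> * Lip \<phi> (curve_fun \<gamma> t) * Lip_on (curve_dom \<gamma>) (curve_fun \<gamma>) t)"


subsection \<open>Alberti representations\<close>

text \<open>
  The pair \<open>(P, M)\<close> represents \<open>\<mu>\<close> restricted to \<open>A\<close>. Absolute continuity with respect to
  \<open>\<H>\<^sup>1\<close> restricted to the image of \<open>\<gamma>\<close> is written out on Borel sets, since \<open>hausdorff1\<close> is an
  outer measure rather than an object of type \<open>measure\<close>.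
\<close>

definition alberti_representation ::
    "'a::polish_space measure \<Rightarrow> 'a set \<Rightarrow> 'a curve measure \<Rightarrow> ('a curve \<Rightarrow> 'a measure) \<Rightarrow> bool" where
  "alberti_representation \<mu> A P M \<longleftrightarrow>
     prob_space P \<and> sets P = sets borel \<and>
     (\<forall>\<gamma>. sets (M \<gamma>) = sets borel \<and>
        (\<forall>B\<in>sets borel. hausdorff1 (curve_image \<gamma> \<inter> B) = 0 \<longrightarrow> emeasure (M \<gamma>) B = 0)) \<and>
     (\<forall>Y\<in>sets borel. Y \<subseteq> A \<longrightarrow>
        (\<lambda>\<gamma>. emeasure (M \<gamma>) Y) \<in> borel_measurable borel \<and>
        emeasure \<mu> Y = (\<integral>\<^sup>+\<gamma>. emeasure (M \<gamma>) Y \<partial>P))"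

text \<open>The push-forward of \<open>\<nu>\<close> under \<open>\<gamma>\<inverse>\<close>, which is defined on the image of \<open>\<gamma>\<close> only.\<close>

definition pullback_measure :: "'a::metric_space curve \<Rightarrow> 'a measure \<Rightarrow> real measure" where
  "pullback_measure \<gamma> \<nu> =
     distr (restrict_space \<nu> (curve_image \<gamma>)) borel (the_inv_into (curve_dom \<gamma>) (curve_fun \<gamma>))"

definition alberti_in_direction ::
    "'a curve measure \<Rightarrow> ('a curve \<Rightarrow> 'a measure) \<Rightarrow> ('a::polish_space \<Rightarrow> real ^ 'n)
      \<Rightarrow> (real ^ 'n) set \<Rightarrow> bool" where
  "alberti_in_direction P M \<phi> C \<longleftrightarrow>
     (AE \<gamma> in P. in_direction (pullback_measure \<gamma> (M \<gamma>)) \<phi> C \<gamma>)"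

definition has_independent_alberti_representations ::
    "'a::polish_space measure \<Rightarrow> 'a set \<Rightarrow> ('a \<Rightarrow> real ^ 'n) \<Rightarrow> nat \<Rightarrow> bool" where
  "has_independent_alberti_representations \<mu> A \<phi> m \<longleftrightarrow>
     (\<exists>P M C. independent_cones m C \<and>
        (\<forall>i<m. alberti_representation \<mu> A (P i) (M i) \<and>
           alberti_in_direction (P i) (M i) \<phi> (C i)))"


subsection \<open>The class of sets that are null for all curves in wide cones\<close>

text \<open>
  A member \<open>S\<close> is automatically Borel, being the union of a countable Borel decomposition.
\<close>

definition A_tilde_param ::
    "('a::polish_space \<Rightarrow> real ^ 'n) \<Rightarrow> real \<Rightarrow> real \<Rightarrow> real \<Rightarrow> 'a set set" where
  "A_tilde_param \<phi> \<delta> \<theta> l =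
     {S. (\<forall>x0\<in>S. \<forall>v. norm v = 1 \<longrightarrow> Lip (\<lambda>x. v \<bullet> \<phi> x) x0 > ennreal l * Lip \<phi> x0) \<and>
         (\<exists>V C. borel_decomposition S V \<and>
            (\<forall>k. is_closed_cone_of_width (1 - \<theta>) (C k) \<and>
               (\<forall>\<gamma>. in_direction (lebesgue_on (curve_dom \<gamma>)) \<phi> (C k) \<gamma> \<and>
                    has_speed (lebesgue_on (curve_dom \<gamma>)) \<phi> \<delta> \<gamma> \<longrightarrow>
                    hausdorff1 (curve_image \<gamma> \<inter> V k) = 0)))}"

definition A_tilde :: "('a::polish_space \<Rightarrow> real ^ 'n) \<Rightarrow> 'a set set" where
  "A_tilde \<phi> = {S. \<exists>l>0. \<forall>\<delta>>0. \<forall>\<theta>. 0 < \<theta> \<and> \<theta> < 1 \<longrightarrow> S \<in> A_tilde_param \<phi> \<delta> \<theta> l}"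

end

theory Submission
  imports Defs
begin

text \<open>
  Suppose first that there are \<open>n\<close> independent representations. The cones being independent, there is
  \<open>\<theta> > 0\<close> such that for every unit vector \<open>w\<close> one of them, \<open>C\<^sub>j\<close>, satisfies \<open>\<bar>v \<bullet> w\<bar> \<ge> \<theta> \<parallel>v\<parallel>\<close> on \<open>C\<^sub>j\<close>; up to
  reversing orientation, the curves of the \<open>j\<close>-th representation run in the wide cone around \<open>w\<close>. With \<open>\<delta> \<rightarrow> 0\<close>
  every point of a curve eventually has sufficient speed. Hence a set of the class splits into \<open>n\<close> pieces,
  the \<open>j\<close>-th being null for almost every curve of the \<open>j\<close>-th representation.

  Conversely, for every cone exhaust \<open>U\<close> by sets that are represented by curves in a slightly wider
  cone. What is left is, up to a \<open>\<mu>\<close>-null set, null for all curves in the cone. This is a minimax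
  argument: otherwise there are measures on a compact family of curves which charge every closed set of
  nearly full measure by a fixed amount; a weak limit of finitely supported ones gives a mixture of
  length measures that is not singular to \<open>\<mu>\<close>, and its absolutely continuous part represents a further
  set of positive measure. Points that lie in sets represented in \<open>n\<close> independent cones are covered by
  the required decomposition. At all other points the represented directions lie in a hyperplane, so
  the cones of width less than \<open>1\<close> around its normal consist of directions without representation, and
  the set of these points belongs to the class up to a null set.
\<close>

subsection \<open>Differentiability of Lipschitz functions on the line\<close>

text \<open>Weak compactness is used only for probability measures on the line, so every curve
  family in the minimax argument has to be a continuous image of a compact set of reals. Running in
  a cone is a condition on derivatives and is not closed under Hausdorff limits of graphs. It is
  replaced by bounds on all secants of the graph, with one constant for the bi-Lipschitz bounds and
  for the lower bound on increments of \<open>\<phi>\<close>. With \<open>U\<close> and a time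
  interval compact this gives compact families, and the times at which a curve has its derivative in
  a cone are covered, up to a null set, by countably many pieces from such families for any strictly
  wider cone. This loss of width is why each direction carries a narrow and a wide cone. Only
  countably many cones occur, so all exceptional null sets can be discarded at once.

  In the other direction, the decomposition of a set of the class depends on \<delta>, and those for
  different \<delta> are unrelated. Each piece is assigned one representation, and by pigeonhole a
  point receives the same one for arbitrarily small \<delta>.\<close>

text \<open>The inverse \<open>g\<close> of \<open>f\<close> is 1-Lipschitz, and the push-forward of
  Lebesgue measure under \<open>g\<close> gives \<open>{a..b}\<close> the mass
  \<open>f b - f a\<close>. Since \<open>f\<close> is Lipschitz, it maps null sets to null sets, so
  this measure has a density, and \<open>r\<close> is that density.\<close>

lemma expanding_lipschitz_is_integral:
  fixes f :: "real \<Rightarrow> real"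
  assumes lip: "L-lipschitz_on UNIV f" and inc: "\<And>x y. x \<le> y \<Longrightarrow> y - x \<le> f y - f x"
  obtains r where "\<And>a b. a \<le> b \<Longrightarrow> (r has_integral (f b - f a)) {a..b}"
proof -
  have cont: "continuous_on UNIV f" using lip by (rule lipschitz_on_continuous_on)
  have smono: "x < y \<Longrightarrow> f x < f y" for x y using inc[of x y] by linarith
  have inj: "inj f" by (metis injI linorder_neq_iff smono)
  have surj: "surj f"
  proof (unfold surj_def, rule allI)
    fix y :: real
    have "f (- \<bar>y - f 0\<bar>) \<le> y" "y \<le> f \<bar>y - f 0\<bar>"
      using inc[of 0 "\<bar>y - f 0\<bar>"] inc[of "- \<bar>y - f 0\<bar>" 0] by linarith+
    then have "\<exists>x. - \<bar>y - f 0\<bar> \<le> x \<and> x \<le> \<bar>y - f 0\<bar> \<and> f x = y"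
      by (intro IVT' continuous_on_subset[OF cont]) auto
    then show "\<exists>x. y = f x" by blast
  qed
  define g where "g = inv f"
  have fg: "f (g y) = y" and gf: "g (f x) = x" for x y
    using inj surj by (auto simp: g_def surj_f_inv_f)
  have "dist (g x) (g y) \<le> dist x y" for x y
    using inc[of "g x" "g y"] inc[of "g y" "g x"] unfolding fg dist_real_def by linarith
  then have "1-lipschitz_on UNIV g" by (auto intro: lipschitz_onI)
  then have g_meas[measurable]: "g \<in> borel_measurable borel"
    by (intro borel_measurable_continuous_onI lipschitz_on_continuous_on)
  have vimage: "g -` A = f ` A" for A
  proof (intro equalityI subsetI)
    fix x assume "x \<in> g -` A" then show "x \<in> f ` A" using fg[of x] by (metis imageI vimageD)
  next
    fix x assume "x \<in> f ` A" then show "x \<in> g -` A" using gf by auto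
  qed
  define \<nu> where "\<nu> = distr lborel borel g"
  have Icc: "emeasure \<nu> {a..b} = ennreal (f b - f a)" if "a \<le> b" for a b
  proof -
    have "f ` {a..b} = {f a..f b}"
    proof (intro equalityI subsetI)
      fix y assume "y \<in> {f a..f b}"
      then have "g y \<in> {a..b}" using smono[of "g y" a] smono[of b "g y"] fg[of y] by force
      then show "y \<in> f ` {a..b}" using fg[of y] by (metis imageI)
    next
      fix y assume "y \<in> f ` {a..b}"
      then show "y \<in> {f a..f b}" using inc by (fastforce simp: algebra_simps)
    qed
    then show ?thesis using that inc[OF that] by (simp add: \<nu>_def emeasure_distr vimage)
  qed
  have "absolutely_continuous lborel \<nu>"
  proof (unfold absolutely_continuous_def, rule subsetI)
    fix B :: "real set" assume B: "B \<in> null_sets lborel"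
    then have "negligible B"
      by (simp add: negligible_iff_null_sets null_sets_completionI)
    then have "negligible (f ` B)"
    proof (rule negligible_locally_Lipschitz_image[OF order_refl])
      fix x assume "x \<in> B"
      show "\<exists>T K. open T \<and> x \<in> T \<and> (\<forall>y\<in>B \<inter> T. norm (f y - f x) \<le> K * norm (y - x))"
        by (rule exI[of _ UNIV], rule exI[of _ L]) (use lip in \<open>auto dest: lipschitz_on_normD\<close>)
    qed
    moreover have "f ` B \<in> sets lborel" using B measurable_sets[OF g_meas, of B]
      by (simp add: null_sets_def vimage)
    ultimately have "f ` B \<in> null_sets lborel"
      by (simp add: negligible_iff_null_sets null_sets_completion_iff)
    then show "B \<in> null_sets \<nu>"
      using B by (auto simp: null_sets_def \<nu>_def emeasure_distr vimage)
  qed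
  then obtain \<rho> where \<rho>[measurable]: "\<rho> \<in> borel_measurable lborel" and dens: "density lborel \<rho> = \<nu>"
    using sigma_finite_lborel sigma_finite_measure.Radon_Nikodym[of lborel \<nu>]
    by (auto simp: \<nu>_def)
  have int: "((\<lambda>x. enn2real (\<rho> x)) has_integral (f b - f a)) {a..b}" if "a \<le> b" for a b
  proof -
    have eq: "(\<integral>\<^sup>+x. \<rho> x * indicator {a..b} x \<partial>lborel) = ennreal (f b - f a)"
      using Icc[OF that] by (simp add: emeasure_density flip: dens)
    then have "AE x in lborel. \<rho> x * indicator {a..b} x \<noteq> \<infinity>"
      by (intro nn_integral_PInf_AE) auto
    then have "AE x in lborel. \<rho> x * indicator {a..b} x
        = ennreal (enn2real (\<rho> x) * indicat_real {a..b} x)"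
    proof (eventually_elim)
      case (elim x) then show ?case
        by (cases "x \<in> {a..b}") (auto simp: less_top)
    qed
    then have nn: "(\<integral>\<^sup>+x. ennreal (enn2real (\<rho> x) * indicat_real {a..b} x) \<partial>lborel) = ennreal (f b - f a)"
      using eq nn_integral_cong_AE by metis
    have "((\<lambda>x. enn2real (\<rho> x) * indicat_real {a..b} x) has_integral (f b - f a)) UNIV"
      using inc[OF that] that by (intro nn_integral_has_integral[OF _ _ nn]) auto
    moreover have "(\<lambda>x. enn2real (\<rho> x) * indicat_real {a..b} x) = (\<lambda>x. if x \<in> {a..b} then enn2real (\<rho> x) else 0)"
      by auto
    ultimately show ?thesis
      using has_integral_restrict_UNIV[of "{a..b}" "\<lambda>x. enn2real (\<rho> x)"] by simp
  qed
  show ?thesis by (rule that[OF int])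
qed

lemma negligible_imp_AE:
  assumes "negligible N" shows "AE x in lborel. x \<notin> N"
  using assms AE_not_in[of N "lebesgue"] unfolding negligible_iff_null_sets
  by (auto simp: AE_completion_iff)

text \<open>Lebesgue differentiation of \<open>r\<close> over intervals to the right of a point
  controls the right difference quotients; the left ones are right ones of the reflected density
  \<open>\<lambda>x. r (- x)\<close>.\<close>

lemma expanding_lipschitz_differentiable_AE:
  fixes f :: "real \<Rightarrow> real"
  assumes lip: "L-lipschitz_on UNIV f" and inc: "\<And>x y. x \<le> y \<Longrightarrow> y - x \<le> f y - f x"
  shows "AE x in lborel. f differentiable (at x)"
proof -
  obtain r where r: "\<And>a b. a \<le> b \<Longrightarrow> (r has_integral (f b - f a)) {a..b}"
    using expanding_lipschitz_is_integral[OF assms] by blast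
  have r': "((\<lambda>x. r (- x)) has_integral (f (- a) - f (- b))) {a..b}" if "a \<le> b" for a b
    using has_integral_reflect_lemma_real[OF r[of "- b" "- a"]] that by simp
  have "r integrable_on cbox a b" for a b
    using r[of a b] by (cases "a \<le> b") (auto simp: integrable_on_def integrable_on_empty)
  then obtain N where N: "negligible N" "\<And>x e. \<lbrakk>x \<notin> N; 0 < e\<rbrakk> \<Longrightarrow> \<exists>d>0. \<forall>h. 0 < h \<and> h < d \<longrightarrow>
         norm (integral (cbox x (x + h *\<^sub>R One)) r /\<^sub>R h ^ DIM(real) - r x) < e"
    using integrable_ccontinuous_explicit by metis
  have "(\<lambda>x. r (- x)) integrable_on cbox a b" for a b
    using r'[of a b] by (cases "a \<le> b") (auto simp: integrable_on_def integrable_on_empty)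
  then obtain N' where N': "negligible N'" "\<And>x e. \<lbrakk>x \<notin> N'; 0 < e\<rbrakk> \<Longrightarrow> \<exists>d>0. \<forall>h. 0 < h \<and> h < d \<longrightarrow>
         norm (integral (cbox x (x + h *\<^sub>R One)) (\<lambda>x. r (- x)) /\<^sub>R h ^ DIM(real) - r (- x)) < e"
    using integrable_ccontinuous_explicit by metis
  have "negligible (uminus ` N')" using N'(1)
    by (intro negligible_differentiable_image_negligible) (auto intro!: differentiable_on_minus differentiable_on_id)
  moreover have "f differentiable at x" if x: "x \<notin> N" "x \<notin> uminus ` N'" for x
  proof -
    have x': "- x \<notin> N'" using x by force
    have "((\<lambda>y. (f y - f x) / (y - x)) \<longlongrightarrow> r x) (at x)"
    proof (rule LIM_I)
      fix e :: real assume e: "e > 0"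
      obtain d where d: "d > 0" "\<And>h. 0 < h \<Longrightarrow> h < d \<Longrightarrow> norm (integral {x..x+h} r / h - r x) < e"
        using N(2)[OF x(1) e] by (auto simp: divide_inverse mult.commute)
      obtain d' where d': "d' > 0" "\<And>h. 0 < h \<Longrightarrow> h < d' \<Longrightarrow>
          norm (integral {-x..-x+h} (\<lambda>x. r (- x)) / h - r x) < e"
        using N'(2)[OF x' e] by (auto simp: divide_inverse mult.commute)
      show "\<exists>s>0. \<forall>y. y \<noteq> x \<and> norm (y - x) < s \<longrightarrow> norm ((f y - f x) / (y - x) - r x) < e"
      proof (intro exI[of _ "min d d'"] conjI allI impI)
        show "min d d' > 0" using d d' by simp
        fix y assume y: "y \<noteq> x \<and> norm (y - x) < min d d'"
        show "norm ((f y - f x) / (y - x) - r x) < e"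
        proof (cases "y > x")
          case True
          then have "integral {x..x+(y-x)} r = f y - f x" using integral_unique[OF r[of x y]] by simp
          then show ?thesis using d(2)[of "y - x"] True y by auto
        next
          case False
          then have "integral {-x..-x+(x-y)} (\<lambda>x. r (- x)) = f x - f y"
            using integral_unique[OF r'[of "- x" "- y"]] by simp
          moreover have "(f y - f x) / (y - x) = (f x - f y) / (x - y)"
            by (metis minus_diff_eq minus_divide_divide)
          ultimately show ?thesis using d'(2)[of "x - y"] False y by auto
        qed
      qed
    qed
    then have "(f has_field_derivative r x) (at x)"
      by (simp add: has_field_derivative_iff)
    then show ?thesis using real_differentiable_def by blast
  qed
  ultimately show ?thesis
    using negligible_imp_AE[OF N(1)] negligible_imp_AE[of "uminus ` N'"] by auto
qed

lemma lipschitz_differentiable_AE: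
  fixes f :: "real \<Rightarrow> real ^ 'n"
  assumes lip: "L-lipschitz_on UNIV f"
  shows "AE x in lborel. f differentiable (at x)"
proof -
  have "AE x in lborel. (\<lambda>x. f x $ i) differentiable (at x)" for i
  proof -
    have L: "L \<ge> 0" using lip by (rule lipschitz_on_nonneg)
    have fi: "\<bar>f x $ i - f y $ i\<bar> \<le> L * \<bar>x - y\<bar>" for x y
      using lipschitz_onD[OF lip, of x y] component_le_norm_cart[of "f x - f y" i]
      by (auto simp: dist_norm intro: order_trans)
    \<comment> \<open>The slope \<open>L + 1\<close> exceeds the Lipschitz constant by 1, so
      \<open>g\<close> is expanding; the linear term is subtracted again afterwards.\<close>
    define g where "g x = f x $ i + (L + 1) * x" for x
    have "(2 * L + 1)-lipschitz_on UNIV g"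
    proof (rule lipschitz_onI)
      fix x y
      have "\<bar>g x - g y\<bar> \<le> \<bar>f x $ i - f y $ i\<bar> + \<bar>(L + 1) * (x - y)\<bar>"
        by (simp add: g_def algebra_simps)
      also have "\<dots> \<le> L * \<bar>x - y\<bar> + (L + 1) * \<bar>x - y\<bar>"
        using fi L by (simp add: abs_mult)
      finally show "dist (g x) (g y) \<le> (2 * L + 1) * dist x y"
        by (simp add: dist_real_def algebra_simps)
    qed (use L in simp)
    moreover have "y - x \<le> g y - g x" if "x \<le> y" for x y
      using fi[of x y] that by (auto simp: g_def algebra_simps abs_le_iff)
    ultimately have "AE x in lborel. g differentiable (at x)"
      by (rule expanding_lipschitz_differentiable_AE)
    then show ?thesis
    proof eventually_elim
      case (elim x)
      then have "(\<lambda>x. g x - (L + 1) * x) differentiable (at x)"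
        by (intro differentiable_diff) auto
      then show ?case by (simp add: g_def)
    qed
  qed
  then have "AE x in lborel. \<forall>i. (\<lambda>x. f x $ i) differentiable (at x)"
    by (subst AE_all_countable) auto
  then show ?thesis
    by eventually_elim
       (auto simp: differentiable_componentwise_within[of f] Basis_vec_def inner_axis)
qed

subsection \<open>Curves, extensions and derivatives\<close>

text \<open>A basic open set that meets \<open>K\<close> in a single point determines that
  point.\<close>

lemma countable_isolated_points:
  fixes K :: "'a::second_countable_topology set"
  shows "countable {x\<in>K. \<not> x islimpt K}"
proof -
  obtain B :: "'a set set" where B: "countable B" "topological_basis B"
    using ex_countable_basis by blast
  have "{x\<in>K. \<not> x islimpt K} \<subseteq> (\<lambda>b. the_elem (b \<inter> K)) ` B"
  proof clarify
    fix x assume x: "x \<in> K" "\<not> x islimpt K"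
    then obtain T where T: "x \<in> T" "open T" "\<And>y. y \<in> K \<Longrightarrow> y \<in> T \<Longrightarrow> y = x"
      unfolding islimpt_def by blast
    then obtain b where b: "b \<in> B" "x \<in> b" "b \<subseteq> T"
      using topological_basisE[OF B(2) T(2,1)] by blast
    then have "b \<inter> K = {x}" using T x by blast
    then show "x \<in> (\<lambda>b. the_elem (b \<inter> K)) ` B" using b(1) by (intro image_eqI[of _ _ b]) auto
  qed
  then show ?thesis by (rule countable_subset[OF _ countable_image[OF B(1)]])
qed

lemma AE_islimpt:
  fixes K :: "real set"
  shows "AE t in lborel. t \<in> K \<longrightarrow> t islimpt K"
proof -
  have "{t\<in>K. \<not> t islimpt K} \<in> null_sets lborel"
    by (intro countable_imp_null_set_lborel countable_isolated_points)
  then show ?thesis by (rule AE_I') auto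
qed

text \<open>Derivatives within \<open>K\<close> are unique at limit points of \<open>K\<close>, and
  the other points of \<open>K\<close> form a countable, hence null, set. This makes the choice of
  an extension in \<open>curve_deriv\<close> immaterial almost everywhere.\<close>

lemma lipschitz_vector_derivatives_agree_AE:
  fixes g h :: "real \<Rightarrow> real ^ 'n"
  assumes "L-lipschitz_on UNIV g" "M-lipschitz_on UNIV h" and eq: "\<And>t. t \<in> K \<Longrightarrow> g t = h t"
  shows "AE t in lborel. t \<in> K \<longrightarrow>
    (\<exists>D. (g has_vector_derivative D) (at t) \<and> (h has_vector_derivative D) (at t))"
  using lipschitz_differentiable_AE[OF assms(1)] lipschitz_differentiable_AE[OF assms(2)]
    AE_islimpt[of K]
proof eventually_elim
  case (elim t)
  show ?case
  proof
    assume t: "t \<in> K"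
    have D: "(g has_vector_derivative vector_derivative g (at t)) (at t)"
      and E: "(h has_vector_derivative vector_derivative h (at t)) (at t)"
      using elim vector_derivative_works by blast+
    have "(g has_vector_derivative vector_derivative h (at t)) (at t within K)"
      by (rule has_vector_derivative_transform[OF t eq has_vector_derivative_at_within[OF E]])
    then have "vector_derivative g (at t) = vector_derivative h (at t)"
      using vector_derivative_unique_within[of t K] has_vector_derivative_at_within[OF D]
        elim t trivial_limit_within by metis
    then show "\<exists>D. (g has_vector_derivative D) (at t) \<and> (h has_vector_derivative D) (at t)"
      using D E by auto
  qed
qed

lemma lipschitz_extend_real:
  fixes f :: "'a::metric_space \<Rightarrow> real"
  assumes lip: "L-lipschitz_on K f" and ne: "K \<noteq> {}"
  obtains g where "L-lipschitz_on UNIV g" "\<And>t. t \<in> K \<Longrightarrow> g t = f t"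
proof
  \<comment> \<open>McShane's extension: the largest \<open>L\<close>-Lipschitz function that agrees
    with \<open>f\<close> on \<open>K\<close>.\<close>
  define g where "g t = (INF s\<in>K. f s + L * dist s t)" for t
  have L: "L \<ge> 0" using lip by (rule lipschitz_on_nonneg)
  obtain k where k: "k \<in> K" using ne by blast
  have lower: "f u - L * dist u t \<le> f s + L * dist s t" if "s \<in> K" "u \<in> K" for s t u
  proof -
    have "f u - f s \<le> L * dist u s" using lipschitz_onD[OF lip that(2,1)] by (simp add: dist_real_def)
    also have "\<dots> \<le> L * (dist u t + dist s t)"
      using L dist_triangle2[of u s t] by (intro mult_left_mono) auto
    finally show ?thesis by (simp add: algebra_simps)
  qed
  have bdd: "bdd_below ((\<lambda>s. f s + L * dist s t) ` K)" for t
    by (rule bdd_belowI2[of _ "f k - L * dist k t"]) (use lower k in auto)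
  have step: "g t \<le> g u + L * dist t u" for t u
  proof -
    have "g t - L * dist t u \<le> f s + L * dist s u" if "s \<in> K" for s
    proof -
      have "g t \<le> f s + L * dist s t" unfolding g_def by (rule cINF_lower[OF bdd that])
      also have "\<dots> \<le> f s + L * (dist s u + dist t u)"
        using L dist_triangle2[of s t u] by (intro add_left_mono mult_left_mono) auto
      finally show ?thesis by (simp add: algebra_simps)
    qed
    then have "g t - L * dist t u \<le> g u" unfolding g_def[of u] by (intro cINF_greatest ne)
    then show ?thesis by simp
  qed
  show "L-lipschitz_on UNIV g"
  proof (rule lipschitz_onI[OF _ L])
    show "dist (g t) (g u) \<le> L * dist t u" for t u
      using step[of t u] step[of u t] by (simp add: dist_real_def dist_commute abs_le_iff)
  qed
  show "g t = f t" if "t \<in> K" for t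
  proof (rule antisym)
    show "g t \<le> f t" unfolding g_def using cINF_lower[OF bdd that, of t] by simp
    show "f t \<le> g t" unfolding g_def using lower[OF _ that, of _ t] by (intro cINF_greatest ne) auto
  qed
qed

lemma curve_lipschitz:
  obtains L where "L > 0" "L-lipschitz_on (curve_dom \<gamma>) (curve_fun \<gamma>)"
    "\<And>s t. s \<in> curve_dom \<gamma> \<Longrightarrow> t \<in> curve_dom \<gamma> \<Longrightarrow>
       dist s t \<le> L * dist (curve_fun \<gamma> s) (curve_fun \<gamma> t)"
proof -
  obtain L where "L > 0" "\<forall>s\<in>curve_dom \<gamma>. \<forall>t\<in>curve_dom \<gamma>.
      dist s t / L \<le> dist (curve_fun \<gamma> s) (curve_fun \<gamma> t) \<and>
      dist (curve_fun \<gamma> s) (curve_fun \<gamma> t) \<le> L * dist s t"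
    using curve_props(4)[of \<gamma>] unfolding bilipschitz_on_def by blast
  then show ?thesis
    by (intro that[of L]) (auto intro!: lipschitz_onI simp: divide_simps mult.commute)
qed

lemma curve_continuous_on: "continuous_on (curve_dom \<gamma>) (curve_fun \<gamma>)"
  by (intro bilipschitz_on_continuous_on curve_props)

lemma curve_inj_on: "inj_on (curve_fun \<gamma>) (curve_dom \<gamma>)"
  using curve_lipschitz[of \<gamma>] by (metis dist_eq_0_iff dist_le_zero_iff inj_onI mult_zero_right)

lemma lipschitz_extension_exists:
  fixes \<phi> :: "'a::metric_space \<Rightarrow> real ^ 'n"
  assumes lip: "M-lipschitz_on UNIV \<phi>"
  shows "\<exists>g. lipschitz_extension g \<phi> \<gamma>"
proof -
  let ?K = "curve_dom \<gamma>"
  obtain L where L: "L > 0" "L-lipschitz_on ?K (curve_fun \<gamma>)"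
    by (rule curve_lipschitz[of \<gamma>])
  have M: "M \<ge> 0" using lip by (rule lipschitz_on_nonneg)
  have "\<exists>g. (M * L)-lipschitz_on UNIV g \<and> (\<forall>t\<in>?K. g t = \<phi> (curve_fun \<gamma> t) $ i)" for i
  proof -
    have "(M * L)-lipschitz_on ?K (\<lambda>t. \<phi> (curve_fun \<gamma> t) $ i)"
    proof (rule lipschitz_onI)
      fix s t assume st: "s \<in> ?K" "t \<in> ?K"
      have "dist (\<phi> (curve_fun \<gamma> s) $ i) (\<phi> (curve_fun \<gamma> t) $ i)
          \<le> dist (\<phi> (curve_fun \<gamma> s)) (\<phi> (curve_fun \<gamma> t))"
        by (rule dist_vec_nth_le)
      also have "\<dots> \<le> M * dist (curve_fun \<gamma> s) (curve_fun \<gamma> t)" using lipschitz_onD[OF lip] by simp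
      also have "\<dots> \<le> M * (L * dist s t)" using lipschitz_onD[OF L(2) st] M by (intro mult_left_mono)
      finally show "dist (\<phi> (curve_fun \<gamma> s) $ i) (\<phi> (curve_fun \<gamma> t) $ i) \<le> M * L * dist s t"
        by (simp add: mult.assoc)
    qed (use M L in simp)
    from lipschitz_extend_real[OF this curve_props(2)] show ?thesis by metis
  qed
  then obtain g where g: "\<And>i. (M * L)-lipschitz_on UNIV (g i)"
      "\<And>i t. t \<in> ?K \<Longrightarrow> g i t = \<phi> (curve_fun \<gamma> t) $ i" by metis
  \<comment> \<open>The components are extended separately, so the bound by the sum of the
    components costs a factor equal to the dimension; only finiteness of the constant
    matters.\<close>
  have "(real CARD('n) * (M * L))-lipschitz_on UNIV (\<lambda>t. (\<chi> i. g i t))"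
  proof (rule lipschitz_onI)
    fix s t :: real
    have "dist (\<chi> i. g i s) (\<chi> i. g i t) \<le> (\<Sum>i\<in>UNIV. \<bar>g i s - g i t\<bar>)"
      using norm_le_l1_cart[of "(\<chi> i. g i s) - (\<chi> i. g i t)"] by (simp add: dist_norm)
    also have "\<dots> \<le> (\<Sum>i\<in>(UNIV::'n set). M * L * dist s t)"
      using lipschitz_onD[OF g(1)] by (intro sum_mono) (auto simp: dist_real_def)
    finally show "dist (\<chi> i. g i s) (\<chi> i. g i t) \<le> real CARD('n) * (M * L) * dist s t" by simp
  qed (use M L in simp)
  moreover have "(\<chi> i. g i t) = \<phi> (curve_fun \<gamma> t)" if "t \<in> ?K" for t
    using g(2)[OF that] by (simp add: vec_eq_iff)
  ultimately show ?thesis unfolding lipschitz_extension_def by blast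
qed

text \<open>The derivative can be computed with any convenient extension \<open>g\<close>, for
  example a reparametrized one, instead of the one picked by \<open>SOME\<close>.\<close>

lemma curve_deriv_AE:
  fixes \<phi> :: "'a::metric_space \<Rightarrow> real ^ 'n"
  assumes g: "lipschitz_extension g \<phi> \<gamma>"
  shows "AE t in lborel. t \<in> curve_dom \<gamma> \<longrightarrow> (g has_vector_derivative curve_deriv \<phi> \<gamma> t) (at t)"
proof -
  define g0 where "g0 = (SOME g. lipschitz_extension g \<phi> \<gamma>)"
  have "lipschitz_extension g0 \<phi> \<gamma>" 
    unfolding g0_def by (rule someI[of "\<lambda>g. lipschitz_extension g \<phi> \<gamma>", OF g])
  then obtain L M where "L-lipschitz_on UNIV g" "M-lipschitz_on UNIV g0"
    "\<And>t. t \<in> curve_dom \<gamma> \<Longrightarrow> g t = g0 t"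
    using g unfolding lipschitz_extension_def by auto
  then have "AE t in lborel. t \<in> curve_dom \<gamma> \<longrightarrow>
      (\<exists>D. (g has_vector_derivative D) (at t) \<and> (g0 has_vector_derivative D) (at t))"
    by (rule lipschitz_vector_derivatives_agree_AE)
  then show ?thesis
    by eventually_elim (auto simp: curve_deriv_def vector_derivative_at simp flip: g0_def)
qed

lemma curve_exists:
  assumes "compact K" "K \<noteq> {}" "bilipschitz_on K f"
  obtains \<gamma> where "curve_dom \<gamma> = K" "\<And>t. t \<in> K \<Longrightarrow> curve_fun \<gamma> t = f t"
proof -
  have "bilipschitz_on K (restrict f K)" using assms(3) by (simp add: bilipschitz_on_def)
  then have "Rep_curve (Abs_curve (K, restrict f K)) = (K, restrict f K)"
    using assms by (intro Abs_curve_inverse) auto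
  then show ?thesis using that[of "Abs_curve (K, restrict f K)"]
    by (simp add: curve_dom_def curve_fun_def)
qed

lemma bilipschitz_on_curve: "K \<subseteq> curve_dom \<gamma> \<Longrightarrow> bilipschitz_on K (curve_fun \<gamma>)"
  using curve_props(4)[of \<gamma>] unfolding bilipschitz_on_def by blast

lemma curve_of_graph:
  fixes F :: "(real \<times> 'a::metric_space) set"
  assumes F: "compact F" "F \<noteq> {}" and "L > 0"
    and bi: "\<And>s x t y. (s, x) \<in> F \<Longrightarrow> (t, y) \<in> F \<Longrightarrow> dist s t / L \<le> dist x y \<and> dist x y \<le> L * dist s t"
  obtains \<gamma> where "curve_graph \<gamma> = F"
proof -
  define f where "f t = (SOME x. (t, x) \<in> F)" for t
  have f: "(t, f t) \<in> F" if t: "t \<in> fst ` F" for t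
  proof -
    obtain x where "(t, x) \<in> F" using t by auto
    then show ?thesis unfolding f_def by (rule someI)
  qed
  \<comment> \<open>For two points of \<open>F\<close> over the same time the upper bound reads
    \<open>dist x y \<le> 0\<close>, so \<open>F\<close> is a graph.\<close>
  have uniq: "x = f t" if "(t, x) \<in> F" for t x
    using bi[OF that f[of t]] that by force
  have "bilipschitz_on (fst ` F) f"
    unfolding bilipschitz_on_def using \<open>L > 0\<close> bi f by blast
  then obtain \<gamma> where g: "curve_dom \<gamma> = fst ` F" "\<And>t. t \<in> fst ` F \<Longrightarrow> curve_fun \<gamma> t = f t"
    using curve_exists[of "fst ` F" f] F compact_continuous_image[of F fst]
    by (auto simp: continuous_on_fst)
  have "curve_graph \<gamma> = F"
    unfolding curve_graph_def g(1) using g(2) f uniq by (force simp: image_iff)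
  then show ?thesis by (rule that)
qed

text \<open>The sign \<open>\<sigma> = - 1\<close> reverses time. It turns a curve that runs in the
  cone opposite to a given one into a curve that runs in it, which is how bounds on
  \<open>\<bar>v \<bullet> w\<bar>\<close> become cone conditions.\<close>

lemma subcurve_exists:
  fixes \<gamma> :: "'a::metric_space curve"
  assumes K: "compact K" "K \<noteq> {}" "K \<subseteq> curve_dom \<gamma>" and \<sigma>: "\<sigma> = 1 \<or> \<sigma> = (- 1 :: real)"
  obtains \<eta> where "curve_dom \<eta> = (*) \<sigma> ` K" "\<And>t. t \<in> K \<Longrightarrow> curve_fun \<eta> (\<sigma> * t) = curve_fun \<gamma> t"
    "curve_image \<eta> = curve_fun \<gamma> ` K"
proof -
  have inv: "\<sigma> * (\<sigma> * t) = t" for t using \<sigma> by auto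
  have sd: "dist (\<sigma> * s) (\<sigma> * t) = dist s t" for s t using \<sigma> by (auto simp: dist_real_def)
  obtain L where "L > 0" "\<forall>s\<in>K. \<forall>t\<in>K. dist s t / L \<le> dist (curve_fun \<gamma> s) (curve_fun \<gamma> t) \<and>
      dist (curve_fun \<gamma> s) (curve_fun \<gamma> t) \<le> L * dist s t"
    using bilipschitz_on_curve[OF K(3)] unfolding bilipschitz_on_def by blast
  then have "bilipschitz_on ((*) \<sigma> ` K) (\<lambda>t. curve_fun \<gamma> (\<sigma> * t))"
    unfolding bilipschitz_on_def by (intro exI[of _ L]) (auto simp: inv sd)
  then obtain \<eta> where \<eta>: "curve_dom \<eta> = (*) \<sigma> ` K"
      "\<And>t. t \<in> (*) \<sigma> ` K \<Longrightarrow> curve_fun \<eta> t = curve_fun \<gamma> (\<sigma> * t)"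
    using curve_exists[of "(*) \<sigma> ` K"] K(1,2) compact_continuous_image[of K "(*) \<sigma>"]
    by (auto simp: continuous_on_mult_left)
  then have "curve_image \<eta> = curve_fun \<gamma> ` K"
    unfolding curve_image_def by (auto simp: inv image_image)
  moreover have "curve_fun \<eta> (\<sigma> * t) = curve_fun \<gamma> t" if "t \<in> K" for t
    using \<eta>(2)[OF imageI[OF that]] by (simp add: inv)
  ultimately show ?thesis using that[of \<eta>] \<eta>(1) by blast
qed

lemma subcurve_deriv_AE:
  fixes \<phi> :: "'a::metric_space \<Rightarrow> real ^ 'n"
  assumes lip: "M-lipschitz_on UNIV \<phi>" and \<sigma>: "\<sigma> = 1 \<or> \<sigma> = (- 1 :: real)" and "K \<subseteq> curve_dom \<gamma>"
    and \<eta>: "curve_dom \<eta> = (*) \<sigma> ` K" "\<And>t. t \<in> K \<Longrightarrow> curve_fun \<eta> (\<sigma> * t) = curve_fun \<gamma> t"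
  shows "AE t in lborel. t \<in> curve_dom \<eta> \<longrightarrow> curve_deriv \<phi> \<eta> t = \<sigma> *\<^sub>R curve_deriv \<phi> \<gamma> (\<sigma> * t)"
proof -
  have inv: "\<sigma> * (\<sigma> * t) = t" for t using \<sigma> by auto
  have sd: "dist (\<sigma> * s) (\<sigma> * t) = dist s t" for s t using \<sigma> by (auto simp: dist_real_def)
  obtain g where g: "lipschitz_extension g \<phi> \<gamma>" using lipschitz_extension_exists[OF lip] by blast
  then obtain L where L: "L-lipschitz_on UNIV g" unfolding lipschitz_extension_def by blast
  have "L-lipschitz_on UNIV (\<lambda>t. g (\<sigma> * t))"
    using lipschitz_onD[OF L] lipschitz_on_nonneg[OF L] sd by (intro lipschitz_onI) (metis UNIV_I)+
  moreover have "\<forall>t\<in>curve_dom \<eta>. g (\<sigma> * t) = \<phi> (curve_fun \<eta> t)"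
    using g \<eta> assms(3) by (auto simp: lipschitz_extension_def inv)
  ultimately have h: "lipschitz_extension (\<lambda>t. g (\<sigma> * t)) \<phi> \<eta>"
    unfolding lipschitz_extension_def by blast
  have "AE t in lborel. t \<in> curve_dom \<gamma> \<longrightarrow> (g has_vector_derivative curve_deriv \<phi> \<gamma> t) (at t)"
    by (rule curve_deriv_AE[OF g])
  note ae = this
  have "AE t in distr lborel lborel ((*) \<sigma>). t \<in> curve_dom \<gamma> \<longrightarrow>
      (g has_vector_derivative curve_deriv \<phi> \<gamma> t) (at t)"
  proof -
    \<comment> \<open>Reflection preserves Lebesgue measure, so the exceptional null set of
      \<open>\<gamma>\<close> is carried to a null set for \<open>\<eta>\<close>.\<close>
    have "distr lborel lborel ((*) \<sigma>) = lborel"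
      using lborel_distr_mult'[of \<sigma>] \<sigma> distr_cong[of lborel lborel lborel borel "(*) \<sigma>" "(*) \<sigma>"]
      by (auto simp: density_1)
    then show ?thesis using ae by metis
  qed
  then have "AE t in lborel. \<sigma> * t \<in> curve_dom \<gamma> \<longrightarrow>
      (g has_vector_derivative curve_deriv \<phi> \<gamma> (\<sigma> * t)) (at (\<sigma> * t))"
    by (rule AE_distrD[rotated]) measurable
  with curve_deriv_AE[OF h] show ?thesis
  proof eventually_elim
    case (elim t)
    show ?case
    proof
      assume t: "t \<in> curve_dom \<eta>"
      then have "\<sigma> * t \<in> curve_dom \<gamma>" using \<eta> assms(3) by (auto simp: inv)
      then have "(g has_vector_derivative curve_deriv \<phi> \<gamma> (\<sigma> * t)) (at (\<sigma> * t))" using elim by blast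
      moreover have "((\<lambda>t. \<sigma> * t) has_vector_derivative \<sigma>) (at t)"
        by (auto intro!: derivative_eq_intros)
      ultimately have "((g \<circ> (\<lambda>t. \<sigma> * t)) has_vector_derivative \<sigma> *\<^sub>R curve_deriv \<phi> \<gamma> (\<sigma> * t)) (at t)"
        by (intro vector_diff_chain_at)
      then show "curve_deriv \<phi> \<eta> t = \<sigma> *\<^sub>R curve_deriv \<phi> \<gamma> (\<sigma> * t)"
        using elim t vector_derivative_unique_at by (auto simp: o_def)
    qed
  qed
qed

subsection \<open>Length measure on curves\<close>

text \<open>Lebesgue measure transported by the curve. Because curves are bi-Lipschitz, it has the
  same Borel null sets as \<open>hausdorff1\<close> on the image; moreover it is finite and depends
  semicontinuously on the curve.\<close>

definition curve_measure :: "'a::metric_space curve \<Rightarrow> 'a measure" where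
  "curve_measure \<gamma> = distr (restrict_space lborel (curve_dom \<gamma>)) borel (curve_fun \<gamma>)"

lemma sets_curve_measure [simp, measurable_cong]: "sets (curve_measure \<gamma>) = sets borel"
  by (simp add: curve_measure_def)

lemma space_curve_measure [simp]: "space (curve_measure \<gamma>) = UNIV"
  by (simp add: curve_measure_def)

lemma borel_curve_dom [measurable]: "curve_dom \<gamma> \<in> sets borel"
  by (intro borel_closed compact_imp_closed curve_props)

lemma measurable_curve_fun:
  "curve_fun \<gamma> \<in> borel_measurable (restrict_space borel (curve_dom \<gamma>))"
  by (intro borel_measurable_continuous_on_restrict curve_continuous_on)

lemma borel_curve_vimage:
  assumes "B \<in> sets borel" shows "{t \<in> curve_dom \<gamma>. curve_fun \<gamma> t \<in> B} \<in> sets borel"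
proof -
  have "curve_fun \<gamma> -` B \<inter> space (restrict_space borel (curve_dom \<gamma>))
      \<in> sets (restrict_space borel (curve_dom \<gamma>))"
    using measurable_curve_fun assms by (rule measurable_sets)
  then have "curve_fun \<gamma> -` B \<inter> curve_dom \<gamma> \<in> sets borel"
    by (simp add: sets_restrict_space_iff space_restrict_space)
  then show ?thesis by (simp add: Collect_conj_eq Int_commute vimage_def)
qed

lemma emeasure_curve_measure:
  assumes "B \<in> sets borel"
  shows "emeasure (curve_measure \<gamma>) B = emeasure lborel {t \<in> curve_dom \<gamma>. curve_fun \<gamma> t \<in> B}"
proof -
  have "curve_fun \<gamma> \<in> measurable (restrict_space lborel (curve_dom \<gamma>)) borel"
    by (subst measurable_cong_sets[OF sets_restrict_space_cong[OF sets_lborel] refl])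
       (rule measurable_curve_fun)
  then have "emeasure (curve_measure \<gamma>) B
      = emeasure (restrict_space lborel (curve_dom \<gamma>)) (curve_fun \<gamma> -` B \<inter> curve_dom \<gamma>)"
    unfolding curve_measure_def using assms by (simp add: emeasure_distr space_restrict_space)
  also have "\<dots> = emeasure lborel (curve_fun \<gamma> -` B \<inter> curve_dom \<gamma>)"
    by (intro emeasure_restrict_space) auto
  also have "curve_fun \<gamma> -` B \<inter> curve_dom \<gamma> = {t \<in> curve_dom \<gamma>. curve_fun \<gamma> t \<in> B}" by auto
  finally show ?thesis .
qed

lemma compact_curve_image: "compact (curve_image \<gamma>)"
  unfolding curve_image_def by (intro compact_continuous_image curve_continuous_on curve_props)

lemma measurable_the_inv_curve:
  "the_inv_into (curve_dom \<gamma>) (curve_fun \<gamma>) \<in> borel_measurable (restrict_space borel (curve_image \<gamma>))"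
  unfolding curve_image_def
  by (intro borel_measurable_continuous_on_restrict continuous_on_inv curve_continuous_on curve_props)
     (auto intro: the_inv_into_f_f curve_inj_on)

lemma curve_fun_image_eq:
  "curve_fun \<gamma> ` (N \<inter> curve_dom \<gamma>)
    = the_inv_into (curve_dom \<gamma>) (curve_fun \<gamma>) -` N \<inter> curve_image \<gamma>"
  unfolding curve_image_def using the_inv_into_f_f[OF curve_inj_on[of \<gamma>]] by force

lemma borel_curve_fun_image:
  assumes "N \<in> sets borel" shows "curve_fun \<gamma> ` (N \<inter> curve_dom \<gamma>) \<in> sets borel"
proof -
  have "the_inv_into (curve_dom \<gamma>) (curve_fun \<gamma>) -` N \<inter> space (restrict_space borel (curve_image \<gamma>))
      \<in> sets (restrict_space borel (curve_image \<gamma>))"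
    using measurable_the_inv_curve assms by (rule measurable_sets)
  moreover have "curve_image \<gamma> \<in> sets borel"
    by (intro borel_closed compact_imp_closed compact_curve_image)
  ultimately show ?thesis
    by (simp add: sets_restrict_space_iff space_restrict_space curve_fun_image_eq)
qed

lemma emeasure_pullback_measure:
  assumes \<nu>: "sets \<nu> = sets borel" and N: "N \<in> sets borel"
  shows "emeasure (pullback_measure \<gamma> \<nu>) N = emeasure \<nu> (curve_fun \<gamma> ` (N \<inter> curve_dom \<gamma>))"
proof -
  let ?i = "the_inv_into (curve_dom \<gamma>) (curve_fun \<gamma>)"
  have im: "curve_image \<gamma> \<in> sets \<nu>"
    unfolding \<nu> by (intro borel_closed compact_imp_closed compact_curve_image)
  have sp: "space \<nu> = UNIV" using sets_eq_imp_space_eq[OF \<nu>] by simp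
  have "?i \<in> measurable (restrict_space \<nu> (curve_image \<gamma>)) borel"
    by (subst measurable_cong_sets[OF sets_restrict_space_cong[OF \<nu>] refl])
       (rule measurable_the_inv_curve)
  then have "emeasure (pullback_measure \<gamma> \<nu>) N
      = emeasure (restrict_space \<nu> (curve_image \<gamma>)) (?i -` N \<inter> curve_image \<gamma>)"
    unfolding pullback_measure_def using N sp by (simp add: emeasure_distr space_restrict_space)
  also have "\<dots> = emeasure \<nu> (?i -` N \<inter> curve_image \<gamma>)"
    using im sp by (intro emeasure_restrict_space) auto
  finally show ?thesis by (simp add: curve_fun_image_eq)
qed

text \<open>The inverse of the curve is \<open>L\<close>-Lipschitz, so a covering of the image by
  sets of diameter \<open>d\<close> gives a covering of \<open>T\<close> by intervals of radius
  \<open>L * d\<close>.\<close>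

lemma curve_image_hausdorff1_null_imp_negligible:
  assumes T: "T \<subseteq> curve_dom \<gamma>" and 0: "hausdorff1 (curve_fun \<gamma> ` T) = 0"
  shows "negligible T"
  unfolding negligible_outer_le
proof (intro allI impI)
  fix e :: real assume e: "e > 0"
  obtain L where L: "L > 0" "\<And>s t. s \<in> curve_dom \<gamma> \<Longrightarrow> t \<in> curve_dom \<gamma> \<Longrightarrow>
       dist s t \<le> L * dist (curve_fun \<gamma> s) (curve_fun \<gamma> t)"
    using curve_lipschitz[of \<gamma>] by metis
  let ?\<F> = "{F :: nat \<Rightarrow> 'a set. curve_fun \<gamma> ` T \<subseteq> (\<Union>i. F i) \<and> (\<forall>i. bounded (F i) \<and> diameter (F i) \<le> 1)}"
  have "(INF F\<in>?\<F>. \<Sum>i. ennreal (diameter (F i))) \<le> hausdorff1 (curve_fun \<gamma> ` T)"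
    unfolding hausdorff1_def by (rule SUP_upper) simp
  \<comment> \<open>An interval of radius \<open>L * diameter (F i)\<close> has twice that length,
    hence the factor \<open>2 * L\<close>. Coverings at the single scale 1 already give the
    estimate.\<close>
  also have "\<dots> < ennreal (e / (2 * L))" using 0 e L by simp
  finally obtain F where F: "curve_fun \<gamma> ` T \<subseteq> (\<Union>i. F i)" "\<And>i. bounded (F i)"
      "(\<Sum>i. ennreal (diameter (F i))) < ennreal (e / (2 * L))"
    unfolding INF_less_iff by blast
  \<comment> \<open>A time at which the curve meets \<open>F i\<close>. If there is none, the value
    is arbitrary, and the interval around it still respects the length bound.\<close>
  define c where "c i = (SOME t. t \<in> T \<and> curve_fun \<gamma> t \<in> F i)" for i
  define I where "I i = cball (c i) (L * diameter (F i))" for i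
  have "T \<subseteq> (\<Union>i. I i)"
  proof
    fix t assume t: "t \<in> T"
    then obtain i where i: "curve_fun \<gamma> t \<in> F i" using F(1) by blast
    have c: "c i \<in> T \<and> curve_fun \<gamma> (c i) \<in> F i" unfolding c_def by (rule someI[of _ t]) (use t i in simp)
    have "dist (c i) t \<le> L * dist (curve_fun \<gamma> (c i)) (curve_fun \<gamma> t)" using L(2) c t T by blast
    also have "\<dots> \<le> L * diameter (F i)"
      using diameter_bounded_bound[OF F(2)] c i L(1) by (intro mult_left_mono) auto
    finally show "t \<in> (\<Union>i. I i)" by (auto simp: I_def)
  qed
  moreover have le: "emeasure lborel (\<Union>i. I i) \<le> ennreal e"
  proof -
    have "emeasure lborel (\<Union>i. I i) \<le> (\<Sum>i. emeasure lborel (I i))"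
      by (rule emeasure_subadditive_countably) (auto simp: I_def)
    also have "\<dots> = (\<Sum>i. ennreal (2 * L) * ennreal (diameter (F i)))"
    proof (intro arg_cong[where f = suminf] ext)
      fix i
      have "0 \<le> L * diameter (F i)" using L(1) diameter_ge_0[OF F(2)] by simp
      then have "emeasure lborel (I i) = ennreal (2 * L * diameter (F i))"
        by (simp add: I_def cball_eq_atLeastAtMost)
      then show "emeasure lborel (I i) = ennreal (2 * L) * ennreal (diameter (F i))"
        using L(1) diameter_ge_0[OF F(2)] by (simp add: ennreal_mult)
    qed
    also have "\<dots> = ennreal (2 * L) * (\<Sum>i. ennreal (diameter (F i)))" by (rule ennreal_suminf_cmult)
    also have "\<dots> \<le> ennreal (2 * L) * ennreal (e / (2 * L))" using F(3) by (intro mult_left_mono) auto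
    also have "\<dots> = ennreal e" using L(1) e by (simp flip: ennreal_mult)
    finally show ?thesis .
  qed
  moreover have m: "(\<Union>i. I i) \<in> sets borel" by (auto simp: I_def)
  moreover have "(\<Union>i. I i) \<in> lmeasurable"
    using le m by (intro fmeasurableI) (auto simp: le_less_trans[OF le])
  moreover have "measure lebesgue (\<Union>i. I i) \<le> e"
    using le m e by (simp add: measure_def enn2real_leI)
  ultimately show "\<exists>S. T \<subseteq> S \<and> S \<in> lmeasurable \<and> measure lebesgue S \<le> e" by blast
qed

text \<open>Intervals of total length \<open>h\<close> that cover \<open>T\<close> have images of
  total diameter at most \<open>L * h\<close>. The intervals may share endpoints, so their lengths
  are summed through their interiors, which are pairwise disjoint.\<close>

lemma curve_image_negligible_imp_hausdorff1_null:
  assumes T: "T \<subseteq> curve_dom \<gamma>" and 0: "negligible T"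
  shows "hausdorff1 (curve_fun \<gamma> ` T) = 0"
proof -
  obtain L where L: "L > 0" "L-lipschitz_on (curve_dom \<gamma>) (curve_fun \<gamma>)"
    by (rule curve_lipschitz[of \<gamma>])
  obtain b where b: "b > 0" "curve_dom \<gamma> \<subseteq> cbox (- b) b"
  proof -
    have "bounded (curve_dom \<gamma>)" by (intro compact_imp_bounded curve_props)
    then obtain b where "\<And>x. x \<in> curve_dom \<gamma> \<Longrightarrow> norm x \<le> b" "b > 0" by (meson bounded_pos)
    then show ?thesis by (intro that[of b]) (auto simp: abs_le_iff minus_le_iff)
  qed
  have "(INF F\<in>{F. curve_fun \<gamma> ` T \<subseteq> (\<Union>i::nat. F i) \<and> (\<forall>i. bounded (F i) \<and> diameter (F i) \<le> d)}.
      \<Sum>i. ennreal (diameter (F i))) \<le> ennreal e" if d: "d > 0" and e: "e > 0" for d e :: real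
  proof -
    \<comment> \<open>The bound \<open>L * h\<close> has to be at most the scale \<open>d\<close>
      and at most the total \<open>e\<close>.\<close>
    define h where "h = min d e / L"
    have h: "h > 0" "L * h \<le> d" "L * h \<le> e" using L(1) d e by (auto simp: h_def)
    have "T \<in> lmeasurable" "measure lebesgue T = 0"
      using 0 by (simp_all add: negligible_imp_measurable negligible_imp_measure0)
    moreover have "T \<subseteq> cbox (- b) b" using T b by blast
    ultimately obtain \<D> where \<D>: "countable \<D>"
        "\<And>K. K \<in> \<D> \<Longrightarrow> K \<subseteq> cbox (- b) b \<and> K \<noteq> {} \<and> (\<exists>c d. K = cbox c d)"
        "pairwise (\<lambda>A B. interior A \<inter> interior B = {}) \<D>"
        "T \<subseteq> \<Union>\<D>" "\<Union>\<D> \<in> lmeasurable" "measure lebesgue (\<Union>\<D>) \<le> h"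
      using measurable_outer_intervals_bounded[of T "- b" b h] h by (metis add_0)
    define J where "J = to_nat_on \<D> ` \<D>"
    define K where "K = from_nat_into \<D>"
    \<comment> \<open>\<open>\<D>\<close> may be finite; indices outside \<open>J\<close> contribute
      the empty set, of diameter 0.\<close>
    define F where "F i = (if i \<in> J then curve_fun \<gamma> ` (T \<inter> K i) else {})" for i
    have KD: "K i \<in> \<D>" if "i \<in> J" for i using that \<D>(1) by (auto simp: J_def K_def)
    have Kinj: "inj_on K J" using \<D>(1) by (auto simp: J_def K_def inj_on_def)
    define len where "len i = (if i \<in> J then measure lborel (interior (K i)) else 0)" for i
    have Kbox: "\<exists>c d. c \<le> d \<and> K i = {c..d} \<and> interior (K i) = {c<..<d} \<and> len i = d - c" if i: "i \<in> J" for i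
    proof -
      obtain c d where "K i = cbox c d" "K i \<noteq> {}" using \<D>(2)[OF KD[OF i]] by blast
      then have "c \<le> d" "K i = {c..d}" "interior (K i) = {c<..<d}" by auto
      then show ?thesis using i by (auto simp: len_def)
    qed
    have len0: "len i \<ge> 0" for i by (simp add: len_def)
    have sum: "(\<Sum>i<n. len i) \<le> h" for n
    proof -
      let ?G = "{..<n} \<inter> J"
      have "(\<Sum>i<n. len i) = (\<Sum>i\<in>?G. measure lborel (interior (K i)))"
        by (auto simp: len_def sum.inter_restrict)
      also have "\<dots> = measure lborel (\<Union>i\<in>?G. interior (K i))"
      proof (rule measure_finite_Union[symmetric])
        show "disjoint_family_on (\<lambda>i. interior (K i)) ?G"
          unfolding disjoint_family_on_def
          using \<D>(3) KD Kinj by (auto simp: pairwise_def inj_on_def) (metis disjoint_iff)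
        show "emeasure lborel (interior (K i)) \<noteq> \<infinity>" if "i \<in> ?G" for i
          using Kbox[of i] that by auto
      qed auto
      also have "\<dots> = measure lebesgue (\<Union>i\<in>?G. interior (K i))"
        by (intro measure_completion[symmetric]) auto
      also have "\<dots> \<le> measure lebesgue (\<Union>\<D>)"
      proof (rule measure_mono_fmeasurable[OF _ _ \<D>(5)])
        show "(\<Union>i\<in>?G. interior (K i)) \<subseteq> \<Union>\<D>" using KD interior_subset by blast
      qed auto
      finally show ?thesis using \<D>(6) by simp
    qed
    have len_le: "len i \<le> h" for i
      using sum[of "Suc i"] sum_nonneg[of "{..<i}" len] len0 by simp
    have diam: "bounded (F i) \<and> diameter (F i) \<le> L * len i" for i
    proof (cases "i \<in> J")
      case True
      then obtain c d where cd: "c \<le> d" "K i = {c..d}" "len i = d - c" using Kbox by blast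
      have Fd: "dist x y \<le> L * len i" if xy: "x \<in> F i" "y \<in> F i" for x y
      proof -
        obtain s t where st: "x = curve_fun \<gamma> s" "y = curve_fun \<gamma> t" "s \<in> T" "t \<in> T" "s \<in> K i" "t \<in> K i"
          using xy True by (auto simp: F_def)
        have "dist x y \<le> L * dist s t" using lipschitz_onD[OF L(2)] st T by blast
        also have "\<dots> \<le> L * len i" using st cd L(1) by (intro mult_left_mono) (auto simp: dist_real_def)
        finally show ?thesis .
      qed
      have "diameter (F i) \<le> L * len i"
        using Fd len0[of i] L(1) by (auto simp: diameter_def intro!: cSUP_least)
      moreover have "bounded (F i)" using Fd by (auto simp: bounded_two_points)
      ultimately show ?thesis by blast
    qed (use len0 L in \<open>auto simp: F_def\<close>)
    have "curve_fun \<gamma> ` T \<subseteq> (\<Union>i. F i)"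
    proof
      fix x assume "x \<in> curve_fun \<gamma> ` T"
      then obtain t where t: "t \<in> T" "x = curve_fun \<gamma> t" by blast
      then obtain A where A: "A \<in> \<D>" "t \<in> A" using \<D>(4) by blast
      then have "K (to_nat_on \<D> A) = A" "to_nat_on \<D> A \<in> J" using \<D>(1) by (auto simp: K_def J_def)
      then have "x \<in> F (to_nat_on \<D> A)" using t A by (auto simp: F_def)
      then show "x \<in> (\<Union>i. F i)" by blast
    qed
    moreover have "bounded (F i) \<and> diameter (F i) \<le> d" for i
    proof -
      have "L * len i \<le> L * h" using len_le L(1) by simp
      then show ?thesis using diam[of i] h(2) by linarith
    qed
    moreover have "(\<Sum>i. ennreal (diameter (F i))) \<le> ennreal e"
    proof (rule suminf_le_const)
      fix n
      have "(\<Sum>i<n. ennreal (diameter (F i))) \<le> (\<Sum>i<n. ennreal (L * len i))"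
        using diam by (intro sum_mono ennreal_leI) auto
      also have "\<dots> = ennreal (L * (\<Sum>i<n. len i))"
        using L(1) len0 by (simp add: sum_ennreal sum_distrib_left)
      also have "\<dots> \<le> ennreal (L * h)" using sum L(1) by (intro ennreal_leI) simp
      finally show "(\<Sum>i<n. ennreal (diameter (F i))) \<le> ennreal e"
        using h(3) ennreal_leI order_trans by blast
    qed simp
    ultimately show ?thesis by (intro INF_lower2[of F]) auto
  qed
  note le = this
  have "(INF F\<in>{F. curve_fun \<gamma> ` T \<subseteq> (\<Union>i::nat. F i) \<and> (\<forall>i. bounded (F i) \<and> diameter (F i) \<le> d)}.
      \<Sum>i. ennreal (diameter (F i))) \<le> 0" (is "?I \<le> 0") if "d > 0" for d
  proof (rule ennreal_le_epsilon)
    fix e :: real assume "0 < e"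
    from le[OF that this] show "?I \<le> 0 + ennreal e" unfolding add_0 .
  qed
  then have "hausdorff1 (curve_fun \<gamma> ` T) \<le> 0"
    unfolding hausdorff1_def by (intro SUP_least) auto
  then show ?thesis by simp
qed

text \<open>A null set of times has an image that is null for \<open>curve_measure\<close>, hence
  for every density with respect to it.\<close>

lemma pullback_measure_density_AE:
  assumes f: "f \<in> borel_measurable borel" and P: "AE t in lborel. t \<in> curve_dom \<gamma> \<longrightarrow> P t"
  shows "AE t in pullback_measure \<gamma> (density (curve_measure \<gamma>) f). P t"
proof -
  let ?\<nu> = "density (curve_measure \<gamma>) f"
  obtain N where N: "N \<in> null_sets lborel" "{t. \<not> (t \<in> curve_dom \<gamma> \<longrightarrow> P t)} \<subseteq> N"
    using P by (auto simp: eventually_ae_filter)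
  \<comment> \<open>Times outside the domain have no mass under the pull-back, so they may be added
    to the exceptional set.\<close>
  define N' where "N' = N \<union> - curve_dom \<gamma>"
  have N': "N' \<in> sets borel" using N(1) by (auto simp: N'_def null_sets_def)
  have im: "curve_fun \<gamma> ` (N \<inter> curve_dom \<gamma>) \<in> sets borel"
    using N(1) by (intro borel_curve_fun_image) auto
  have "{t \<in> curve_dom \<gamma>. curve_fun \<gamma> t \<in> curve_fun \<gamma> ` (N \<inter> curve_dom \<gamma>)} = N \<inter> curve_dom \<gamma>"
    using curve_inj_on[of \<gamma>] by (auto dest: inj_onD)
  then have "emeasure (curve_measure \<gamma>) (curve_fun \<gamma> ` (N \<inter> curve_dom \<gamma>)) = 0"
    using null_setsD1[OF null_set_Int2[OF N(1), of "curve_dom \<gamma>"]]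
    by (simp add: emeasure_curve_measure[OF im])
  then have "curve_fun \<gamma> ` (N \<inter> curve_dom \<gamma>) \<in> null_sets (curve_measure \<gamma>)"
    using im by auto
  then have "AE x in curve_measure \<gamma>. x \<notin> curve_fun \<gamma> ` (N \<inter> curve_dom \<gamma>)"
    by (rule AE_not_in)
  then have "curve_fun \<gamma> ` (N \<inter> curve_dom \<gamma>) \<in> null_sets ?\<nu>"
    using f im by (subst null_sets_density_iff) (auto elim: eventually_mono)
  moreover have "N' \<inter> curve_dom \<gamma> = N \<inter> curve_dom \<gamma>" by (auto simp: N'_def)
  ultimately have "emeasure (pullback_measure \<gamma> ?\<nu>) N' = 0"
    using N' null_setsD1 by (simp add: emeasure_pullback_measure)
  then have "N' \<in> null_sets (pullback_measure \<gamma> ?\<nu>)"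
    using N' by (auto simp: null_sets_def pullback_measure_def)
  then show ?thesis by (rule AE_I') (use N(2) in \<open>auto simp: N'_def\<close>)
qed

section \<open>Curves with uniformly controlled secants\<close>

text \<open>
  In the relation below, \<open>\<tau> = t - s\<close> multiplies the cone condition so that it does not depend on the
  order of \<open>s\<close> and \<open>t\<close>; it is vacuous for \<open>s = t\<close>, which makes the relation closed.
\<close>

definition secant_rel ::
    "('a::metric_space \<Rightarrow> real ^ 'n) \<Rightarrow> real ^ 'n \<Rightarrow> real \<Rightarrow> real \<Rightarrow> ((real \<times> 'a) \<times> (real \<times> 'a)) set" where
  "secant_rel \<phi> w \<theta> N = {((s, x), (t, y)).
     dist s t / N \<le> dist x y \<and> dist x y \<le> N * dist s t \<and> dist s t / N \<le> norm (\<phi> y - \<phi> x) \<and>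
     (1 - \<theta>) * (norm (\<phi> y - \<phi> x) * \<bar>t - s\<bar>) \<le> (t - s) * ((\<phi> y - \<phi> x) \<bullet> w)}"

lemma closed_secant_rel:
  assumes "continuous_on UNIV \<phi>" and "N > 0"
  shows "closed (secant_rel \<phi> w \<theta> N)"
proof -
  have c: "continuous_on UNIV (\<lambda>p. \<phi> (f p))" if "continuous_on UNIV f"
    for f :: "((real \<times> 'a) \<times> (real \<times> 'a)) \<Rightarrow> 'a"
    using continuous_on_compose2[OF assms(1) that] by simp
  show ?thesis
    unfolding secant_rel_def case_prod_unfold
    by (intro closed_Collect_conj closed_Collect_le continuous_intros c)
       (use assms(2) in auto)
qed

lemma has_vector_derivative_slope:
  assumes "(f has_vector_derivative D) (at x within S)"
  shows "((\<lambda>y. (f y - f x) /\<^sub>R (y - x)) \<longlongrightarrow> D) (at x within S)"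
proof -
  have "norm ((f y - f x) /\<^sub>R (y - x) - D) = norm ((f y - f x) - (y - x) *\<^sub>R D) / norm (y - x)"
    if "y \<noteq> x" for y
  proof -
    have "(f y - f x) /\<^sub>R (y - x) - D = ((f y - f x) - (y - x) *\<^sub>R D) /\<^sub>R (y - x)"
      using that by (simp add: scaleR_diff_right)
    then show ?thesis by (simp add: divide_inverse mult.commute)
  qed
  then have "\<forall>\<^sub>F y in at x within S. norm ((f y - f x) - (y - x) *\<^sub>R D) / norm (y - x)
      = norm ((f y - f x) /\<^sub>R (y - x) - D)"
    by (auto simp: eventually_at_filter)
  moreover have "((\<lambda>y. norm ((f y - f x) - (y - x) *\<^sub>R D) / norm (y - x)) \<longlongrightarrow> 0) (at x within S)"
    using assms by (simp add: has_vector_derivative_def has_derivative_iff_norm)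
  ultimately have "((\<lambda>y. norm ((f y - f x) /\<^sub>R (y - x) - D)) \<longlongrightarrow> 0) (at x within S)"
    by (rule Lim_transform_eventually[rotated])
  from LIM_zero_cancel[OF tendsto_norm_zero_cancel[OF this]] show ?thesis .
qed

text \<open>For distinct times the cone condition can be divided by
  \<open>(s - t)\<^sup>2 > 0\<close>; the relation then speaks of the difference quotient.\<close>

lemma secant_rel_iff_slope:
  assumes "s \<noteq> t" "N > 0"
  shows "((t, x), (s, y)) \<in> secant_rel \<phi> w \<theta> N \<longleftrightarrow>
    dist t s / N \<le> dist x y \<and> dist x y \<le> N * dist t s \<and>
    1 / N \<le> norm ((\<phi> y - \<phi> x) /\<^sub>R (s - t)) \<and> (\<phi> y - \<phi> x) /\<^sub>R (s - t) \<in> closed_cone w \<theta>"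
proof -
  define D where "D = \<phi> y - \<phi> x"
  define a where "a = \<bar>s - t\<bar>"
  have a: "a > 0" using assms by (simp add: a_def)
  have n: "norm (D /\<^sub>R (s - t)) = norm D / a" by (simp add: a_def divide_inverse mult.commute)
  have sq: "(s - t)\<^sup>2 = a * a" by (simp add: a_def power2_eq_square)
  have in_w: "(D /\<^sub>R (s - t)) \<bullet> w = ((s - t) * (D \<bullet> w)) / (s - t)\<^sup>2"
    using assms(1) by (simp add: power2_eq_square divide_inverse)
  have "1 / N \<le> norm D / a \<longleftrightarrow> dist t s / N \<le> norm D"
    using a assms(2) by (simp add: a_def dist_real_def pos_le_divide_eq abs_minus_commute)
  moreover have "(1 - \<theta>) * (norm D * a) \<le> (s - t) * (D \<bullet> w) \<longleftrightarrow> (D /\<^sub>R (s - t)) \<in> closed_cone w \<theta>"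
  proof -
    have "(1 - \<theta>) * (norm D / a) = ((1 - \<theta>) * (norm D * a)) / (s - t)\<^sup>2" using a unfolding sq by simp
    moreover have "(s - t)\<^sup>2 > 0" using assms(1) by simp
    ultimately show ?thesis unfolding closed_cone_def mem_Collect_eq n in_w
      by (simp add: divide_le_cancel)
  qed
  ultimately show ?thesis 
    by (auto simp: secant_rel_def n D_def[symmetric] a_def[symmetric] simp del: norm_scaleR)
qed

text \<open>At a limit point of the domain the derivative is a limit of secant slopes. The closed
  cone contains the limit, and the lower bound \<open>1 / N\<close> on the slopes keeps it away from
  0.\<close>

lemma secant_curve_direction:
  fixes \<phi> :: "'a::metric_space \<Rightarrow> real ^ 'n"
  assumes lip: "M-lipschitz_on UNIV \<phi>" and "N > 0"
    and rel: "curve_graph \<gamma> \<times> curve_graph \<gamma> \<subseteq> secant_rel \<phi> w \<theta> N"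
  shows "AE t in lborel. t \<in> curve_dom \<gamma> \<longrightarrow> curve_deriv \<phi> \<gamma> t \<in> closed_cone w \<theta> - {0}"
proof -
  obtain g where g: "lipschitz_extension g \<phi> \<gamma>" using lipschitz_extension_exists[OF lip] by blast
  have sec: "norm ((g s - g t) /\<^sub>R (s - t)) \<ge> 1 / N"
     "(g s - g t) /\<^sub>R (s - t) \<in> closed_cone w \<theta>"
    if st: "s \<in> curve_dom \<gamma>" "t \<in> curve_dom \<gamma>" and "s \<noteq> t" for s t
  proof -
    have eq: "\<phi> (curve_fun \<gamma> s) = g s" "\<phi> (curve_fun \<gamma> t) = g t"
      using g st by (simp_all add: lipschitz_extension_def)
    have "((t, curve_fun \<gamma> t), (s, curve_fun \<gamma> s)) \<in> secant_rel \<phi> w \<theta> N"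
      using rel st by (auto simp: curve_graph_def)
    from iffD1[OF secant_rel_iff_slope[OF \<open>s \<noteq> t\<close> \<open>N > 0\<close>] this, unfolded eq]
    show "norm ((g s - g t) /\<^sub>R (s - t)) \<ge> 1 / N"
      "(g s - g t) /\<^sub>R (s - t) \<in> closed_cone w \<theta>" by blast+
  qed
  show ?thesis
    using curve_deriv_AE[OF g] AE_islimpt[of "curve_dom \<gamma>"]
  proof eventually_elim
    case (elim t)
    show ?case
    proof
      assume t: "t \<in> curve_dom \<gamma>"
      let ?F = "at t within curve_dom \<gamma>"
      have nb: "\<not> trivial_limit ?F" using elim t by (simp add: trivial_limit_within)
      have "(g has_vector_derivative curve_deriv \<phi> \<gamma> t) ?F"
        using elim t by (auto intro: has_vector_derivative_at_within)
      then have lim: "((\<lambda>s. (g s - g t) /\<^sub>R (s - t)) \<longlongrightarrow> curve_deriv \<phi> \<gamma> t) ?F"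
        by (rule has_vector_derivative_slope)
      have ev: "\<forall>\<^sub>F s in ?F. s \<in> curve_dom \<gamma> \<and> s \<noteq> t"
        by (auto simp: eventually_at_filter)
      have "closed (closed_cone w \<theta>)"
        unfolding closed_cone_def by (intro closed_Collect_le continuous_intros)
      then have "curve_deriv \<phi> \<gamma> t \<in> closed_cone w \<theta>"
        by (rule Lim_in_closed_set[OF _ _ nb lim]) (use ev sec(2) t in \<open>auto elim: eventually_mono\<close>)
      moreover have "norm (curve_deriv \<phi> \<gamma> t) \<ge> 1 / N"
        by (rule tendsto_lowerbound[OF tendsto_norm[OF lim] _ nb])
           (use ev sec(1) t in \<open>auto elim: eventually_mono\<close>)
      ultimately show "curve_deriv \<phi> \<gamma> t \<in> closed_cone w \<theta> - {0}" using \<open>N > 0\<close> by auto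
    qed
  qed
qed

section \<open>Semicontinuity of \<open>curve_measure\<close> on closed sets\<close>

lemma curve_measure_finite: "finite_measure (curve_measure \<gamma>)"
proof
  have "emeasure lborel (curve_dom \<gamma>) < \<infinity>"
    by (intro emeasure_compact_finite curve_props)
  then show "emeasure (curve_measure \<gamma>) (space (curve_measure \<gamma>)) \<noteq> \<infinity>"
    by (simp add: emeasure_curve_measure)
qed

lemma compact_infdist_attained:
  fixes A :: "'a::metric_space set"
  assumes "compact A" "A \<noteq> {}"
  obtains q where "q \<in> A" "infdist p A = dist p q"
proof -
  obtain q where q: "q \<in> A" "\<And>y. y \<in> A \<Longrightarrow> dist p q \<le> dist p y"
    using continuous_attains_inf[OF assms continuous_on_dist[OF continuous_on_const continuous_on_id]]
    by blast
  have "infdist p A = dist p q"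
    using q assms(2) by (intro antisym infdist_le) (auto simp: infdist_notempty intro: cINF_greatest)
  with q(1) show ?thesis by (rule that)
qed

text \<open>Graph points of \<open>\<gamma> k\<close> are within
  \<open>dist (\<gamma> k) \<eta>\<close> of the compact graph of \<open>\<eta>\<close>, so along a
  subsequence the points over the fixed time \<open>t\<close> converge to a point of that
  graph.\<close>

lemma curve_limit_points:
  assumes lim: "\<gamma> \<longlonglongrightarrow> \<eta>" and inf: "\<exists>\<^sub>\<infinity>k. t \<in> curve_dom (\<gamma> k) \<and> curve_fun (\<gamma> k) t \<in> B" and "closed B"
  shows "t \<in> curve_dom \<eta> \<and> curve_fun \<eta> t \<in> B"
proof -
  obtain r :: "nat \<Rightarrow> nat" where r: "strict_mono r"
      "\<And>k. t \<in> curve_dom (\<gamma> (r k)) \<and> curve_fun (\<gamma> (r k)) t \<in> B"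
    using inf infinite_enumerate[of "{k. t \<in> curve_dom (\<gamma> k) \<and> curve_fun (\<gamma> k) t \<in> B}"]
    by (auto simp: INFM_iff_infinite)
  define p where "p k = (t, curve_fun (\<gamma> (r k)) t)" for k
  have d0: "(\<lambda>k. dist (\<gamma> (r k)) \<eta>) \<longlonglongrightarrow> 0"
    using LIMSEQ_subseq_LIMSEQ[OF lim r(1)] tendsto_dist_iff[THEN iffD1] by (force simp: o_def)
  have "\<exists>q\<in>curve_graph \<eta>. dist (p k) q \<le> dist (\<gamma> (r k)) \<eta>" for k
  proof -
    obtain q where q: "q \<in> curve_graph \<eta>" "infdist (p k) (curve_graph \<eta>) = dist (p k) q"
      using compact_infdist_attained[OF curve_graph_compact curve_graph_nonempty] by blast
    have "p k \<in> curve_graph (\<gamma> (r k))" using r(2) by (auto simp: p_def curve_graph_def)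
    then show ?thesis
      using q infdist_le_hausdorff_dist[OF curve_graph_compact, of "p k" "\<gamma> (r k)" "curve_graph \<eta>"]
      unfolding dist_curve_def by auto
  qed
  then obtain q where q: "\<And>k. q k \<in> curve_graph \<eta>" "\<And>k. dist (p k) (q k) \<le> dist (\<gamma> (r k)) \<eta>"
    by metis
  obtain l r' where l: "l \<in> curve_graph \<eta>" "strict_mono (r' :: nat \<Rightarrow> nat)" "(q \<circ> r') \<longlonglongrightarrow> l"
    using curve_graph_compact[of \<eta>] q(1) unfolding compact_def by blast
  have "(\<lambda>k. p (r' k)) \<longlonglongrightarrow> l"
  proof (rule tendsto_dist_iff[THEN iffD2], rule tendsto_sandwich[OF _ _ tendsto_const])
    have "(\<lambda>k. dist (\<gamma> (r (r' k))) \<eta>) \<longlonglongrightarrow> 0"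
      using LIMSEQ_subseq_LIMSEQ[OF d0 l(2)] by (simp add: o_def)
    moreover have "(\<lambda>k. dist (q (r' k)) l) \<longlonglongrightarrow> 0"
      using tendsto_dist_iff[THEN iffD1, OF l(3)] by (simp add: o_def)
    ultimately show "(\<lambda>k. dist (\<gamma> (r (r' k))) \<eta> + dist (q (r' k)) l) \<longlonglongrightarrow> 0"
      using tendsto_add by force
    show "\<forall>\<^sub>F k in sequentially. dist (p (r' k)) l \<le> dist (\<gamma> (r (r' k))) \<eta> + dist (q (r' k)) l"
      using dist_triangle[of "p (r' _)" l "q (r' _)"] q(2) add_right_mono order_trans
      by (intro always_eventually allI) blast
  qed auto
  from tendsto_fst[OF this] tendsto_snd[OF this]
  have "(\<lambda>k. t) \<longlonglongrightarrow> fst l" and snd: "(\<lambda>k. curve_fun (\<gamma> (r (r' k))) t) \<longlonglongrightarrow> snd l"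
    by (simp_all add: p_def)
  then have "fst l = t" by (metis LIMSEQ_unique tendsto_const)
  moreover have "snd l \<in> B"
    using closed_sequentially[OF \<open>closed B\<close> _ snd] r(2) by blast
  ultimately show ?thesis using l(1) by (auto simp: curve_graph_def)
qed

text \<open>Upper semicontinuity: the upper limit of the time sets of \<open>\<gamma> k\<close> lies
  in the time set of \<open>\<eta>\<close>. All but finitely many of them lie in one bounded
  interval, so Lebesgue measure is continuous along the decreasing unions
  \<open>A n\<close>.\<close>

lemma curve_measure_limit_ge:
  assumes lim: "\<gamma> \<longlonglongrightarrow> \<eta>" and B: "closed B"
    and ge: "\<And>k. emeasure (curve_measure (\<gamma> k)) B \<ge> c"
  shows "emeasure (curve_measure \<eta>) B \<ge> c"
proof -
  define T where "T \<zeta> = {t \<in> curve_dom \<zeta>. curve_fun \<zeta> t \<in> B}" for \<zeta>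
  have T: "T \<zeta> \<in> sets borel" for \<zeta> unfolding T_def using B by (intro borel_curve_vimage) auto
  have em: "emeasure (curve_measure \<zeta>) B = emeasure lborel (T \<zeta>)" for \<zeta>
    using B by (simp add: emeasure_curve_measure T_def)
  obtain b where b: "\<And>x. x \<in> curve_dom \<eta> \<Longrightarrow> \<bar>x\<bar> \<le> b"
    using compact_imp_bounded[OF curve_props(1)[of \<eta>]] by (auto simp: bounded_iff)
  obtain k0 where k0: "\<And>k. k \<ge> k0 \<Longrightarrow> dist (\<gamma> k) \<eta> < 1"
    using lim[unfolded lim_sequentially] by (meson zero_less_one)
  have sub: "T (\<gamma> k) \<subseteq> {-(b+1)..b+1}" if k: "k \<ge> k0" for k
  proof
    fix t assume "t \<in> T (\<gamma> k)"
    then have p: "(t, curve_fun (\<gamma> k) t) \<in> curve_graph (\<gamma> k)" by (auto simp: T_def curve_graph_def)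
    obtain q where q: "q \<in> curve_graph \<eta>"
        "infdist (t, curve_fun (\<gamma> k) t) (curve_graph \<eta>) = dist (t, curve_fun (\<gamma> k) t) q"
      using compact_infdist_attained[OF curve_graph_compact curve_graph_nonempty] by blast
    have "dist t (fst q) \<le> dist (t, curve_fun (\<gamma> k) t) q"
      using dist_fst_le[of "(t, curve_fun (\<gamma> k) t)" q] by simp
    also have "\<dots> < 1"
      using infdist_le_hausdorff_dist[OF curve_graph_compact p, of "curve_graph \<eta>"] k0[OF k] q
      unfolding dist_curve_def by simp
    finally have "dist t (fst q) < 1" .
    moreover have "\<bar>fst q\<bar> \<le> b" using q(1) b by (auto simp: curve_graph_def)
    ultimately show "t \<in> {-(b+1)..b+1}" by (auto simp: dist_real_def)
  qed
  define A where "A n = (\<Union>k\<in>{k0+n..}. T (\<gamma> k))" for n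
  have A: "range A \<subseteq> sets lborel" using T by (auto simp: A_def)
  have dec: "decseq A" unfolding A_def decseq_def by fastforce
  have fin: "emeasure lborel (A n) \<noteq> \<infinity>" for n
  proof -
    have "emeasure lborel (A n) \<le> emeasure lborel {-(b+1)..b+1}"
      unfolding A_def by (intro emeasure_mono UN_least sub) auto
    also have "\<dots> < \<infinity>" by (rule emeasure_compact_finite) simp
    finally show ?thesis by simp
  qed
  have cA: "c \<le> emeasure lborel (A n)" for n
  proof -
    have "c \<le> emeasure lborel (T (\<gamma> (k0 + n)))" using ge em by metis
    also have "\<dots> \<le> emeasure lborel (A n)" using A by (intro emeasure_mono) (auto simp: A_def)
    finally show ?thesis .
  qed
  have "c \<le> (INF n. emeasure lborel (A n))" by (rule INF_greatest) (rule cA)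
  also have "\<dots> = emeasure lborel (\<Inter>n. A n)" by (rule INF_emeasure_decseq[OF A dec fin])
  also have "\<dots> \<le> emeasure lborel (T \<eta>)"
  proof (rule emeasure_mono)
    show "(\<Inter>n. A n) \<subseteq> T \<eta>"
    proof
      fix t assume t: "t \<in> (\<Inter>n. A n)"
      have "\<exists>k\<ge>m. t \<in> T (\<gamma> k)" for m
      proof -
        have "t \<in> A m" using t by blast
        then obtain k where "k \<ge> k0 + m" "t \<in> T (\<gamma> k)" by (auto simp: A_def)
        then show ?thesis by (intro exI[of _ k]) auto
      qed
      then have "\<exists>\<^sub>\<infinity>k. t \<in> curve_dom (\<gamma> k) \<and> curve_fun (\<gamma> k) t \<in> B"
        by (auto simp: INFM_nat_le T_def)
      from curve_limit_points[OF lim this B] show "t \<in> T \<eta>" by (simp add: T_def)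
    qed
  qed (use T in simp)
  finally show ?thesis by (simp add: em)
qed

lemma closed_curve_measure_ge:
  assumes "closed B" shows "closed {\<gamma>. c \<le> emeasure (curve_measure \<gamma>) B}"
  unfolding closed_sequential_limits using curve_measure_limit_ge[OF _ assms] by blast

text \<open>For closed sets the superlevel sets are closed; finiteness of
  \<open>curve_measure\<close> allows complements, and Dynkin's argument reaches all Borel
  sets.\<close>

lemma measurable_emeasure_curve_measure:
  fixes B :: "'a::metric_space set"
  assumes "B \<in> sets borel"
  shows "(\<lambda>\<gamma>. emeasure (curve_measure \<gamma>) B) \<in> borel_measurable borel"
proof -
  have cl: "(\<lambda>\<gamma>. emeasure (curve_measure \<gamma>) B) \<in> borel_measurable borel" if "closed B" for B :: "'a set"
    by (rule borel_measurableI_ge) (simp add: closed_curve_measure_ge[OF that] borel_closed)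
  have "Int_stable {B :: 'a set. closed B}" by (auto simp: Int_stable_def)
  moreover have "{B :: 'a set. closed B} \<subseteq> Pow UNIV" by simp
  moreover have "B \<in> sigma_sets UNIV {B. closed B}" using assms by (simp add: borel_eq_closed)
  ultimately show ?thesis
  proof (induction B rule: sigma_sets_induct_disjoint[consumes 3, case_names basic empty compl union])
    case (basic B) then show ?case using cl by simp
  next
    case empty then show ?case by simp
  next
    case (compl B)
    then have B: "B \<in> sets borel" by (simp add: borel_eq_closed)
    have "emeasure (curve_measure \<gamma>) (UNIV - B)
        = emeasure (curve_measure \<gamma>) UNIV - emeasure (curve_measure \<gamma>) B" for \<gamma>
      using B finite_measure.emeasure_finite[OF curve_measure_finite, of \<gamma> B]
      by (subst emeasure_compl[of B "curve_measure \<gamma>", simplified, symmetric]) (auto simp: Compl_eq_Diff_UNIV)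
    then show ?case using cl[of UNIV] compl by simp
  next
    case (union A)
    then have "range A \<subseteq> sets borel" by (auto simp: borel_eq_closed)
    then have "emeasure (curve_measure \<gamma>) (\<Union>i. A i) = (\<Sum>i. emeasure (curve_measure \<gamma>) (A i))" for \<gamma>
      using union by (intro suminf_emeasure[symmetric]) auto
    then show ?case using union by simp
  qed
qed

subsection \<open>Compact families of curves as images of compact sets of reals\<close>

text \<open>Digits 0 and 1 in base 3: the tail after position \<open>n\<close> is at most half the
  unit \<open>(1/3)^n\<close>, so every digit can be read off the real number and the codes form a
  Cantor set.\<close>

definition cantor_code :: "(nat \<Rightarrow> bool) \<Rightarrow> real" where
  "cantor_code A = (\<Sum>n. of_bool (A n) * (1/3)^n)"

lemma summable_cantor_code: "summable (\<lambda>n. of_bool (A n) * (1/3::real)^n)"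
  by (rule summable_comparison_test'[of "\<lambda>n. (1/3::real)^n" 0]) (auto simp: summable_geometric)

lemma cantor_code_diff:
  assumes eq: "\<And>j. j < n \<Longrightarrow> A j = B j"
  shows "\<bar>cantor_code A - cantor_code B - (of_bool (A n) - of_bool (B n)) * (1/3)^n\<bar> \<le> (1/3)^n / 2"
proof -
  define f :: "nat \<Rightarrow> real" where "f k = (of_bool (A k) - of_bool (B k)) * (1/3)^k" for k
  have f: "summable f" "cantor_code A - cantor_code B = suminf f"
    using summable_diff[OF summable_cantor_code summable_cantor_code, of A B]
      suminf_diff[OF summable_cantor_code summable_cantor_code, of A B]
    unfolding f_def cantor_code_def left_diff_distrib by simp_all
  have geo: "(\<lambda>k. (1/3::real)^(k + Suc n)) sums ((1/3)^n / 2)"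
    using sums_mult2[OF geometric_sums[of "1/3::real"], of "(1/3)^Suc n"] by (simp add: power_add)
  have "suminf f = (\<Sum>k. f (k + Suc n)) + (\<Sum>k<Suc n. f k)"
    by (rule suminf_split_initial_segment[OF f(1)])
  moreover have "(\<Sum>k<Suc n. f k) = f n" using eq by (auto simp: f_def)
  moreover have "\<bar>\<Sum>k. f (k + Suc n)\<bar> \<le> (\<Sum>k. (1/3::real)^(k + Suc n))"
    using norm_suminf_le[of "\<lambda>k. f (k + Suc n)" "\<lambda>k. (1/3)^(k + Suc n)"] sums_summable[OF geo]
    by (auto simp: f_def abs_mult)
  ultimately show ?thesis using f(2) sums_unique[OF geo] by (simp add: f_def)
qed

text \<open>At the first disagreement \<open>m\<close> the codes differ by \<open>(1/3)^m\<close> up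
  to a tail of at most half that size.\<close>

lemma cantor_code_close_imp_agree:
  assumes "\<bar>cantor_code A - cantor_code B\<bar> < (1/3)^n / 2" and "j \<le> n"
  shows "A j = B j"
proof (rule ccontr)
  assume "A j \<noteq> B j"
  define m where "m = (LEAST k. A k \<noteq> B k)"
  have m: "A m \<noteq> B m" unfolding m_def by (rule LeastI) (rule \<open>A j \<noteq> B j\<close>)
  have "m \<le> j" unfolding m_def by (rule Least_le) (rule \<open>A j \<noteq> B j\<close>)
  have "A k = B k" if "k < m" for k using not_less_Least that unfolding m_def by blast
  from cantor_code_diff[of m A B, OF this] have "(1/3)^m / 2 \<le> \<bar>cantor_code A - cantor_code B\<bar>"
    using m by (cases "A m") (auto simp: abs_if split: if_splits)
  moreover have "(1/3::real)^n \<le> (1/3)^m" using \<open>m \<le> j\<close> \<open>j \<le> n\<close> by (intro power_decreasing) auto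
  ultimately show False using assms(1) by simp
qed

lemma cantor_code_agree_imp_close:
  assumes "\<And>j. j \<le> n \<Longrightarrow> A j = B j"
  shows "\<bar>cantor_code A - cantor_code B\<bar> \<le> (1/3)^n / 2"
  using cantor_code_diff[of n A B] assms by simp

lemma cantor_code_inj: "cantor_code A = cantor_code B \<Longrightarrow> A = B"
  using cantor_code_close_imp_agree[of A B] by fastforce

lemma cantor_code_bounds: "0 \<le> cantor_code A" "cantor_code A \<le> 3/2"
proof -
  show "0 \<le> cantor_code A"
    unfolding cantor_code_def by (intro suminf_nonneg summable_cantor_code) auto
  have "cantor_code A \<le> (\<Sum>n. (1/3::real)^n)"
    unfolding cantor_code_def by (intro suminf_le summable_cantor_code) (auto simp: summable_geometric)
  then show "cantor_code A \<le> 3/2" by (simp add: suminf_geometric)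
qed

text \<open>The digits of a convergent sequence of codes stabilize one after the other, so limits of
  codes are codes and convergence is coordinatewise; \<open>s n\<close> is a stage from which the
  digits up to \<open>n\<close> are final.\<close>

lemma cantor_code_convergent_imp:
  assumes "(\<lambda>k. cantor_code (A k)) \<longlonglongrightarrow> z"
  obtains B s where "z = cantor_code B" "\<And>n k j. k \<ge> s n \<Longrightarrow> j \<le> n \<Longrightarrow> A k j = B j"
proof -
  have "Cauchy (\<lambda>k. cantor_code (A k))" using assms by (rule LIMSEQ_imp_Cauchy)
  then have "\<exists>s. \<forall>k\<ge>s. \<forall>l\<ge>s. \<bar>cantor_code (A k) - cantor_code (A l)\<bar> < (1/3)^n / 2" for n
    using \<open>Cauchy _\<close>[unfolded Cauchy_def dist_real_def, rule_format, of "(1/3)^n / 2"] by simp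
  then obtain s where s: "\<And>n k l. k \<ge> s n \<Longrightarrow> l \<ge> s n \<Longrightarrow>
      \<bar>cantor_code (A k) - cantor_code (A l)\<bar> < (1/3)^n / 2"
    by metis
  have agree: "A k j = A l j" if "k \<ge> s n" "l \<ge> s n" "j \<le> n" for k l j n
    using cantor_code_close_imp_agree[OF s] that by blast
  define B where "B j = A (s j) j" for j
  have AB: "A k j = B j" if "k \<ge> s n" "j \<le> n" for n k j
    unfolding B_def using agree[of n k "max (s n) (s j)" j] agree[of j "max (s n) (s j)" "s j" j] that
    by auto
  have "(\<lambda>k. cantor_code (A k)) \<longlonglongrightarrow> cantor_code B"
  proof (rule LIMSEQ_I)
    fix e :: real assume "e > 0"
    then obtain n where n: "(1/3::real)^n < e" using real_arch_pow_inv[of e "1/3"] by auto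
    have "norm (cantor_code (A k) - cantor_code B) < e" if "k \<ge> s n" for k
    proof -
      have "\<bar>cantor_code (A k) - cantor_code B\<bar> \<le> (1/3)^n / 2"
        using AB[OF that] by (rule cantor_code_agree_imp_close)
      moreover have "(1/3::real)^n / 2 \<le> (1/3)^n" by simp
      ultimately show ?thesis using n unfolding real_norm_def by linarith
    qed
    then show "\<exists>no. \<forall>k\<ge>no. norm (cantor_code (A k) - cantor_code B) < e" by blast
  qed
  then have "z = cantor_code B" using assms LIMSEQ_unique by blast
  then show ?thesis using that AB by blast
qed

text \<open>
  A closed subset of \<open>W\<close> is coded by the set of basic open sets that it misses. On the codes whose
  remaining basic open sets (almost) meet the coded set, decoding is continuous for the Hausdorff metric.
\<close>

definition coded_set :: "'b set \<Rightarrow> (nat \<Rightarrow> 'b set) \<Rightarrow> (nat \<Rightarrow> bool) \<Rightarrow> 'b set" where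
  "coded_set W Ob A = {x\<in>W. \<forall>i. A i \<longrightarrow> x \<notin> Ob i}"

definition faithful_code :: "'b::topological_space set \<Rightarrow> (nat \<Rightarrow> 'b set) \<Rightarrow> (nat \<Rightarrow> bool) \<Rightarrow> bool" where
  "faithful_code W Ob A \<longleftrightarrow>
     coded_set W Ob A \<noteq> {} \<and> (\<forall>i. \<not> A i \<longrightarrow> closure (Ob i) \<inter> coded_set W Ob A \<noteq> {})"

lemma compact_coded_set:
  assumes "compact W" "\<And>i. open (Ob i)"
  shows "compact (coded_set W Ob A)"
proof -
  have "coded_set W Ob A = W \<inter> (\<Inter>i\<in>{i. A i}. - Ob i)" by (auto simp: coded_set_def)
  then show ?thesis using assms by (auto intro!: compact_Int_closed closed_INT)
qed

text \<open>Missing the open set \<open>Ob i\<close> is a closed condition, and each single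
  \<open>i\<close> is eventually among the indices on which the codes agree.\<close>

lemma coded_set_upper_limit:
  fixes W :: "'b::metric_space set"
  assumes W: "compact W" and op: "\<And>i. open (Ob i)"
    and x: "\<And>n. x n \<in> coded_set W Ob (B n)" and agree: "\<And>n j. j \<le> n \<Longrightarrow> B n j = A j"
  obtains l r where "l \<in> coded_set W Ob A" "strict_mono (r :: nat \<Rightarrow> nat)" "(x \<circ> r) \<longlonglongrightarrow> l"
proof -
  have "\<forall>n. x n \<in> W" using x by (auto simp: coded_set_def)
  then obtain l r where lr: "l \<in> W" "strict_mono (r :: nat \<Rightarrow> nat)" "(x \<circ> r) \<longlonglongrightarrow> l"
    by (rule seq_compactE[OF compact_imp_seq_compact[OF W]])
  have "l \<notin> Ob i" if "A i" for i
  proof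
    assume "l \<in> Ob i"
    then have "\<forall>\<^sub>F n in sequentially. (x \<circ> r) n \<in> Ob i"
      using lr(3) op topological_tendstoD by blast
    then obtain n0 where n0: "\<And>n. n \<ge> n0 \<Longrightarrow> x (r n) \<in> Ob i" by (auto simp: eventually_sequentially)
    define n where "n = max n0 i"
    have "i \<le> r n" using strict_mono_imp_increasing[OF lr(2), of n] by (simp add: n_def)
    then have "B (r n) i" using agree that by blast
    then show False using n0[of n] x[of "r n"] by (auto simp: n_def coded_set_def)
  qed
  then show ?thesis using lr by (intro that) (auto simp: coded_set_def)
qed

text \<open>This is what faithfulness is for: a basic set around \<open>x\<close> is not marked as
  missed by \<open>A\<close>, hence eventually not by \<open>B n\<close>, so its closure contains a
  point of the set coded by \<open>B n\<close>.\<close>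

lemma coded_set_lower_limit:
  fixes W :: "'b::metric_space set"
  assumes ba: "topological_basis (range Ob)" and x: "x \<in> coded_set W Ob A"
    and B: "\<And>n. faithful_code W Ob (B n)" and agree: "\<And>n j. j \<le> n \<Longrightarrow> B n j = A j" and e: "e > 0"
  obtains n0 where "\<And>n. n \<ge> n0 \<Longrightarrow> \<exists>x'\<in>coded_set W Ob (B n). dist x x' \<le> e"
proof -
  obtain i where i: "x \<in> Ob i" "Ob i \<subseteq> ball x e"
    using topological_basisE[OF ba open_ball, of x x e] e by auto
  then have "\<not> A i" using x by (auto simp: coded_set_def)
  show ?thesis
  proof (rule that[of i])
    fix n assume "n \<ge> i"
    then have "\<not> B n i" using agree \<open>\<not> A i\<close> by blast
    then obtain x' where x': "x' \<in> closure (Ob i)" "x' \<in> coded_set W Ob (B n)"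
      using B unfolding faithful_code_def by blast
    have "closure (Ob i) \<subseteq> cball x e"
      using i(2) ball_subset_cball by (intro closure_minimal) auto
    then show "\<exists>x'\<in>coded_set W Ob (B n). dist x x' \<le> e"
      using x' by (intro bexI[of _ x']) auto
  qed
qed

text \<open>Each half of the Hausdorff distance is bounded by contradiction: offending points have a
  convergent subsequence, which \<open>coded_set_upper_limit\<close> excludes in one case and
  \<open>coded_set_lower_limit\<close>, applied at the limit point, in the other.\<close>

lemma coded_set_hausdorff_limit:
  fixes W :: "'b::metric_space set"
  assumes W: "compact W" and ba: "topological_basis (range Ob)"
    and A: "faithful_code W Ob A" and B: "\<And>n. faithful_code W Ob (B n)"
    and agree: "\<And>n j. j \<le> n \<Longrightarrow> B n j = A j" and e: "e > 0"
  shows "\<exists>n. hausdorff_dist (coded_set W Ob (B n)) (coded_set W Ob A) \<le> e"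
proof -
  have op: "open (Ob i)" for i using topological_basis_open[OF ba] by blast
  have agree': "B (k n) j = A j" if "\<And>n. k n \<ge> n" "j \<le> n" for k n j
    using agree[of j "k n"] that(1)[of n] that(2) by simp
  have "\<exists>n0. \<forall>n\<ge>n0. \<forall>x\<in>coded_set W Ob (B n). infdist x (coded_set W Ob A) \<le> e"
  proof (rule ccontr)
    assume "\<not> ?thesis"
    then have "\<forall>n. \<exists>k\<ge>n. \<exists>x\<in>coded_set W Ob (B k). infdist x (coded_set W Ob A) > e"
      by (meson not_le)
    then obtain k x where kx: "\<And>n. k n \<ge> n" "\<And>n. x n \<in> coded_set W Ob (B (k n))"
        "\<And>n. infdist (x n) (coded_set W Ob A) > e" by metis
    obtain l r where lr: "l \<in> coded_set W Ob A" "strict_mono (r :: nat \<Rightarrow> nat)" "(x \<circ> r) \<longlonglongrightarrow> l"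
      by (rule coded_set_upper_limit[OF W op kx(2) agree'[OF kx(1)]])
    have "\<forall>\<^sub>F n in sequentially. dist ((x \<circ> r) n) l < e" using lr(3) e by (rule tendstoD)
    then obtain n where "dist (x (r n)) l < e" by (auto simp: eventually_sequentially)
    then show False using infdist_le[OF lr(1), of "x (r n)"] kx(3)[of "r n"] by simp
  qed
  then obtain n1 where n1: "\<And>n x. n \<ge> n1 \<Longrightarrow> x \<in> coded_set W Ob (B n) \<Longrightarrow> infdist x (coded_set W Ob A) \<le> e"
    by blast
  have "\<exists>n0. \<forall>n\<ge>n0. \<forall>x\<in>coded_set W Ob A. infdist x (coded_set W Ob (B n)) \<le> e"
  proof (rule ccontr)
    assume "\<not> ?thesis"
    then have "\<forall>n. \<exists>k\<ge>n. \<exists>x\<in>coded_set W Ob A. infdist x (coded_set W Ob (B k)) > e"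
      by (meson not_le)
    then obtain k x where kx: "\<And>n. k n \<ge> n" "\<And>n. x n \<in> coded_set W Ob A"
        "\<And>n. infdist (x n) (coded_set W Ob (B (k n))) > e" by metis
    obtain l r where lr: "l \<in> coded_set W Ob A" "strict_mono (r :: nat \<Rightarrow> nat)" "(x \<circ> r) \<longlonglongrightarrow> l"
      by (rule seq_compactE[OF compact_imp_seq_compact[OF compact_coded_set[where A = A, OF W op]], of x])
         (use kx(2) in auto)
    have "\<forall>\<^sub>F n in sequentially. dist ((x \<circ> r) n) l < e / 2"
      using e by (intro tendstoD[OF lr(3)]) simp
    then obtain n1 where n1: "\<And>n. n \<ge> n1 \<Longrightarrow> dist (x (r n)) l < e / 2"
      by (auto simp: eventually_sequentially)
    obtain n0 where n0: "\<And>n. n \<ge> n0 \<Longrightarrow> \<exists>x'\<in>coded_set W Ob (B (k n)). dist l x' \<le> e / 2"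
      using coded_set_lower_limit[where B = "\<lambda>n. B (k n)" and e = "e / 2", OF ba lr(1) B agree'[OF kx(1)]] e by auto
    define n where "n = max n0 n1"
    have "r n \<ge> n0" using strict_mono_imp_increasing[OF lr(2), of n] by (simp add: n_def)
    then obtain x' where x': "x' \<in> coded_set W Ob (B (k (r n)))" "dist l x' \<le> e / 2" using n0 by blast
    have "infdist (x (r n)) (coded_set W Ob (B (k (r n)))) \<le> dist (x (r n)) x'"
      by (rule infdist_le[OF x'(1)])
    also have "\<dots> \<le> e" using dist_triangle[of "x (r n)" x' l] x'(2) n1[of n] by (simp add: n_def)
    finally show False using kx(3)[of "r n"] by simp
  qed
  then obtain n2 where n2: "\<And>n x. n \<ge> n2 \<Longrightarrow> x \<in> coded_set W Ob A \<Longrightarrow> infdist x (coded_set W Ob (B n)) \<le> e"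
    by blast
  have "hausdorff_dist (coded_set W Ob (B (max n1 n2))) (coded_set W Ob A) \<le> e"
    using A B n1[of "max n1 n2"] n2[of "max n1 n2"] unfolding faithful_code_def
    by (intro hausdorff_dist_le) auto
  then show ?thesis by blast
qed

lemma topological_basis_sequence:
  obtains Ob :: "nat \<Rightarrow> 'b::second_countable_topology set" where "topological_basis (range Ob)"
proof -
  obtain \<B> :: "'b set set" where \<B>: "countable \<B>" "topological_basis \<B>"
    using ex_countable_basis by blast
  have "\<B> \<noteq> {}" using topological_basisE[OF \<B>(2) open_UNIV, of undefined] by blast
  then have "topological_basis (range (from_nat_into \<B>))" using \<B> by (simp add: range_from_nat_into)
  then show ?thesis by (rule that)
qed

text \<open>The parameters are real numbers because weak limits will be taken of distributions on
  the line. The bounds in \<open>R\<close> force every non-empty coded set whose square lies in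
  \<open>R\<close> to be the graph of a curve.\<close>

lemma compact_curve_family_parametrization:
  fixes W :: "(real \<times> 'a::polish_space) set"
  assumes W: "compact W" and R: "closed R" and "L > 0"
    and RL: "\<And>s x t y. ((s, x), (t, y)) \<in> R \<Longrightarrow> dist s t / L \<le> dist x y \<and> dist x y \<le> L * dist s t"
  obtains Z :: "real set" and \<Theta> where "compact Z" "continuous_on Z \<Theta>"
    "\<Theta> ` Z = {\<gamma>. curve_graph \<gamma> \<subseteq> W \<and> curve_graph \<gamma> \<times> curve_graph \<gamma> \<subseteq> R}"
proof -
  obtain Ob :: "nat \<Rightarrow> (real \<times> 'a) set" where ba: "topological_basis (range Ob)"
    by (rule topological_basis_sequence)
  have op: "open (Ob i)" for i using topological_basis_open[OF ba] by blast
  define D where "D = {A. faithful_code W Ob A \<and> coded_set W Ob A \<times> coded_set W Ob A \<subseteq> R}"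
  define Z where "Z = cantor_code ` D"
  \<comment> \<open>Codes in \<open>D\<close> are closed under coordinatewise limits. That
    faithfulness asks only the closures of basic sets to meet the coded set is what makes it survive
    the limit.\<close>
  have Dclosed: "A \<in> D" if B: "\<And>n. B n \<in> D" and agree: "\<And>n j. j \<le> n \<Longrightarrow> B n j = A j" for A B
  proof -
    have fB: "faithful_code W Ob (B n)" for n using B by (auto simp: D_def)
    have agree': "B (n + i) j = A j" if "j \<le> n" for i n j using agree[of j "n + i"] that by simp
    have "\<exists>x. \<forall>n. x n \<in> coded_set W Ob (B n)" using fB unfolding faithful_code_def by (intro choice allI) blast
    then obtain x where "\<And>n. x n \<in> coded_set W Ob (B n)" by blast
    from coded_set_upper_limit[where A = A and B = B, OF W op this agree] have ne: "coded_set W Ob A \<noteq> {}" by blast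
    have "closure (Ob i) \<inter> coded_set W Ob A \<noteq> {}" if "\<not> A i" for i
    proof -
      have "\<not> B (n + i) i" for n using agree[of i "n + i"] that by simp
      then have "\<exists>x. \<forall>n. x n \<in> closure (Ob i) \<inter> coded_set W Ob (B (n + i))"
        using fB unfolding faithful_code_def by (intro choice allI) blast
      then obtain x where x: "\<And>n. x n \<in> closure (Ob i)" "\<And>n. x n \<in> coded_set W Ob (B (n + i))" by blast
      obtain l r where lr: "l \<in> coded_set W Ob A" "strict_mono (r :: nat \<Rightarrow> nat)" "(x \<circ> r) \<longlonglongrightarrow> l"
        by (rule coded_set_upper_limit[OF W op x(2) agree'])
      have "l \<in> closure (Ob i)"
        by (rule closed_sequentially[OF closed_closure _ lr(3)]) (use x(1) in simp)
      then show ?thesis using lr(1) by blast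
    qed
    with ne have fA: "faithful_code W Ob A" by (simp add: faithful_code_def)
    have "(x, y) \<in> R" if xy: "x \<in> coded_set W Ob A" "y \<in> coded_set W Ob A" for x y
    proof (rule ccontr)
      assume "(x, y) \<notin> R"
      then obtain e where e: "e > 0" "ball (x, y) e \<subseteq> - R"
        using R by (metis ComplI open_Compl open_contains_ball)
      obtain n1 where n1: "\<And>n. n \<ge> n1 \<Longrightarrow> \<exists>x'\<in>coded_set W Ob (B n). dist x x' \<le> e / 4"
        using coded_set_lower_limit[where B = B and e = "e / 4", OF ba xy(1) fB agree] e by auto
      obtain n2 where n2: "\<And>n. n \<ge> n2 \<Longrightarrow> \<exists>x'\<in>coded_set W Ob (B n). dist y x' \<le> e / 4"
        using coded_set_lower_limit[where B = B and e = "e / 4", OF ba xy(2) fB agree] e by auto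
      obtain x' y' where x': "x' \<in> coded_set W Ob (B (max n1 n2))" "dist x x' \<le> e / 4"
        and y': "y' \<in> coded_set W Ob (B (max n1 n2))" "dist y y' \<le> e / 4"
        using n1[of "max n1 n2"] n2[of "max n1 n2"] by auto
      have "dist (x, y) (x', y') \<le> dist x x' + dist y y'"
        unfolding dist_Pair_Pair by (rule sqrt_sum_squares_le_sum) auto
      also have "\<dots> < e" using x' y' e by simp
      finally have "(x', y') \<notin> R" using e(2) by auto
      then show False using x'(1) y'(1) B[of "max n1 n2"] by (auto simp: D_def)
    qed
    with fA show ?thesis by (auto simp: D_def)
  qed
  have "compact Z"
  proof (rule compact_eq_bounded_closed[THEN iffD2], rule conjI)
    show "bounded Z"
      unfolding Z_def using cantor_code_bounds by (intro boundedI[of _ "3/2"]) auto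
    show "closed Z"
      unfolding closed_sequential_limits
    proof (intro allI impI, elim conjE)
      fix z l assume z: "\<forall>n. z n \<in> Z" "z \<longlonglongrightarrow> l"
      then have "\<forall>n. \<exists>A. A \<in> D \<and> z n = cantor_code A" unfolding Z_def by blast
      then obtain A where A: "\<And>n. A n \<in> D" "\<And>n. z n = cantor_code (A n)" by metis
      have "z = (\<lambda>n. cantor_code (A n))" using A(2) by blast
      then have "(\<lambda>n. cantor_code (A n)) \<longlonglongrightarrow> l" using z(2) by simp
      then obtain B s where B: "l = cantor_code B" "\<And>n k j. k \<ge> s n \<Longrightarrow> j \<le> n \<Longrightarrow> A k j = B j"
        using cantor_code_convergent_imp[of A l] by metis
      have "B \<in> D" by (rule Dclosed[of "\<lambda>n. A (s n)"]) (use A(1) B(2) in auto)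
      then show "l \<in> Z" using B(1) by (auto simp: Z_def)
    qed
  qed
  define dec where "dec z = (SOME A. A \<in> D \<and> cantor_code A = z)" for z
  have dec: "dec z \<in> D \<and> cantor_code (dec z) = z" if "z \<in> Z" for z
  proof -
    have "\<exists>A. A \<in> D \<and> cantor_code A = z" using that by (auto simp: Z_def)
    then show ?thesis unfolding dec_def by (rule someI_ex)
  qed
  have dec_code: "dec (cantor_code A) = A" if "A \<in> D" for A
    using dec[of "cantor_code A"] that cantor_code_inj by (auto simp: Z_def)
  define \<Theta> where "\<Theta> z = (SOME \<gamma>. curve_graph \<gamma> = coded_set W Ob (dec z))" for z
  have \<Theta>: "curve_graph (\<Theta> z) = coded_set W Ob (dec z)" if "z \<in> Z" for z
  proof -
    have dz: "dec z \<in> D" using dec that by blast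
    obtain \<gamma> where "curve_graph \<gamma> = coded_set W Ob (dec z)"
    proof (rule curve_of_graph[of "coded_set W Ob (dec z)" L])
      show "compact (coded_set W Ob (dec z))" by (rule compact_coded_set[OF W op])
      show "coded_set W Ob (dec z) \<noteq> {}" using dz by (auto simp: D_def faithful_code_def)
      show "dist s t / L \<le> dist x y \<and> dist x y \<le> L * dist s t"
        if "(s, x) \<in> coded_set W Ob (dec z)" "(t, y) \<in> coded_set W Ob (dec z)" for s x t y
        using dz that by (intro RL) (auto simp: D_def)
    qed (use \<open>L > 0\<close> in auto)
    then show ?thesis unfolding \<Theta>_def by (rule someI)
  qed
  have "continuous_on Z \<Theta>"
  proof (rule ccontr)
    assume "\<not> continuous_on Z \<Theta>"
    then obtain z e where z: "z \<in> Z" "e > 0" "\<And>d. d > 0 \<Longrightarrow> \<exists>z'\<in>Z. dist z' z < d \<and> dist (\<Theta> z') (\<Theta> z) \<ge> e"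
      unfolding continuous_on_iff by (meson not_le)
    have "\<exists>z'\<in>Z. dist z' z < (1/3)^n / 2 \<and> dist (\<Theta> z') (\<Theta> z) \<ge> e" for n :: nat
      by (rule z(3)) simp
    then obtain z' where z': "\<And>n. z' n \<in> Z" "\<And>n. dist (z' n) z < (1/3)^n / 2" "\<And>n. dist (\<Theta> (z' n)) (\<Theta> z) \<ge> e"
      by metis
    have "\<exists>n. hausdorff_dist (coded_set W Ob (dec (z' n))) (coded_set W Ob (dec z)) \<le> e / 2"
    proof (rule coded_set_hausdorff_limit[OF W ba])
      show "faithful_code W Ob (dec z)" "faithful_code W Ob (dec (z' n))" for n
        using dec z(1) z'(1) by (auto simp: D_def)
      show "dec (z' n) j = dec z j" if "j \<le> n" for n j
        by (rule cantor_code_close_imp_agree[OF _ that]) (use dec z(1) z'(1,2) in \<open>auto simp: dist_real_def\<close>)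
    qed (use z(2) in simp)
    then obtain n where "dist (\<Theta> (z' n)) (\<Theta> z) \<le> e / 2"
      using \<Theta> z(1) z'(1) by (auto simp: dist_curve_def)
    then show False using z'(3)[of n] z(2) by simp
  qed
  moreover have "\<Theta> ` Z = {\<gamma>. curve_graph \<gamma> \<subseteq> W \<and> curve_graph \<gamma> \<times> curve_graph \<gamma> \<subseteq> R}"
  proof (intro equalityI subsetI)
    fix \<gamma> assume "\<gamma> \<in> \<Theta> ` Z"
    then obtain z where z: "z \<in> Z" "\<gamma> = \<Theta> z" by blast
    then have "curve_graph \<gamma> = coded_set W Ob (dec z)" "dec z \<in> D" using \<Theta> dec by auto
    then show "\<gamma> \<in> {\<gamma>. curve_graph \<gamma> \<subseteq> W \<and> curve_graph \<gamma> \<times> curve_graph \<gamma> \<subseteq> R}"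
      by (auto simp: D_def coded_set_def)
  next
    fix \<gamma> assume \<gamma>: "\<gamma> \<in> {\<gamma>. curve_graph \<gamma> \<subseteq> W \<and> curve_graph \<gamma> \<times> curve_graph \<gamma> \<subseteq> R}"
    \<comment> \<open>The canonical code marks every basic set disjoint from the graph; all others
      meet the graph, so it is faithful.\<close>
    define A where "A i \<longleftrightarrow> Ob i \<inter> curve_graph \<gamma> = {}" for i
    have "coded_set W Ob A = curve_graph \<gamma>"
    proof (intro equalityI subsetI)
      fix x assume x: "x \<in> coded_set W Ob A"
      show "x \<in> curve_graph \<gamma>"
      proof (rule ccontr)
        assume "x \<notin> curve_graph \<gamma>"
        then obtain i where "x \<in> Ob i" "Ob i \<subseteq> - curve_graph \<gamma>"
          using topological_basisE[OF ba, of "- curve_graph \<gamma>" x]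
            compact_imp_closed[OF curve_graph_compact, of \<gamma>] by auto
        then show False using x by (auto simp: coded_set_def A_def)
      qed
    qed (use \<gamma> in \<open>auto simp: coded_set_def A_def\<close>)
    moreover from this have "faithful_code W Ob A"
      using curve_graph_nonempty closure_subset unfolding faithful_code_def A_def by blast
    ultimately have "A \<in> D" using \<gamma> by (auto simp: D_def)
    then have "cantor_code A \<in> Z" "curve_graph (\<Theta> (cantor_code A)) = curve_graph \<gamma>"
      using \<Theta>[of "cantor_code A"] dec_code \<open>coded_set W Ob A = curve_graph \<gamma>\<close> by (auto simp: Z_def)
    then show "\<gamma> \<in> \<Theta> ` Z" by (metis curve_graph_eq_iff imageI)
  qed
  ultimately show ?thesis using \<open>compact Z\<close> that by blast
qed

subsection \<open>A minimax theorem for distributions\<close>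

text \<open>
  Blackwell's approachability argument: the squared positive parts of the deficits
  \<open>T * c - (\<Sum>t<T. y i (\<gamma> t))\<close> grow at most linearly when each \<open>\<gamma> t\<close> responds to the current deficits.
\<close>

lemma blackwell_sequence:
  fixes y :: "nat \<Rightarrow> 'c \<Rightarrow> real"
  assumes "G \<noteq> {}" and "M \<ge> 0" and bnd: "\<And>i g. i < n \<Longrightarrow> g \<in> G \<Longrightarrow> \<bar>c - y i g\<bar> \<le> M"
    and resp: "\<And>a. (\<And>i. i < n \<Longrightarrow> 0 \<le> a i) \<Longrightarrow> (\<Sum>i<n. a i) = 1 \<Longrightarrow> \<exists>g\<in>G. c \<le> (\<Sum>i<n. a i * y i g)"
  obtains \<gamma> :: "nat \<Rightarrow> 'c" where "\<And>t. \<gamma> t \<in> G"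
    "\<And>T i. i < n \<Longrightarrow> real T * c - (\<Sum>t<T. y i (\<gamma> t)) \<le> M * sqrt (real n * real T)"
proof -
  \<comment> \<open>The normalized positive deficits serve as weights, and the response makes the
    next increment point, on average, against them. When no deficit is positive, any
    \<open>g\<close> will do.\<close>
  have "\<exists>g\<in>G. (\<Sum>i<n. max 0 (d i) * (c - y i g)) \<le> 0" for d :: "nat \<Rightarrow> real"
  proof -
    define s where "s = (\<Sum>i<n. max 0 (d i))"
    show ?thesis
    proof (cases "s = 0")
      case True
      then have "\<forall>i<n. max 0 (d i) = 0"
        unfolding s_def by (subst (asm) sum_nonneg_eq_0_iff) auto
      moreover obtain g where "g \<in> G" using \<open>G \<noteq> {}\<close> by blast
      ultimately show ?thesis by (intro bexI[of _ g]) auto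
    next
      case False
      moreover have "s \<ge> 0" unfolding s_def by (intro sum_nonneg) auto
      ultimately have s: "s > 0" by simp
      have "\<exists>g\<in>G. c \<le> (\<Sum>i<n. max 0 (d i) / s * y i g)"
      proof (rule resp)
        show "(\<Sum>i<n. max 0 (d i) / s) = 1"
          using s by (simp add: s_def flip: sum_divide_distrib)
      qed (use s in auto)
      then obtain g where g: "g \<in> G" "c \<le> (\<Sum>i<n. max 0 (d i) / s * y i g)" by blast
      have "(\<Sum>i<n. max 0 (d i) * (c - y i g)) = s * c - s * (\<Sum>i<n. max 0 (d i) / s * y i g)"
      proof -
        have "s * (\<Sum>i<n. max 0 (d i) / s * y i g) = (\<Sum>i<n. max 0 (d i) * y i g)"
          using s by (simp add: sum_distrib_left)
        moreover have "s * c = (\<Sum>i<n. max 0 (d i) * c)" by (simp add: s_def sum_distrib_right)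
        ultimately show ?thesis by (simp add: right_diff_distrib sum_subtractf)
      qed
      also have "\<dots> \<le> 0" using g(2) s by simp
      finally show ?thesis using g(1) by blast
    qed
  qed
  then obtain g where g: "\<And>d. g d \<in> G" "\<And>d. (\<Sum>i<n. max 0 (d i) * (c - y i (g d))) \<le> 0"
    by metis
  define D where "D = rec_nat (\<lambda>_. 0) (\<lambda>_ d i. d i + (c - y i (g d)))"
  define \<gamma> where "\<gamma> t = g (D t)" for t
  have D: "D 0 = (\<lambda>_. 0)" "\<And>t i. D (Suc t) i = D t i + (c - y i (\<gamma> t))" by (auto simp: D_def \<gamma>_def)
  have Dsum: "D T i = real T * c - (\<Sum>t<T. y i (\<gamma> t))" for T i
    by (induction T) (auto simp: D algebra_simps)
  have sq: "(max 0 (d + u))\<^sup>2 \<le> (max 0 d)\<^sup>2 + 2 * (max 0 d * u) + u\<^sup>2" for d u :: real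
  proof (cases "d \<ge> 0")
    case True
    have "(max 0 (d + u))\<^sup>2 \<le> (d + u)\<^sup>2" by (auto simp: max_def)
    then show ?thesis using True by (simp add: power2_sum)
  next
    case False
    then have "\<bar>max 0 (d + u)\<bar> \<le> \<bar>u\<bar>" by auto
    then have "(max 0 (d + u))\<^sup>2 \<le> u\<^sup>2" by (rule abs_le_square_iff[THEN iffD1])
    then show ?thesis using False by simp
  qed
  \<comment> \<open>By the choice of \<open>\<gamma> T\<close> the mixed terms of the squares sum to
    at most 0, so each step adds at most \<open>n * M\<^sup>2\<close>.\<close>
  have pot: "(\<Sum>i<n. (max 0 (D T i))\<^sup>2) \<le> real T * (real n * M\<^sup>2)" for T
  proof (induction T)
    case (Suc T)
    have "(\<Sum>i<n. (max 0 (D (Suc T) i))\<^sup>2)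
        \<le> (\<Sum>i<n. (max 0 (D T i))\<^sup>2 + 2 * (max 0 (D T i) * (c - y i (\<gamma> T))) + M\<^sup>2)"
    proof (rule sum_mono)
      fix i assume "i \<in> {..<n}"
      then have "(c - y i (\<gamma> T))\<^sup>2 \<le> M\<^sup>2"
        using bnd[of i "\<gamma> T"] g(1) \<open>M \<ge> 0\<close>
        by (intro abs_le_square_iff[THEN iffD1]) (auto simp: \<gamma>_def)
      then show "(max 0 (D (Suc T) i))\<^sup>2 \<le> (max 0 (D T i))\<^sup>2 + 2 * (max 0 (D T i) * (c - y i (\<gamma> T))) + M\<^sup>2"
        using sq[of "D T i" "c - y i (\<gamma> T)"] by (simp add: D)
    qed
    also have "\<dots> = (\<Sum>i<n. (max 0 (D T i))\<^sup>2) + 2 * (\<Sum>i<n. max 0 (D T i) * (c - y i (\<gamma> T))) + real n * M\<^sup>2"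
      by (simp add: sum.distrib sum_distrib_left)
    also have "\<dots> \<le> real T * (real n * M\<^sup>2) + real n * M\<^sup>2"
      using Suc.IH g(2)[of "D T"] by (simp add: \<gamma>_def)
    finally show ?case by (simp add: algebra_simps)
  qed (simp add: D)
  have "D T i \<le> M * sqrt (real n * real T)" if "i < n" for T i
  proof -
    have "(max 0 (D T i))\<^sup>2 \<le> (\<Sum>i<n. (max 0 (D T i))\<^sup>2)"
      using that by (intro member_le_sum) auto
    also have "\<dots> \<le> M\<^sup>2 * (real n * real T)" using pot[of T] by (simp add: mult_ac)
    finally have "max 0 (D T i) \<le> sqrt (M\<^sup>2 * (real n * real T))" by (rule real_le_rsqrt)
    then show ?thesis using \<open>M \<ge> 0\<close> by (simp add: real_sqrt_mult)
  qed
  then show ?thesis using that[of \<gamma>] g(1) by (auto simp: \<gamma>_def[symmetric] Dsum) (simp add: \<gamma>_def)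
qed

section \<open>Weak limits of finitely supported distributions\<close>

text \<open>A bounded upper semicontinuous function is a pointwise limit from above of Lipschitz
  functions. Weak convergence gives the bound for these, and dominated convergence passes it on to
  \<open>F\<close>.\<close>

lemma usc_weak_limit:
  fixes F :: "real \<Rightarrow> real"
  assumes F: "\<And>x. 0 \<le> F x" "\<And>x. F x \<le> C" and usc: "\<And>a. closed {x. a \<le> F x}"
    and Q: "\<And>n. real_distribution (Q n)" "real_distribution M" "weak_conv_m Q M"
    and ge: "\<forall>\<^sub>F n in sequentially. c n \<le> integral\<^sup>L (Q n) F" and c: "c \<longlonglongrightarrow> c0"
  shows "c0 \<le> integral\<^sup>L M F"
proof -
  interpret M: real_distribution M by fact
  have Fm: "F \<in> borel_measurable borel" by (rule borel_measurableI_ge) (use usc in auto)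
  \<comment> \<open>Sup-convolution: \<open>f j\<close> is \<open>j\<close>-Lipschitz, lies above
    \<open>F\<close>, and tends to \<open>F\<close> by semicontinuity.\<close>
  define f where "f j x = (SUP y. F y - real j * \<bar>x - y\<bar>)" for j x
  have pen: "0 \<le> real j * \<bar>x - y\<bar>" for j and x y :: real by simp
  have bdd: "bdd_above (range (\<lambda>y. F y - real j * \<bar>x - y\<bar>))" for j x
  proof (rule bdd_aboveI2)
    show "F y - real j * \<bar>x - y\<bar> \<le> C" for y
      using F(2)[of y] pen[of j x y] by linarith
  qed
  have Ff: "F x \<le> f j x" for j x
    unfolding f_def using cSUP_upper[OF UNIV_I bdd, of x j x] by simp
  have fC: "f j x \<le> C" for j x
    unfolding f_def
  proof (rule cSUP_least)
    show "F y - real j * \<bar>x - y\<bar> \<le> C" for y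
      using F(2)[of y] pen[of j x y] by linarith
  qed simp
  have step: "f j x \<le> f j x' + real j * \<bar>x - x'\<bar>" for j x x'
    unfolding f_def[of j x]
  proof (rule cSUP_least)
    fix y
    have "F y - real j * \<bar>x' - y\<bar> \<le> f j x'"
      unfolding f_def by (rule cSUP_upper[OF UNIV_I bdd])
    moreover have "real j * \<bar>x' - y\<bar> \<le> real j * (\<bar>x - x'\<bar> + \<bar>x - y\<bar>)"
      by (intro mult_left_mono) auto
    ultimately show "F y - real j * \<bar>x - y\<bar> \<le> f j x' + real j * \<bar>x - x'\<bar>"
      by (simp add: distrib_left)
  qed simp
  have "(real j)-lipschitz_on UNIV (f j)" for j
  proof (rule lipschitz_onI)
    show "dist (f j x) (f j x') \<le> real j * dist x x'" for x x'
      using step[of j x x'] step[of j x' x] by (simp add: dist_real_def abs_minus_commute abs_le_iff)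
  qed simp
  then have cont: "continuous_on UNIV (f j)" for j by (rule lipschitz_on_continuous_on)
  then have fm: "f j \<in> borel_measurable borel" for j by (intro borel_measurable_continuous_onI)
  have fb: "norm (f j x) \<le> C" for j x using F(1)[of x] Ff[of x j] fC[of j x] by simp
  have lim: "(\<lambda>j. f j x) \<longlonglongrightarrow> F x" for x
  proof (rule LIMSEQ_I)
    fix e :: real assume e: "e > 0"
    have "open {y. F y < F x + e / 2}"
      using usc[of "F x + e / 2"] by (simp add: closed_def Compl_eq not_le Collect_neg_eq[symmetric])
    then obtain r where r: "r > 0" "\<And>y. \<bar>x - y\<bar> < r \<Longrightarrow> F y < F x + e / 2"
      using e unfolding open_contains_ball by (fastforce simp: dist_real_def subset_iff)
    \<comment> \<open>From \<open>j0\<close> on, the penalty at distance at least \<open>r\<close>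
      is at least the bound \<open>C\<close> of \<open>F\<close>, so only points near
      \<open>x\<close> count.\<close>
    obtain j0 :: nat where j0: "C / r < real j0" using reals_Archimedean2 by blast
    have "norm (f j x - F x) < e" if j: "j \<ge> j0" for j
    proof -
      have "f j x \<le> F x + e / 2"
        unfolding f_def
      proof (rule cSUP_least)
        fix y
        show "F y - real j * \<bar>x - y\<bar> \<le> F x + e / 2"
        proof (cases "\<bar>x - y\<bar> < r")
          case True
          then show ?thesis using r(2)[OF True] pen[of j x y] by linarith
        next
          case False
          have "C \<le> real j0 * r" using j0 r(1) by (simp add: pos_divide_less_eq less_imp_le)
          also have "\<dots> \<le> real j * \<bar>x - y\<bar>" using j False r(1) by (intro mult_mono) auto
          finally show ?thesis using F(1)[of x] F(2)[of y] e by simp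
        qed
      qed simp
      then show ?thesis using Ff[of x j] e by simp
    qed
    then show "\<exists>no. \<forall>j\<ge>no. norm (f j x - F x) < e" by blast
  qed
  have ge': "c0 \<le> integral\<^sup>L M (f j)" for j
  proof -
    have "(\<lambda>n. integral\<^sup>L (Q n) (f j)) \<longlonglongrightarrow> integral\<^sup>L M (f j)"
      by (rule weak_conv_imp_integral_bdd_continuous_conv[OF Q, of "f j" C])
         (use cont fb in \<open>auto simp: continuous_on_eq_continuous_at\<close>)
    moreover have "\<forall>\<^sub>F n in sequentially. c n \<le> integral\<^sup>L (Q n) (f j)"
      using ge
    proof eventually_elim
      case (elim n)
      interpret Qn: real_distribution "Q n" by (rule Q)
      have "integral\<^sup>L (Q n) F \<le> integral\<^sup>L (Q n) (f j)"
        using Fm fm F Ff fb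
        by (intro integral_mono Qn.integrable_const_bound[of _ C]) (auto)
      then show ?case using elim by simp
    qed
    ultimately show ?thesis using c by (intro tendsto_le[OF sequentially_bot])
  qed
  have "(\<lambda>j. integral\<^sup>L M (f j)) \<longlonglongrightarrow> integral\<^sup>L M F"
    using lim fb Fm fm by (intro integral_dominated_convergence[where w = "\<lambda>_. C"]) auto
  then show ?thesis using ge' by (intro LIMSEQ_le_const) auto
qed

text \<open>Empirical distributions of Blackwell sequences satisfy the first \<open>n\<close>
  inequalities up to \<open>1 / (n + 1)\<close>. They are tight since \<open>Z\<close> is compact,
  and semicontinuity preserves all inequalities in a weak limit.\<close>

lemma minimax_distribution:
  fixes Z :: "real set" and F :: "nat \<Rightarrow> real \<Rightarrow> real"
  assumes Z: "compact Z" "Z \<noteq> {}"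
    and F: "\<And>i z. 0 \<le> F i z" "\<And>i z. F i z \<le> C" "\<And>i z. z \<notin> Z \<Longrightarrow> F i z = 0"
    and usc: "\<And>i a. closed {z. a \<le> F i z}"
    and resp: "\<And>n a. (\<And>i. i < n \<Longrightarrow> 0 \<le> a i) \<Longrightarrow> (\<Sum>i<n. a i) = 1 \<Longrightarrow> \<exists>z\<in>Z. c \<le> (\<Sum>i<n. a i * F i z)"
  obtains Q where "real_distribution Q" "measure Q Z = 1" "\<And>i. c \<le> integral\<^sup>L Q (F i)"
proof -
  define M where "M = \<bar>c\<bar> + C"
  have C: "C \<ge> 0" using F(1,2) order_trans by blast
  have M: "M \<ge> 0" "\<bar>c - F i z\<bar> \<le> M" for i z
    using F(1,2)[of i z] C by (auto simp: M_def)
  have "\<exists>z T. (\<forall>t. z t \<in> Z) \<and> T > 0 \<and>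
      (\<forall>i<n. c - (\<Sum>t<T. F i (z t)) / real T \<le> 1 / (real n + 1))" for n :: nat
  proof -
    have "\<exists>z. (\<forall>t. z t \<in> Z) \<and>
      (\<forall>T i. i < n \<longrightarrow> real T * c - (\<Sum>t<T. F i (z t)) \<le> M * sqrt (real n * real T))"
    proof (rule blackwell_sequence[of Z M n c F])
      show "\<exists>z\<in>Z. c \<le> (\<Sum>i<n. a i * F i z)" if "\<And>i. i < n \<Longrightarrow> 0 \<le> a i" "(\<Sum>i<n. a i) = 1" for a
        by (rule resp[OF that])
    qed (use Z(2) M in blast)+
    then obtain z where z: "\<And>t. z t \<in> Z"
      "\<And>T i. i < n \<Longrightarrow> real T * c - (\<Sum>t<T. F i (z t)) \<le> M * sqrt (real n * real T)"
      by blast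
    \<comment> \<open>With \<open>k\<^sup>2\<close> steps the average deficit is at most
      \<open>M * sqrt n / k\<close>, which this \<open>k\<close> brings below
      \<open>1 / (n + 1)\<close>.\<close>
    obtain k :: nat where k: "M * sqrt (real n) * (real n + 1) < real k" "k > 0"
      using reals_Archimedean2[of "max (M * sqrt (real n) * (real n + 1)) 1"] by auto
    have "c - (\<Sum>t<k\<^sup>2. F i (z t)) / real (k\<^sup>2) \<le> 1 / (real n + 1)" if "i < n" for i
    proof -
      have k0: "real k > 0" using k by simp
      have "c - (\<Sum>t<k\<^sup>2. F i (z t)) / real (k\<^sup>2) = (real (k\<^sup>2) * c - (\<Sum>t<k\<^sup>2. F i (z t))) / real (k\<^sup>2)"
        using k0 by (simp add: diff_divide_distrib)
      also have "\<dots> \<le> M * sqrt (real n * real (k\<^sup>2)) / real (k\<^sup>2)"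
        by (intro divide_right_mono z(2) that) simp
      also have "\<dots> = M * sqrt (real n) / real k"
        using k0 by (simp add: real_sqrt_mult power2_eq_square)
      also have "\<dots> \<le> 1 / (real n + 1)"
        using k k0 by (simp add: divide_simps)
      finally show ?thesis .
    qed
    then show ?thesis using z(1) k(2) by (intro exI[of _ z] exI[of _ "k\<^sup>2"]) auto
  qed
  then obtain z T where zT: "\<And>n t. z n t \<in> Z" "\<And>n. T n > (0::nat)"
      "\<And>n i. i < n \<Longrightarrow> c - (\<Sum>t<T n. F i (z n t)) / real (T n) \<le> 1 / (real n + 1)"
    by metis
  define P where "P n = distr (measure_pmf (pmf_of_set {..<T n})) borel (z n)" for n
  have P: "real_distribution (P n)" for n
  proof -
    have "prob_space (P n)" unfolding P_def
      by (rule prob_space.prob_space_distr[OF measure_pmf.prob_space_axioms]) simp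
    then show ?thesis unfolding real_distribution_def real_distribution_axioms_def
      by (simp add: P_def)
  qed
  have PF: "integral\<^sup>L (P n) f = (\<Sum>t<T n. f (z n t)) / real (T n)" if "f \<in> borel_measurable borel"
    for f :: "real \<Rightarrow> real" and n
    using that zT(2)[of n] unfolding P_def
    by (subst integral_distr) (auto simp: integral_pmf_of_set lessThan_empty_iff)
  have Zm: "Z \<in> sets borel" using Z(1) by (intro borel_closed compact_imp_closed)
  have PZ: "measure (P n) B = 1" if "Z \<subseteq> B" "B \<in> sets borel" for n B
  proof -
    interpret real_distribution "P n" by (rule P)
    have "measure (P n) B = integral\<^sup>L (P n) (indicat_real B)" using that by (simp add: P_def)
    also have "\<dots> = (\<Sum>t<T n. 1) / real (T n)"
      using that zT(1) by (subst PF) (auto simp: subset_iff)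
    finally show ?thesis using zT(2)[of n] by simp
  qed
  have "tight P"
    unfolding tight_def
  proof (intro conjI allI impI)
    fix e :: real assume "e > 0"
    obtain b where b: "\<And>x. x \<in> Z \<Longrightarrow> \<bar>x\<bar> \<le> b" "b > 0"
      using compact_imp_bounded[OF Z(1)] unfolding bounded_pos by auto
    have "Z \<subseteq> {- b - 1<..b}" using b by (fastforce simp: abs_le_iff)
    then have "measure (P n) {- b - 1<..b} = 1" for n by (intro PZ) auto
    then show "\<exists>a b. a < b \<and> (\<forall>n. 1 - e < measure (P n) {a<..b})"
      using \<open>e > 0\<close> b(2) by (intro exI[of _ "- b - 1"] exI[of _ b]) auto
  qed (rule P)
  then obtain r Q where rQ: "strict_mono (r :: nat \<Rightarrow> nat)" "real_distribution Q" "weak_conv_m (P \<circ> r) Q"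
    using tight_imp_convergent_subsubsequence[of P id] strict_mono_id by auto
  interpret Q: real_distribution Q by fact
  \<comment> \<open>Mass 1 on \<open>Z\<close> survives the limit since the indicator of a closed
    set is upper semicontinuous.\<close>
  have "1 \<le> integral\<^sup>L Q (indicat_real Z)"
  proof (rule usc_weak_limit[OF _ _ _ _ rQ(2,3), where C = 1 and c = "\<lambda>_. 1"])
    show "closed {x. a \<le> indicat_real Z x}" for a
    proof -
      have "{x. a \<le> indicat_real Z x} = (if a \<le> 0 then UNIV else if a \<le> 1 then Z else {})"
        by (auto simp: indicator_def)
      then show ?thesis using Z(1) by (auto simp: compact_imp_closed)
    qed
    show "\<forall>\<^sub>F n in sequentially. 1 \<le> integral\<^sup>L ((P \<circ> r) n) (indicat_real Z)"
      using PZ[OF order_refl Zm] Zm by (simp add: P_def)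
  qed (use P in \<open>auto simp: indicator_def\<close>)
  then have "measure Q Z = 1" using Zm Q.prob_le_1[of Z] by simp
  moreover have "c \<le> integral\<^sup>L Q (F i)" for i
  proof (rule usc_weak_limit[OF F(1,2) usc _ rQ(2,3), where c = "\<lambda>k. c - 1 / (real (r k) + 1)"])
    have Fm: "F i \<in> borel_measurable borel" by (rule borel_measurableI_ge) (use usc in auto)
    have "c - 1 / (real (r k) + 1) \<le> integral\<^sup>L ((P \<circ> r) k) (F i)" if "k > i" for k
      using zT(3)[of i "r k"] strict_mono_imp_increasing[OF rQ(1), of k] that by (simp add: PF[OF Fm])
    then show "\<forall>\<^sub>F k in sequentially. c - 1 / (real (r k) + 1) \<le> integral\<^sup>L ((P \<circ> r) k) (F i)"
      by (rule eventually_mono[OF eventually_gt_at_top])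
    have "(\<lambda>n. c - 1 / (real n + 1)) \<longlonglongrightarrow> c - 0"
      using LIMSEQ_inverse_real_of_nat
      by (intro tendsto_diff tendsto_const) (simp add: inverse_eq_divide add.commute)
    then show "(\<lambda>k. c - 1 / (real (r k) + 1)) \<longlonglongrightarrow> c"
      using LIMSEQ_subseq_LIMSEQ[OF _ rQ(1)] by (fastforce simp: o_def)
  qed (use P in auto)
  ultimately show ?thesis using that[OF rQ(2)] by blast
qed

subsection \<open>Mixtures and absolutely continuous parts\<close>

text \<open>Merging near-optimal sequences gives one whose union has the largest possible measure;
  adjoining a further member cannot increase it. So a countable union is maximal up to null sets
  although \<open>\<A>\<close> may be uncountable and not closed under unions.\<close>

lemma exhaustion_by_sequence:
  assumes "finite_measure \<mu>" and sets: "\<A> \<subseteq> sets \<mu>" and ne: "\<A> \<noteq> {}"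
  obtains A :: "nat \<Rightarrow> 'a set" where "\<And>k. A k \<in> \<A>" "\<And>B. B \<in> \<A> \<Longrightarrow> emeasure \<mu> (B - (\<Union>k. A k)) = 0"
proof -
  interpret finite_measure \<mu> by fact
  define m where "m A = measure \<mu> (\<Union>k. A k)" for A :: "nat \<Rightarrow> 'a set"
  define Seq where "Seq = {A :: nat \<Rightarrow> 'a set. range A \<subseteq> \<A>}"
  define s where "s = (SUP A\<in>Seq. m A)"
  have "Seq \<noteq> {}" using ne by (auto simp: Seq_def intro!: exI[of _ "\<lambda>_. SOME a. a \<in> \<A>"] some_in_eq[THEN iffD2])
  have bdd: "bdd_above (m ` Seq)" by (rule bdd_aboveI2[of _ _ "measure \<mu> (space \<mu>)"]) (simp add: m_def bounded_measure)
  have meas: "(\<Union>k. A k) \<in> sets \<mu>" if "A \<in> Seq" for A using that sets by (auto simp: Seq_def)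
  have "\<exists>A\<in>Seq. s - 1 / (real n + 1) < m A" for n :: nat
    using less_cSUP_iff[OF \<open>Seq \<noteq> {}\<close> bdd, of "s - 1 / (real n + 1)"] by (simp add: s_def)
  then obtain AA where AA: "\<And>n. AA n \<in> Seq" "\<And>n. s - 1 / (real n + 1) < m (AA n)" by metis
  define A where "A k = AA (fst (prod_decode k)) (snd (prod_decode k))" for k
  have A: "A \<in> Seq" using AA(1) by (auto simp: Seq_def A_def)
  have AAA: "(\<Union>k. AA n k) \<subseteq> (\<Union>k. A k)" for n
  proof
    fix x assume "x \<in> (\<Union>k. AA n k)"
    then obtain k where "x \<in> AA n k" by blast
    then have "x \<in> A (prod_encode (n, k))" by (simp add: A_def)
    then show "x \<in> (\<Union>k. A k)" by blast
  qed
  have mA': "s - 1 / (real n + 1) < m A" for n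
    using AA(2)[of n] finite_measure_mono[OF AAA meas[OF A], of n] unfolding m_def by linarith
  have mA: "s \<le> m A"
  proof (rule field_le_epsilon)
    fix e :: real assume "e > 0"
    then obtain n :: nat where "1 / (real n + 1) < e" by (metis nat_approx_posE of_nat_Suc add.commute)
    then show "s \<le> m A + e" using mA'[of n] by linarith
  qed
  show ?thesis
  proof (rule that[of A])
    show "A k \<in> \<A>" for k using A by (auto simp: Seq_def)
    fix B assume B: "B \<in> \<A>"
    define A' where "A' k = (case k of 0 \<Rightarrow> B | Suc k \<Rightarrow> A k)" for k
    have "A' \<in> Seq" using A B by (auto simp: Seq_def A'_def subset_iff split: nat.split)
    then have "m A' \<le> s" unfolding s_def by (intro cSUP_upper bdd)
    moreover have U: "(\<Union>k. A' k) = (B - (\<Union>k. A k)) \<union> (\<Union>k. A k)"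
      by (auto simp: A'_def split: nat.splits)
    then have "m A' = measure \<mu> (B - (\<Union>k. A k)) + m A"
      unfolding m_def U using B sets meas[OF A] by (intro finite_measure_Union) auto
    ultimately have "measure \<mu> (B - (\<Union>k. A k)) \<le> 0" using mA by simp
    then show "emeasure \<mu> (B - (\<Union>k. A k)) = 0"
      by (simp add: emeasure_eq_measure measure_le_0_iff)
  qed
qed

lemma measurable_nn_integral_kernel:
  fixes \<kappa> :: "'c \<Rightarrow> 'a measure"
  assumes s: "\<And>\<gamma>. sets (\<kappa> \<gamma>) = sets N"
    and m: "\<And>B. B \<in> sets N \<Longrightarrow> (\<lambda>\<gamma>. emeasure (\<kappa> \<gamma>) B) \<in> borel_measurable P"
    and f: "f \<in> borel_measurable N"
  shows "(\<lambda>\<gamma>. \<integral>\<^sup>+x. f x \<partial>\<kappa> \<gamma>) \<in> borel_measurable P"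
  using f
proof (induction f rule: borel_measurable_induct)
  case (cong f g)
  have "(\<integral>\<^sup>+x. f x \<partial>\<kappa> \<gamma>) = (\<integral>\<^sup>+x. g x \<partial>\<kappa> \<gamma>)" for \<gamma>
    using cong(3) sets_eq_imp_space_eq[OF s] by (intro nn_integral_cong) auto
  then show ?case using cong by simp
next
  case (set A)
  then show ?case using m s by (simp add: nn_integral_indicator)
next
  case (mult u c)
  have "u \<in> borel_measurable (\<kappa> \<gamma>)" for \<gamma> using mult measurable_cong_sets[OF s refl] by blast
  then show ?case using mult by (simp add: nn_integral_cmult)
next
  case (add u v)
  have "u \<in> borel_measurable (\<kappa> \<gamma>)" "v \<in> borel_measurable (\<kappa> \<gamma>)" for \<gamma>
    using add measurable_cong_sets[OF s refl] by blast+
  then show ?case using add by (simp add: nn_integral_add)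
next
  case (seq U)
  have U: "U i \<in> borel_measurable (\<kappa> \<gamma>)" for i \<gamma> using seq measurable_cong_sets[OF s refl] by blast
  have "(\<integral>\<^sup>+x. (SUP i. U i) x \<partial>\<kappa> \<gamma>) = (SUP i. \<integral>\<^sup>+x. U i x \<partial>\<kappa> \<gamma>)" for \<gamma>
    unfolding SUP_apply image_comp using nn_integral_monotone_convergence_SUP[OF seq(3) U] by simp
  then show ?case using seq by simp
qed

lemma kernel_mixture_exists:
  fixes \<kappa> :: "'c \<Rightarrow> 'a measure"
  assumes s: "\<And>\<gamma>. sets (\<kappa> \<gamma>) = sets N"
    and m: "\<And>B. B \<in> sets N \<Longrightarrow> (\<lambda>\<gamma>. emeasure (\<kappa> \<gamma>) B) \<in> borel_measurable P"
  obtains \<nu> where "sets \<nu> = sets N"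
    "\<And>f. f \<in> borel_measurable N \<Longrightarrow> (\<integral>\<^sup>+x. f x \<partial>\<nu>) = (\<integral>\<^sup>+\<gamma>. \<integral>\<^sup>+x. f x \<partial>\<kappa> \<gamma> \<partial>P)"
proof -
  define \<nu> where "\<nu> = measure_of (space N) (sets N) (\<lambda>B. \<integral>\<^sup>+\<gamma>. emeasure (\<kappa> \<gamma>) B \<partial>P)"
  have sets_\<nu>: "sets \<nu> = sets N" by (simp add: \<nu>_def)
  have em: "emeasure \<nu> B = (\<integral>\<^sup>+\<gamma>. emeasure (\<kappa> \<gamma>) B \<partial>P)" if "B \<in> sets N" for B
    unfolding \<nu>_def
  proof (rule emeasure_measure_of_sigma)
    show "sigma_algebra (space N) (sets N)" by (rule sets.sigma_algebra_axioms)
    show "positive (sets N) (\<lambda>B. \<integral>\<^sup>+\<gamma>. emeasure (\<kappa> \<gamma>) B \<partial>P)" by (simp add: positive_def)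
    show "countably_additive (sets N) (\<lambda>B. \<integral>\<^sup>+\<gamma>. emeasure (\<kappa> \<gamma>) B \<partial>P)"
    proof (rule countably_additiveI)
      fix A :: "nat \<Rightarrow> 'a set" assume A: "range A \<subseteq> sets N" "disjoint_family A"
      have "(\<Sum>i. \<integral>\<^sup>+\<gamma>. emeasure (\<kappa> \<gamma>) (A i) \<partial>P) = (\<integral>\<^sup>+\<gamma>. (\<Sum>i. emeasure (\<kappa> \<gamma>) (A i)) \<partial>P)"
        using A m by (intro nn_integral_suminf[symmetric]) auto
      also have "\<dots> = (\<integral>\<^sup>+\<gamma>. emeasure (\<kappa> \<gamma>) (\<Union>i. A i) \<partial>P)"
        using A s by (intro nn_integral_cong suminf_emeasure) auto
      finally show "(\<Sum>i. \<integral>\<^sup>+\<gamma>. emeasure (\<kappa> \<gamma>) (A i) \<partial>P) = (\<integral>\<^sup>+\<gamma>. emeasure (\<kappa> \<gamma>) (\<Union>i. A i) \<partial>P)" .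
    qed
  qed (rule that)
  have "(\<integral>\<^sup>+x. f x \<partial>\<nu>) = (\<integral>\<^sup>+\<gamma>. \<integral>\<^sup>+x. f x \<partial>\<kappa> \<gamma> \<partial>P)" if "f \<in> borel_measurable N" for f
    using that
  proof (induction f rule: borel_measurable_induct)
    case (cong f g)
    have "(\<integral>\<^sup>+x. f x \<partial>\<kappa> \<gamma>) = (\<integral>\<^sup>+x. g x \<partial>\<kappa> \<gamma>)" for \<gamma>
      using cong(3) sets_eq_imp_space_eq[OF s] by (intro nn_integral_cong) auto
    moreover have "(\<integral>\<^sup>+x. f x \<partial>\<nu>) = (\<integral>\<^sup>+x. g x \<partial>\<nu>)"
      using cong(3) sets_eq_imp_space_eq[OF sets_\<nu>] by (intro nn_integral_cong) auto
    ultimately show ?case using cong(4) by simp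
  next
    case (set A)
    then show ?case using em s sets_\<nu> by (simp add: nn_integral_indicator)
  next
    case (mult u c)
    have "u \<in> borel_measurable (\<kappa> \<gamma>)" "u \<in> borel_measurable \<nu>" for \<gamma>
      using mult measurable_cong_sets[OF s refl] measurable_cong_sets[OF sets_\<nu> refl] by blast+
    then show ?case using mult measurable_nn_integral_kernel[OF s m] by (simp add: nn_integral_cmult)
  next
    case (add u v)
    have "u \<in> borel_measurable (\<kappa> \<gamma>)" "u \<in> borel_measurable \<nu>"
         "v \<in> borel_measurable (\<kappa> \<gamma>)" "v \<in> borel_measurable \<nu>" for \<gamma>
      using add measurable_cong_sets[OF s refl] measurable_cong_sets[OF sets_\<nu> refl] by blast+
    then show ?case using add measurable_nn_integral_kernel[OF s m] by (simp add: nn_integral_add)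
  next
    case (seq U)
    have U: "U i \<in> borel_measurable (\<kappa> \<gamma>)" "U i \<in> borel_measurable \<nu>" for i \<gamma>
      using seq measurable_cong_sets[OF s refl] measurable_cong_sets[OF sets_\<nu> refl] by blast+
    have "(\<integral>\<^sup>+x. (SUP i. U i) x \<partial>\<kappa> \<gamma>) = (SUP i. \<integral>\<^sup>+x. U i x \<partial>\<kappa> \<gamma>)" for \<gamma>
      unfolding SUP_apply image_comp using nn_integral_monotone_convergence_SUP[OF seq(3) U(1)] by simp
    moreover have "(\<integral>\<^sup>+x. (SUP i. U i) x \<partial>\<nu>) = (SUP i. \<integral>\<^sup>+x. U i x \<partial>\<nu>)"
      unfolding SUP_apply image_comp using nn_integral_monotone_convergence_SUP[OF seq(3) U(2)] by simp
    moreover have "(\<integral>\<^sup>+\<gamma>. (SUP i. \<integral>\<^sup>+x. U i x \<partial>\<kappa> \<gamma>) \<partial>P) = (SUP i. \<integral>\<^sup>+\<gamma>. \<integral>\<^sup>+x. U i x \<partial>\<kappa> \<gamma> \<partial>P)"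
    proof (rule nn_integral_monotone_convergence_SUP)
      show "incseq (\<lambda>i \<gamma>. \<integral>\<^sup>+x. U i x \<partial>\<kappa> \<gamma>)"
        using seq(3) by (auto simp: incseq_def le_fun_def intro!: nn_integral_mono)
      show "(\<lambda>\<gamma>. \<integral>\<^sup>+x. U i x \<partial>\<kappa> \<gamma>) \<in> borel_measurable P" for i
        using seq by (intro measurable_nn_integral_kernel[OF s m]) auto
    qed
    ultimately show ?case using seq by simp
  qed
  with sets_\<nu> show ?thesis by (rule that)
qed

text \<open>Exhausting the \<open>\<nu>\<close>-null subsets of \<open>K\<close> removes the part of
  \<open>\<mu>\<close> that is singular to \<open>\<nu>\<close>, and \<open>ns\<close> says that
  something remains. The density \<open>f\<close> is that of \<open>\<mu>\<close> with respect to
  \<open>\<nu>\<close>, because an Alberti representation has to reproduce \<open>\<mu>\<close>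
  itself.\<close>

lemma absolutely_continuous_part:
  fixes \<mu> \<nu> :: "'a measure"
  assumes \<mu>: "finite_measure \<mu>" and \<nu>: "finite_measure \<nu>" and s: "sets \<nu> = sets \<mu>"
    and K: "K \<in> sets \<mu>"
    and ns: "\<And>Y. Y \<in> sets \<mu> \<Longrightarrow> Y \<subseteq> K \<Longrightarrow> emeasure \<nu> Y = 0 \<Longrightarrow> emeasure \<mu> (K - Y) \<noteq> 0"
  obtains A f where "A \<in> sets \<mu>" "A \<subseteq> K" "emeasure \<mu> A \<noteq> 0" "f \<in> borel_measurable \<mu>"
    "\<And>Y. Y \<in> sets \<mu> \<Longrightarrow> Y \<subseteq> A \<Longrightarrow> emeasure \<mu> Y = (\<integral>\<^sup>+x. f x * indicator Y x \<partial>\<nu>)"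
proof -
  define \<A> where "\<A> = {Y \<in> sets \<mu>. Y \<subseteq> K \<and> emeasure \<nu> Y = 0}"
  have \<A>: "\<A> \<subseteq> sets \<mu>" "\<A> \<noteq> {}" by (auto simp: \<A>_def)
  obtain Y :: "nat \<Rightarrow> 'a set" where Y: "\<And>k. Y k \<in> \<A>" "\<And>B. B \<in> \<A> \<Longrightarrow> emeasure \<mu> (B - (\<Union>k. Y k)) = 0"
    using exhaustion_by_sequence[OF \<mu> \<A>] by metis
  define N where "N = (\<Union>k::nat. Y k)"
  have N: "N \<in> sets \<mu>" "N \<subseteq> K" using Y(1) by (auto simp: N_def \<A>_def)
  have "N \<in> null_sets \<nu>" unfolding N_def by (intro null_sets_UN) (use Y(1) s in \<open>auto simp: \<A>_def null_sets_def\<close>)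
  define A where "A = K - N"
  have A: "A \<in> sets \<mu>" "A \<subseteq> K" using K N by (auto simp: A_def)
  have \<mu>A: "emeasure \<mu> A \<noteq> 0" using ns[OF N] \<open>N \<in> null_sets \<nu>\<close> by (auto simp: A_def)
  define M where "M = density \<mu> (indicator A)"
  have M: "emeasure M B = emeasure \<mu> (A \<inter> B)" if "B \<in> sets \<mu>" for B
    unfolding M_def using A(1) that
    by (simp add: emeasure_density nn_integral_indicator indicator_inter_arith[symmetric])
  have "absolutely_continuous \<nu> M"
  proof (unfold absolutely_continuous_def, rule subsetI)
    fix B assume B: "B \<in> null_sets \<nu>"
    then have "A \<inter> B \<in> null_sets \<nu>" using A(1) s by (metis null_set_Int1)
    then have "A \<inter> B \<in> \<A>" using A s by (auto simp: \<A>_def null_sets_def)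
    then have "emeasure \<mu> (A \<inter> B - N) = 0" using Y(2) by (simp add: N_def)
    moreover have "A \<inter> B - N = A \<inter> B" by (auto simp: A_def)
    ultimately show "B \<in> null_sets M" using B s M by (auto simp: null_sets_def M_def)
  qed
  then obtain f where f: "f \<in> borel_measurable \<nu>" "density \<nu> f = M"
    using sigma_finite_measure.Radon_Nikodym[of \<nu> M] finite_measure.axioms(1)[OF \<nu>] s
    by (auto simp: M_def)
  show ?thesis
  proof (rule that[OF A \<mu>A])
    show "f \<in> borel_measurable \<mu>" using f(1) measurable_cong_sets[OF s refl] by blast
    fix B assume B: "B \<in> sets \<mu>" "B \<subseteq> A"
    then have "emeasure \<mu> B = emeasure M B" using M by (simp add: inf.absorb2)
    also have "\<dots> = (\<integral>\<^sup>+x. f x * indicator B x \<partial>\<nu>)"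
      using B s by (simp add: f(2)[symmetric] emeasure_density[OF f(1)])
    finally show "emeasure \<mu> B = (\<integral>\<^sup>+x. f x * indicator B x \<partial>\<nu>)" .
  qed
qed

section \<open>Approximation tools and the dichotomy for compact curve families\<close>

text \<open>Finite unions of closures of basic sets are a countable supply of closed neighbourhoods
  of compact sets; the minimax theorem tests against countably many functions only.\<close>

lemma compact_finite_basis_neighbourhood:
  fixes K :: "'a::metric_space set"
  assumes ba: "topological_basis (range Ob)" and K: "compact K" "open G" "K \<subseteq> G"
  obtains J :: "nat set" where "finite J" "K \<subseteq> (\<Union>j\<in>J. closure (Ob j))" "(\<Union>j\<in>J. closure (Ob j)) \<subseteq> G"
proof -
  have "\<exists>j. x \<in> Ob j \<and> closure (Ob j) \<subseteq> G" if x: "x \<in> K" for x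
  proof -
    obtain e where e: "e > 0" "cball x e \<subseteq> G"
      using K x by (metis open_contains_cball subsetD)
    have "x \<in> ball x e" using e(1) by simp
    then obtain B' where "B' \<in> range Ob" "x \<in> B'" "B' \<subseteq> ball x e"
      by (rule topological_basisE[OF ba open_ball])
    then obtain j where j: "x \<in> Ob j" "Ob j \<subseteq> ball x e" by blast
    have "closure (Ob j) \<subseteq> cball x e" using j(2) ball_subset_cball by (intro closure_minimal) auto
    then show ?thesis using j(1) e(2) by blast
  qed
  then obtain j where j: "\<And>x. x \<in> K \<Longrightarrow> x \<in> Ob (j x)" "\<And>x. x \<in> K \<Longrightarrow> closure (Ob (j x)) \<subseteq> G"
    by metis
  have op: "\<And>x. x \<in> K \<Longrightarrow> open (Ob (j x))" using topological_basis_open[OF ba] by blast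
  have cov: "K \<subseteq> (\<Union>x\<in>K. Ob (j x))" using j(1) by blast
  obtain D where D: "D \<subseteq> K" "finite D" "K \<subseteq> (\<Union>x\<in>D. Ob (j x))"
    by (rule compactE_image[OF K(1) op cov])
  show ?thesis
  proof (rule that[of "j ` D"])
    show "K \<subseteq> (\<Union>i\<in>j ` D. closure (Ob i))" 
    proof
      fix x assume "x \<in> K"
      then obtain y where "y \<in> D" "x \<in> Ob (j y)" using D(3) by blast
      then show "x \<in> (\<Union>i\<in>j ` D. closure (Ob i))" using subsetD[OF closure_subset, of x "Ob (j y)"] by blast
    qed
  qed (use D j(2) in auto)
qed

lemma finite_measure_compact_inner:
  fixes \<mu> :: "'a::polish_space measure"
  assumes "finite_measure \<mu>" and \<mu>: "sets \<mu> = sets borel" and B: "B \<in> sets borel" and d: "d > 0"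
  shows "\<exists>K. compact K \<and> K \<subseteq> B \<and> measure \<mu> (B - K) \<le> d"
proof -
  interpret finite_measure \<mu> by fact
  have "emeasure \<mu> B = (SUP K\<in>{K. K \<subseteq> B \<and> compact K}. emeasure \<mu> K)"
    by (rule inner_regular[OF \<mu> _ B]) simp
  moreover have "ennreal (measure \<mu> B - d) < emeasure \<mu> B" if "measure \<mu> B > 0"
    using d that by (auto simp: emeasure_eq_measure intro: ennreal_lessI)
  ultimately consider "measure \<mu> B = 0"
    | K where "compact K" "K \<subseteq> B" "ennreal (measure \<mu> B - d) < ennreal (measure \<mu> K)"
    using measure_nonneg[of \<mu> B] unfolding emeasure_eq_measure
    by (cases "measure \<mu> B = 0") (auto simp: less_SUP_iff)
  then show ?thesis
  proof cases
    case 1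
    then show ?thesis using d by (intro exI[of _ "{}"]) auto
  next
    case (2 K)
    have Km: "K \<in> sets \<mu>" using \<mu> 2 by (auto intro: borel_closed compact_imp_closed)
    have "measure \<mu> (B - K) = measure \<mu> B - measure \<mu> K"
      using Km 2 B \<mu> by (intro finite_measure_Diff) auto
    moreover have "measure \<mu> B - d \<le> measure \<mu> K"
      using 2(3) ennreal_leI[of "measure \<mu> K" "measure \<mu> B - d"] by (meson leD linear)
    ultimately show ?thesis using 2 by (intro exI[of _ K]) auto
  qed
qed

text \<open>Borel-Cantelli for the errors \<open>(1/2)^k\<close>: almost every point of
  \<open>S\<close> lies in all but finitely many \<open>E k\<close>, and each tail intersection has
  \<open>J \<gamma>\<close>-measure at most \<open>(1/2)^k\<close> for all large \<open>k\<close>.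
  The sets \<open>E k\<close> serve all \<open>\<gamma>\<close> in \<open>G\<close>, hence so does
  \<open>N\<close>.\<close>

lemma null_set_of_uniformly_small_measures:
  fixes J :: "'c \<Rightarrow> 'a measure"
  assumes "finite_measure \<mu>" and s: "\<And>\<gamma>. sets (J \<gamma>) = sets \<mu>" and S: "S \<in> sets \<mu>"
    and good: "\<And>e::real. e > 0 \<Longrightarrow> \<exists>E\<in>sets \<mu>. E \<subseteq> S \<and> measure \<mu> (S - E) \<le> e \<and>
      (\<forall>\<gamma>\<in>G. emeasure (J \<gamma>) E \<le> ennreal e)"
  shows "\<exists>N\<in>null_sets \<mu>. N \<subseteq> S \<and> (\<forall>\<gamma>\<in>G. emeasure (J \<gamma>) (S - N) = 0)"
proof -
  interpret finite_measure \<mu> by fact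
  have "\<exists>E\<in>sets \<mu>. E \<subseteq> S \<and> measure \<mu> (S - E) \<le> (1/2)^k \<and>
      (\<forall>\<gamma>\<in>G. emeasure (J \<gamma>) E \<le> ennreal ((1/2)^k))" for k :: nat
    by (rule good) simp
  then obtain E where E: "\<And>k::nat. E k \<in> sets \<mu>" "\<And>k. E k \<subseteq> S" "\<And>k. measure \<mu> (S - E k) \<le> (1/2)^k"
      "\<And>k \<gamma>. \<gamma> \<in> G \<Longrightarrow> emeasure (J \<gamma>) (E k) \<le> ennreal ((1/2)^k)"
    by metis
  define N where "N = S - (\<Union>n. \<Inter>k\<in>{n..}. E k)"
  have Nm: "N \<in> sets \<mu>" using E(1) S unfolding N_def by (intro sets.Diff sets.countable_UN sets.countable_INT') auto
  have "AE x in \<mu>. eventually (\<lambda>k. x \<in> space \<mu> - (S - E k)) sequentially"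
  proof (rule borel_cantelli_AE1)
    show "summable (\<lambda>k. measure \<mu> (S - E k))"
      by (rule summable_comparison_test'[of "\<lambda>k. (1/2)^k" 0]) (use E(3) in \<open>auto simp: summable_geometric\<close>)
  qed (use E(1) S in \<open>auto simp: less_top[symmetric]\<close>)
  then have "AE x in \<mu>. x \<notin> N"
    by eventually_elim (auto simp: N_def eventually_sequentially)
  then have "N \<in> null_sets \<mu>" using Nm AE_iff_null_sets by blast
  moreover have "emeasure (J \<gamma>) (S - N) = 0" if \<gamma>: "\<gamma> \<in> G" for \<gamma>
  proof -
    have "(\<Inter>k\<in>{n..}. E k) \<in> null_sets (J \<gamma>)" for n
    proof -
      have m: "(\<Inter>k\<in>{n..}. E k) \<in> sets \<mu>" using E(1) by (intro sets.countable_INT') auto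
      have "emeasure (J \<gamma>) (\<Inter>k\<in>{n..}. E k) \<le> ennreal ((1/2)^k)" if "k \<ge> n" for k
      proof -
        have "emeasure (J \<gamma>) (\<Inter>k\<in>{n..}. E k) \<le> emeasure (J \<gamma>) (E k)"
          using that E(1) s by (intro emeasure_mono) auto
        then show ?thesis using E(4)[OF \<gamma>, of k] by simp
      qed
      moreover have "(\<lambda>k. ennreal ((1/2)^k)) \<longlonglongrightarrow> ennreal 0"
        by (intro tendsto_ennrealI LIMSEQ_power_zero) simp
      ultimately have "emeasure (J \<gamma>) (\<Inter>k\<in>{n..}. E k) \<le> ennreal 0"
        by (intro LIMSEQ_le_const) auto
      then show ?thesis using m s by (auto simp: null_sets_def)
    qed
    then have "(\<Union>n. \<Inter>k\<in>{n..}. E k) \<in> null_sets (J \<gamma>)" by (rule null_sets_UN)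
    moreover have "S - N = (\<Union>n. \<Inter>k\<in>{n..}. E k)" using E(2) by (fastforce simp: N_def)
    ultimately show ?thesis by (metis null_setsD1)
  qed
  ultimately show ?thesis by (intro bexI[of _ N]) (auto simp: N_def)
qed

text \<open>Chebyshev's inequality: on the rest of \<open>K\<close>, the average of the indicators
  of \<open>K - B i\<close> exceeds 1/2, while its integral is at most \<open>e\<close>.\<close>

lemma average_indicator_level_set:
  assumes "finite_measure \<mu>" and B: "\<And>i. i < n \<Longrightarrow> B i \<in> sets \<mu>" and K: "K \<in> sets \<mu>"
    and small: "\<And>i. i < n \<Longrightarrow> measure \<mu> (K - B i) \<le> e"
    and a: "\<And>i. i < n \<Longrightarrow> 0 \<le> a i" "(\<Sum>i<n. a i) = 1"
  shows "{x\<in>K. 1/2 \<le> (\<Sum>i<n. a i * indicat_real (B i) x)} \<in> sets \<mu>"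
    and "measure \<mu> (K - {x\<in>K. 1/2 \<le> (\<Sum>i<n. a i * indicat_real (B i) x)}) \<le> 2 * e"
proof -
  interpret finite_measure \<mu> by fact
  define g where "g x = (\<Sum>i<n. a i * indicat_real (B i) x)" for x
  let ?E = "{x\<in>K. 1/2 \<le> g x}"
  have gm: "g \<in> borel_measurable \<mu>" unfolding g_def using B by (intro borel_measurable_sum) auto
  have "?E = K \<inter> {x\<in>space \<mu>. 1/2 \<le> g x}" using sets.sets_into_space[OF K] by auto
  then show E: "?E \<in> sets \<mu>" using K gm by auto
  have int: "integrable \<mu> (\<lambda>x. a i * indicat_real (K - B i) x)" if "i < n" for i
    using that B K by (intro integrable_mult_right integrable_real_indicator) (auto simp: less_top[symmetric])
  have "measure \<mu> (K - ?E) / 2 = (\<integral>x. indicat_real (K - ?E) x / 2 \<partial>\<mu>)"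
    using E K by simp
  also have "\<dots> \<le> (\<integral>x. (\<Sum>i<n. a i * indicat_real (K - B i) x) \<partial>\<mu>)"
  proof (rule integral_mono)
    show "integrable \<mu> (\<lambda>x. indicat_real (K - ?E) x / 2)"
      using E K by (intro integrable_divide integrable_real_indicator) (auto simp: less_top[symmetric])
    show "integrable \<mu> (\<lambda>x. \<Sum>i<n. a i * indicat_real (K - B i) x)" by (rule Bochner_Integration.integrable_sum) (use int in auto)
    fix x
    show "indicat_real (K - ?E) x / 2 \<le> (\<Sum>i<n. a i * indicat_real (K - B i) x)"
    proof (cases "x \<in> K - ?E")
      case True
      then have "(\<Sum>i<n. a i * indicat_real (K - B i) x) = (\<Sum>i<n. a i - a i * indicat_real (B i) x)"
        by (intro sum.cong) (auto simp: indicator_def)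
      also have "\<dots> = 1 - g x" using a(2) by (simp add: sum_subtractf g_def)
      finally have eq: "(\<Sum>i<n. a i * indicat_real (K - B i) x) = 1 - g x" .
      have "g x < 1/2" using True by auto
      then show ?thesis using True unfolding eq by (simp add: indicator_def)
    next
      case False
      moreover have "0 \<le> (\<Sum>i<n. a i * indicat_real (K - B i) x)" using a(1) by (intro sum_nonneg) auto
      ultimately show ?thesis by simp
    qed
  qed
  also have "\<dots> = (\<Sum>i<n. a i * measure \<mu> (K - B i))"
    using int B K by (subst Bochner_Integration.integral_sum) auto
  also have "\<dots> \<le> (\<Sum>i<n. a i * e)" using small a(1) by (intro sum_mono mult_left_mono) auto
  also have "\<dots> = e" using a(2) by (simp flip: sum_distrib_right)
  finally show "measure \<mu> (K - ?E) \<le> 2 * e" by simp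
qed

text \<open>
  If no piece of \<open>S\<close> of positive measure is represented by curves of the compact family \<open>G\<close>, then no
  average of the measures \<open>curve_measure \<gamma>\<close>, \<open>\<gamma> \<in> G\<close>, charges \<open>S\<close> robustly, and the minimax argument
  turns this into a null set that carries \<open>S\<close> for all \<open>\<gamma> \<in> G\<close> at once.
\<close>

lemma curve_family_dichotomy:
  fixes \<mu> :: "'a::polish_space measure" and W :: "(real \<times> 'a) set"
  assumes \<mu>: "finite_measure \<mu>" "sets \<mu> = sets borel" and S: "S \<in> sets borel"
    and W: "compact W" and R: "closed R" and "L > 0"
    and RL: "\<And>s x t y. ((s, x), (t, y)) \<in> R \<Longrightarrow> dist s t / L \<le> dist x y \<and> dist x y \<le> L * dist s t"
    and G: "G = {\<gamma>. curve_graph \<gamma> \<subseteq> W \<and> curve_graph \<gamma> \<times> curve_graph \<gamma> \<subseteq> R}"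
    and norep: "\<And>A P f. A \<in> sets borel \<Longrightarrow> A \<subseteq> S \<Longrightarrow> prob_space P \<Longrightarrow> sets P = sets borel \<Longrightarrow>
       (AE \<gamma> in P. \<gamma> \<in> G) \<Longrightarrow> f \<in> borel_measurable borel \<Longrightarrow>
       (\<And>Y. Y \<in> sets borel \<Longrightarrow> Y \<subseteq> A \<Longrightarrow>
          emeasure \<mu> Y = (\<integral>\<^sup>+\<gamma>. emeasure (density (curve_measure \<gamma>) f) Y \<partial>P)) \<Longrightarrow>
       emeasure \<mu> A = 0"
  shows "\<exists>N\<in>null_sets \<mu>. N \<subseteq> S \<and> (\<forall>\<gamma>\<in>G. emeasure (curve_measure \<gamma>) (S - N) = 0)"
proof (rule ccontr)
  assume "\<not> ?thesis"
  moreover have "?thesis" if "\<And>e::real. e > 0 \<Longrightarrow> \<exists>E\<in>sets \<mu>. E \<subseteq> S \<and> measure \<mu> (S - E) \<le> e \<and>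
      (\<forall>\<gamma>\<in>G. emeasure (curve_measure \<gamma>) E \<le> ennreal e)"
    by (rule null_set_of_uniformly_small_measures[OF \<mu>(1) _ _ that]) (use \<mu>(2) S in auto)
  ultimately obtain e :: real where e: "e > 0"
    and bad: "\<And>E. E \<in> sets borel \<Longrightarrow> E \<subseteq> S \<Longrightarrow> measure \<mu> (S - E) \<le> e \<Longrightarrow>
      \<exists>\<gamma>\<in>G. emeasure (curve_measure \<gamma>) E > ennreal e"
    unfolding \<mu>(2) by (meson not_le)
  interpret finite_measure \<mu> by fact
  note inner = finite_measure_compact_inner[OF \<mu>]
  obtain K where K: "compact K" "K \<subseteq> S" "measure \<mu> (S - K) \<le> e / 2"
    using inner[OF S, of "e / 2"] e by auto
  have Kb: "K \<in> sets borel" using K(1) by (intro borel_closed compact_imp_closed)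
  obtain Ob :: "nat \<Rightarrow> 'a set" where ba: "topological_basis (range Ob)"
    by (rule topological_basis_sequence)
  \<comment> \<open>Coding finite lists by numbers enumerates all finite unions of closures of basic
    sets. Those that miss too much of \<open>K\<close> are replaced by the whole space in
    \<open>B\<close>, so every index is a valid test set.\<close>
  define V where "V i = (\<Union>j\<in>set (from_nat i :: nat list). closure (Ob j))" for i
  define B where "B i = (if measure \<mu> (K - V i) \<le> e / 4 then V i else UNIV)" for i
  have Bc: "closed (B i)" for i by (auto simp: B_def V_def)
  then have Bm: "B i \<in> sets borel" for i by (intro borel_closed)
  have Bsmall: "measure \<mu> (K - B i) \<le> e / 4" for i using e by (auto simp: B_def)
  have "\<exists>Z \<Theta>. compact (Z :: real set) \<and> continuous_on Z \<Theta> \<and> \<Theta> ` Z = G"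
    unfolding G by (rule compact_curve_family_parametrization[OF W R \<open>L > 0\<close> RL], assumption) blast
  then obtain Z :: "real set" and \<Theta> where Z: "compact Z" "continuous_on Z \<Theta>" "\<Theta> ` Z = G" by blast
  have cf: "emeasure (curve_measure \<gamma>) E = ennreal (measure (curve_measure \<gamma>) E)" for \<gamma> :: "'a curve" and E
    by (rule finite_measure.emeasure_eq_measure[OF curve_measure_finite])
  obtain b where b: "b \<ge> 0" "\<And>p. p \<in> W \<Longrightarrow> \<bar>fst p\<bar> \<le> b"
  proof -
    have "bounded (fst ` W)" using W by (intro compact_imp_bounded compact_continuous_image continuous_intros)
    then obtain b where "b > 0" "\<forall>x\<in>fst ` W. norm x \<le> b" unfolding bounded_pos by blast
    then show ?thesis using that[of b] by force
  qed
  have Gbound: "measure (curve_measure \<gamma>) E \<le> 2 * b" if "\<gamma> \<in> G" "E \<in> sets borel" for \<gamma> E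
  proof -
    have "curve_dom \<gamma> \<subseteq> {- b..b}"
    proof
      fix t assume "t \<in> curve_dom \<gamma>"
      then have "(t, curve_fun \<gamma> t) \<in> W" using that G by (auto simp: curve_graph_def)
      then show "t \<in> {- b..b}" using b(2) by (force simp: abs_le_iff)
    qed
    then have "emeasure (curve_measure \<gamma>) E \<le> emeasure lborel {- b..b}"
      using that(2) by (subst emeasure_curve_measure) (auto intro!: emeasure_mono)
    then show ?thesis using b(1) unfolding cf by simp
  qed
  define F where "F i z = (if z \<in> Z then measure (curve_measure (\<Theta> z)) (B i) else 0)" for i z
  \<comment> \<open>Some curve gives \<open>E\<close> more than \<open>e\<close>, and on
    \<open>E\<close> the averaged indicators are at least 1/2.\<close>
  define c where "c = e / 2"
  have resp: "\<exists>z\<in>Z. c \<le> (\<Sum>i<n. a i * F i z)"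
    if a: "\<And>i. i < n \<Longrightarrow> 0 \<le> a i" "(\<Sum>i<n. a i) = 1" for n and a :: "nat \<Rightarrow> real"
  proof -
    \<comment> \<open>The losses add up to \<open>e\<close>: at most \<open>e / 2\<close> for
      \<open>S - K\<close> and \<open>2 * (e / 4)\<close> for \<open>K - E\<close>, so
      \<open>bad\<close> applies to \<open>E\<close>.\<close>
    define E where "E = {x\<in>K. 1/2 \<le> (\<Sum>i<n. a i * indicat_real (B i) x)}"
    have E: "E \<in> sets borel" "measure \<mu> (K - E) \<le> 2 * (e / 4)" "E \<subseteq> K"
      using average_indicator_level_set[OF \<mu>(1) _ _ _ a, of B K "e / 4"] Bm Kb Bsmall \<mu>(2)
      by (auto simp: E_def)
    have "measure \<mu> (S - E) \<le> measure \<mu> ((S - K) \<union> (K - E))"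
      using S Kb E(1) \<mu>(2) by (intro finite_measure_mono) auto
    also have "\<dots> \<le> measure \<mu> (S - K) + measure \<mu> (K - E)"
      using S Kb E(1) \<mu>(2) by (intro measure_subadditive) auto
    also have "\<dots> \<le> e" using K(3) E(2) by simp
    finally obtain \<gamma> where \<gamma>: "\<gamma> \<in> G" "emeasure (curve_measure \<gamma>) E > ennreal e"
      using bad[OF E(1)] E(3) K(2) by blast
    then obtain z where z: "z \<in> Z" "\<gamma> = \<Theta> z" using Z(3) by blast
    interpret J: finite_measure "curve_measure \<gamma>" by (rule curve_measure_finite)
    have int: "integrable (curve_measure \<gamma>) (\<lambda>x. a i * indicat_real (B i) x)" for i
      using Bm by (intro integrable_mult_right integrable_real_indicator) (auto simp: less_top[symmetric])
    have "c \<le> measure (curve_measure \<gamma>) E / 2"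
      using \<gamma>(2) e unfolding cf by (simp add: c_def ennreal_less_iff)
    also have "\<dots> = (\<integral>x. indicat_real E x / 2 \<partial>curve_measure \<gamma>)" using E(1) by simp
    also have "\<dots> \<le> (\<integral>x. (\<Sum>i<n. a i * indicat_real (B i) x) \<partial>curve_measure \<gamma>)"
    proof (rule integral_mono)
      show "integrable (curve_measure \<gamma>) (\<lambda>x. indicat_real E x / 2)"
        using E(1) by (intro integrable_divide integrable_real_indicator) (auto simp: less_top[symmetric])
      show "integrable (curve_measure \<gamma>) (\<lambda>x. \<Sum>i<n. a i * indicat_real (B i) x)"
        by (rule Bochner_Integration.integrable_sum) (rule int)
      show "indicat_real E x / 2 \<le> (\<Sum>i<n. a i * indicat_real (B i) x)" for x
        using a(1) by (cases "x \<in> E") (auto simp: E_def intro!: sum_nonneg)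
    qed
    also have "\<dots> = (\<Sum>i<n. a i * measure (curve_measure \<gamma>) (B i))"
      using int Bm by (subst Bochner_Integration.integral_sum) auto
    finally show ?thesis using z by (auto simp: F_def)
  qed
  obtain \<gamma>0 where \<gamma>0: "\<gamma>0 \<in> G" using bad[OF S order_refl] e by auto
  then obtain z0 where z0: "z0 \<in> Z" using Z(3) by blast
  have usc: "closed {z. a \<le> F i z}" for i a
  proof (cases "a \<le> 0")
    case True
    then have "{z. a \<le> F i z} = UNIV" by (auto simp: F_def intro: order_trans[OF _ measure_nonneg])
    then show ?thesis by simp
  next
    case False
    then have "{z. a \<le> F i z} = Z \<inter> \<Theta> -` {\<gamma>. ennreal a \<le> emeasure (curve_measure \<gamma>) (B i)}"
      by (auto simp: F_def cf)
    then show ?thesis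
      using continuous_closed_preimage[OF Z(2) compact_imp_closed[OF Z(1)] closed_curve_measure_ge[OF Bc]]
      by simp
  qed
  have F0: "0 \<le> F i z" "F i z \<le> 2 * b" "z \<notin> Z \<Longrightarrow> F i z = 0" for i z
    using Gbound[of "\<Theta> z" "B i"] Z(3) b(1) Bm by (auto simp: F_def)
  have Zne: "Z \<noteq> {}" using z0 by blast
  have "\<exists>Q. real_distribution Q \<and> measure Q Z = 1 \<and> (\<forall>i. c \<le> integral\<^sup>L Q (F i))"
    by (rule minimax_distribution[OF Z(1) Zne F0 usc resp]) blast+
  then obtain Q where Q: "real_distribution Q" "measure Q Z = 1" "\<And>i. c \<le> integral\<^sup>L Q (F i)" by blast
  interpret Q: real_distribution Q by (rule Q)
  have Zb: "Z \<in> sets borel" using Z(1) by (intro borel_closed compact_imp_closed)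
  \<comment> \<open>The constant value \<open>\<gamma>0\<close> off \<open>Z\<close> makes the
    parametrization a Borel map on the whole line with values in \<open>G\<close>.\<close>
  define \<Theta>' where "\<Theta>' z = (if z \<in> Z then \<Theta> z else \<gamma>0)" for z
  have \<Theta>'m: "\<Theta>' \<in> borel_measurable borel"
    unfolding \<Theta>'_def using Zb Z(2) by (intro borel_measurable_continuous_on_if continuous_on_const) auto
  then have \<Theta>'Q: "\<Theta>' \<in> measurable Q borel" by simp
  have \<Theta>'G: "\<Theta>' z \<in> G" for z using Z(3) \<gamma>0 by (auto simp: \<Theta>'_def)
  define P where "P = distr Q borel \<Theta>'"
  have P: "prob_space P" "sets P = sets borel"
    unfolding P_def using \<Theta>'Q by (auto intro: Q.prob_space_distr)
  interpret P: prob_space P by (rule P)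
  have Gm: "G \<in> sets borel"
    using compact_continuous_image[OF Z(2,1)] Z(3) by (auto intro: borel_closed compact_imp_closed)
  have PG: "AE \<gamma> in P. \<gamma> \<in> G"
    unfolding P_def using Gm \<Theta>'G by (subst AE_distr_iff[OF \<Theta>'Q]) auto
  have Jm: "(\<lambda>\<gamma>. emeasure (curve_measure \<gamma>) E) \<in> borel_measurable P" if "E \<in> sets borel" for E
    using measurable_emeasure_curve_measure[OF that] measurable_cong_sets[OF P(2) refl] by blast
  obtain \<nu> where \<nu>: "sets \<nu> = sets borel"
      "\<And>f. f \<in> borel_measurable borel \<Longrightarrow> (\<integral>\<^sup>+x. f x \<partial>\<nu>) = (\<integral>\<^sup>+\<gamma>. \<integral>\<^sup>+x. f x \<partial>curve_measure \<gamma> \<partial>P)"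
    by (rule kernel_mixture_exists[of curve_measure borel P]) (use Jm in auto)
  have em\<nu>: "emeasure \<nu> E = (\<integral>\<^sup>+\<gamma>. emeasure (curve_measure \<gamma>) E \<partial>P)" if "E \<in> sets borel" for E
    using \<nu>(2)[of "indicator E"] that \<nu>(1) by (simp add: nn_integral_indicator)
  have \<nu>B: "emeasure \<nu> (B i) \<ge> ennreal c" for i
  proof -
    have "ennreal c \<le> ennreal (integral\<^sup>L Q (F i))" using Q(3) by (rule ennreal_leI)
    also have "\<dots> = (\<integral>\<^sup>+z. ennreal (F i z) \<partial>Q)"
    proof (rule nn_integral_eq_integral[symmetric])
      have "F i \<in> borel_measurable borel" by (rule borel_measurableI_ge) (use usc in auto)
      then show "integrable Q (F i)" using F0 by (intro Q.integrable_const_bound[of _ "2 * b"]) auto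
    qed (use F0 in auto)
    also have "\<dots> \<le> (\<integral>\<^sup>+z. emeasure (curve_measure (\<Theta>' z)) (B i) \<partial>Q)"
      by (intro nn_integral_mono) (auto simp: F_def \<Theta>'_def cf)
    also have "\<dots> = (\<integral>\<^sup>+\<gamma>. emeasure (curve_measure \<gamma>) (B i) \<partial>P)"
      unfolding P_def using \<Theta>'Q measurable_emeasure_curve_measure[OF Bm] by (simp add: nn_integral_distr)
    also have "\<dots> = emeasure \<nu> (B i)" using em\<nu>[OF Bm] by simp
    finally show ?thesis .
  qed
  have \<nu>fin: "finite_measure \<nu>"
  proof
    have "emeasure \<nu> UNIV = (\<integral>\<^sup>+\<gamma>. emeasure (curve_measure \<gamma>) UNIV \<partial>P)" by (rule em\<nu>) simp
    also have "\<dots> \<le> (\<integral>\<^sup>+\<gamma>. ennreal (2 * b) \<partial>P)"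
    proof (rule nn_integral_mono_AE)
      show "AE \<gamma> in P. emeasure (curve_measure \<gamma>) UNIV \<le> ennreal (2 * b)"
        using PG by eventually_elim (auto simp: cf intro!: ennreal_leI Gbound)
    qed
    also have "\<dots> < \<infinity>" by (simp add: P.emeasure_space_1)
    finally show "emeasure \<nu> (space \<nu>) \<noteq> \<infinity>" using sets_eq_imp_space_eq[OF \<nu>(1)] by simp
  qed
  have \<nu>UNIV: "emeasure \<nu> (space \<nu>) \<noteq> \<infinity>"
    using finite_measure.emeasure_finite[OF \<nu>fin] by simp
  \<comment> \<open>Were \<open>\<mu>\<close> and \<open>\<nu>\<close> singular on \<open>K\<close>,
    regularity would give some \<open>V i\<close> of \<open>\<nu>\<close>-measure below
    \<open>c\<close> that nearly covers \<open>K\<close>; but then it is the test set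
    \<open>B i\<close>, which has \<open>\<nu>\<close>-measure at least \<open>c\<close>.\<close>
  have ns: "emeasure \<mu> (K - Y) \<noteq> 0" if Y: "Y \<in> sets \<mu>" "Y \<subseteq> K" "emeasure \<nu> Y = 0" for Y
  proof
    assume 0: "emeasure \<mu> (K - Y) = 0"
    have Yb: "Y \<in> sets borel" using Y(1) \<mu>(2) by simp
    obtain K1 where K1: "compact K1" "K1 \<subseteq> Y" "measure \<mu> (Y - K1) \<le> e / 4"
      using inner[OF Yb, of "e / 4"] e by auto
    have K1b: "K1 \<in> sets borel" using K1(1) by (intro borel_closed compact_imp_closed)
    have "emeasure \<nu> K1 \<le> emeasure \<nu> Y" using K1(2) Yb \<nu>(1) by (intro emeasure_mono) auto
    then have "emeasure \<nu> K1 < ennreal c" using Y(3) e by (simp add: c_def)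
    then have "(INF V\<in>{V. K1 \<subseteq> V \<and> open V}. emeasure \<nu> V) < ennreal c"
      using outer_regular[OF \<nu>(1) \<nu>UNIV K1b] by simp
    then obtain O' where O': "K1 \<subseteq> O'" "open O'" "emeasure \<nu> O' < ennreal c"
      unfolding INF_less_iff by blast
    obtain J where J: "finite J" "K1 \<subseteq> (\<Union>j\<in>J. closure (Ob j))" "(\<Union>j\<in>J. closure (Ob j)) \<subseteq> O'"
      using compact_finite_basis_neighbourhood[OF ba K1(1) O'(2,1)] by blast
    obtain l :: "nat list" where l: "set l = J" using finite_list[OF J(1)] by blast
    define i where "i = to_nat l"
    have V: "V i = (\<Union>j\<in>J. closure (Ob j))" by (simp add: V_def i_def l)
    have "measure \<mu> (K - V i) \<le> measure \<mu> ((K - Y) \<union> (Y - K1))"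
      using J(2) Kb Yb K1b \<mu>(2) unfolding V by (intro finite_measure_mono) auto
    also have "\<dots> \<le> measure \<mu> (K - Y) + measure \<mu> (Y - K1)"
      using Kb Yb K1b \<mu>(2) by (intro measure_subadditive) auto
    also have "\<dots> \<le> e / 4" using 0 K1(3) by (simp add: measure_def)
    finally have "B i = V i" by (simp add: B_def)
    then have "ennreal c \<le> emeasure \<nu> (V i)" using \<nu>B[of i] by simp
    also have "\<dots> \<le> emeasure \<nu> O'" using J(3) O'(2) \<nu>(1) unfolding V by (intro emeasure_mono) auto
    finally show False using O'(3) by simp
  qed
  have \<nu>\<mu>: "sets \<nu> = sets \<mu>" using \<nu>(1) \<mu>(2) by simp
  have K\<mu>: "K \<in> sets \<mu>" using Kb \<mu>(2) by simp
  have "\<exists>A f. A \<in> sets \<mu> \<and> A \<subseteq> K \<and> emeasure \<mu> A \<noteq> 0 \<and> f \<in> borel_measurable \<mu> \<and>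
    (\<forall>Y\<in>sets \<mu>. Y \<subseteq> A \<longrightarrow> emeasure \<mu> Y = (\<integral>\<^sup>+x. f x * indicator Y x \<partial>\<nu>))"
  proof (rule absolutely_continuous_part[OF \<mu>(1) \<nu>fin \<nu>\<mu> K\<mu>])
    show "emeasure \<mu> (K - Y) \<noteq> 0" if "Y \<in> sets \<mu>" "Y \<subseteq> K" "emeasure \<nu> Y = 0" for Y
      by (rule ns[OF that])
  qed blast
  then obtain A f where A: "A \<in> sets \<mu>" "A \<subseteq> K" "emeasure \<mu> A \<noteq> 0" "f \<in> borel_measurable \<mu>"
    "\<And>Y. Y \<in> sets \<mu> \<Longrightarrow> Y \<subseteq> A \<Longrightarrow> emeasure \<mu> Y = (\<integral>\<^sup>+x. f x * indicator Y x \<partial>\<nu>)"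
    by blast
  have fm: "f \<in> borel_measurable borel" using A(4) measurable_cong_sets[OF \<mu>(2) refl] by blast
  have "emeasure \<mu> A = 0"
  proof (rule norep[OF _ _ P PG fm])
    show "A \<in> sets borel" "A \<subseteq> S" using A(1,2) K(2) \<mu>(2) by auto
    fix Y assume Y: "Y \<in> sets borel" "Y \<subseteq> A"
    have "emeasure \<mu> Y = (\<integral>\<^sup>+x. f x * indicator Y x \<partial>\<nu>)" using A(5) Y \<mu>(2) by simp
    also have "\<dots> = (\<integral>\<^sup>+\<gamma>. \<integral>\<^sup>+x. f x * indicator Y x \<partial>curve_measure \<gamma> \<partial>P)"
      using fm Y by (intro \<nu>(2)) auto
    also have "\<dots> = (\<integral>\<^sup>+\<gamma>. emeasure (density (curve_measure \<gamma>) f) Y \<partial>P)"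
      using fm Y by (intro nn_integral_cong emeasure_density[symmetric])
        (auto simp: measurable_cong_sets[OF sets_curve_measure refl])
    finally show "emeasure \<mu> Y = (\<integral>\<^sup>+\<gamma>. emeasure (density (curve_measure \<gamma>) f) Y \<partial>P)" .
  qed
  then show False using A(3) by simp
qed

subsection \<open>Representing a set by curves in a cone\<close>

definition represented_in_direction ::
    "'a::polish_space measure \<Rightarrow> 'a set \<Rightarrow> ('a \<Rightarrow> real ^ 'n) \<Rightarrow> (real ^ 'n) set \<Rightarrow> bool" where
  "represented_in_direction \<mu> A \<phi> C \<longleftrightarrow>
     (\<exists>P M. alberti_representation \<mu> A P M \<and> alberti_in_direction P M \<phi> C)"

lemma curve_measure_null:
  assumes B: "B \<in> sets borel" and 0: "hausdorff1 (curve_image \<gamma> \<inter> B) = 0"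
  shows "B \<in> null_sets (curve_measure \<gamma>)"
proof -
  let ?T = "{t \<in> curve_dom \<gamma>. curve_fun \<gamma> t \<in> B}"
  have "curve_fun \<gamma> ` ?T = curve_image \<gamma> \<inter> B" by (auto simp: curve_image_def)
  then have "negligible ?T" using 0 by (intro curve_image_hausdorff1_null_imp_negligible[of _ \<gamma>]) auto
  then have "?T \<in> null_sets lborel"
    using borel_curve_vimage[OF B] by (simp add: negligible_iff_null_sets null_sets_completion_iff)
  then show ?thesis using B by (simp add: null_sets_def emeasure_curve_measure)
qed

lemma density_curve_measure_null:
  assumes "f \<in> borel_measurable borel" and "B \<in> null_sets (curve_measure \<gamma>)"
  shows "emeasure (density (curve_measure \<gamma>) f) B = 0"
proof -
  have "f \<in> borel_measurable (curve_measure \<gamma>)"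
    using assms(1) measurable_cong_sets[OF sets_curve_measure refl] by blast
  then have "B \<in> null_sets (density (curve_measure \<gamma>) f)"
    using assms(2) AE_not_in[OF assms(2)] by (subst null_sets_density_iff) (auto elim: eventually_mono)
  then show ?thesis by (rule null_setsD1)
qed

text \<open>One density \<open>f\<close> on \<open>X\<close> serves all curves, so measurability in
  the curve reduces to that of \<open>curve_measure\<close>, and the secant bounds supply the
  direction.\<close>

lemma secant_family_represents:
  fixes \<mu> :: "'a::polish_space measure" and \<phi> :: "'a \<Rightarrow> real ^ 'n"
  assumes lip: "M-lipschitz_on UNIV \<phi>" and "N > 0" and P: "prob_space P" "sets P = sets borel"
    and rel: "AE \<gamma> in P. curve_graph \<gamma> \<times> curve_graph \<gamma> \<subseteq> secant_rel \<phi> w \<theta> N"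
    and f: "f \<in> borel_measurable borel"
    and rep: "\<And>Y. Y \<in> sets borel \<Longrightarrow> Y \<subseteq> A \<Longrightarrow>
      emeasure \<mu> Y = (\<integral>\<^sup>+\<gamma>. emeasure (density (curve_measure \<gamma>) f) Y \<partial>P)"
  shows "represented_in_direction \<mu> A \<phi> (closed_cone w \<theta>)"
proof -
  let ?M = "\<lambda>\<gamma>. density (curve_measure \<gamma>) f"
  have f': "f \<in> borel_measurable (curve_measure \<gamma>)" for \<gamma>
    using f measurable_cong_sets[OF sets_curve_measure refl] by blast
  have "(\<lambda>\<gamma>. emeasure (?M \<gamma>) Y) \<in> borel_measurable borel" if "Y \<in> sets borel" for Y
  proof -
    have "(\<lambda>\<gamma>. \<integral>\<^sup>+x. f x * indicator Y x \<partial>curve_measure \<gamma>) \<in> borel_measurable borel"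
      by (rule measurable_nn_integral_kernel[where N = borel])
         (use that f measurable_emeasure_curve_measure in auto)
    then show ?thesis using that f' by (simp add: emeasure_density)
  qed
  moreover have "emeasure (?M \<gamma>) B = 0" if "B \<in> sets borel" "hausdorff1 (curve_image \<gamma> \<inter> B) = 0" for \<gamma> B
    by (intro density_curve_measure_null f curve_measure_null that)
  ultimately have "alberti_representation \<mu> A P ?M"
    unfolding alberti_representation_def using P rep by simp
  moreover have "alberti_in_direction P ?M \<phi> (closed_cone w \<theta>)"
    unfolding alberti_in_direction_def using rel
  proof eventually_elim
    case (elim \<gamma>)
    show ?case unfolding in_direction_def
      by (intro pullback_measure_density_AE f secant_curve_direction[OF lip \<open>N > 0\<close> elim])
  qed
  ultimately show ?thesis unfolding represented_in_direction_def by blast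
qed

text \<open>The zero measures represent a null set, and every direction condition then holds
  vacuously. This provides non-empty families for exhaustion and absorbs leftover null sets.\<close>

lemma represented_in_direction_null:
  assumes A: "A \<in> null_sets \<mu>" and \<mu>: "sets \<mu> = sets borel"
  shows "represented_in_direction \<mu> A \<phi> C"
proof -
  define P :: "'a curve measure" where "P = return borel undefined"
  define M :: "'a curve \<Rightarrow> 'a measure" where "M = (\<lambda>_. null_measure borel)"
  have "prob_space P" unfolding P_def by (rule prob_space_return) simp
  moreover have "emeasure \<mu> Y = 0" if "Y \<in> sets borel" "Y \<subseteq> A" for Y
    using null_sets_subset[OF A] that \<mu> by auto
  ultimately have "alberti_representation \<mu> A P M"
    by (simp add: alberti_representation_def P_def M_def)
  moreover have "AE t in pullback_measure \<gamma> (M \<gamma>). Q t" for \<gamma> Q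
  proof (rule AE_I')
    have "emeasure (pullback_measure \<gamma> (M \<gamma>)) UNIV = 0"
      by (subst emeasure_pullback_measure) (auto simp: M_def)
    then show "UNIV \<in> null_sets (pullback_measure \<gamma> (M \<gamma>))"
      by (auto simp: null_sets_def pullback_measure_def)
  qed simp
  then have "alberti_in_direction P M \<phi> C"
    by (simp add: alberti_in_direction_def in_direction_def)
  ultimately show ?thesis unfolding represented_in_direction_def by blast
qed

lemma secant_rel_refl: "((t, x), (t, x)) \<in> secant_rel \<phi> w \<theta> N"
  by (simp add: secant_rel_def)

lemma secant_rel_mono:
  assumes "0 < N" "N \<le> N'" shows "secant_rel \<phi> w \<theta> N \<subseteq> secant_rel \<phi> w \<theta> N'"
proof -
  have le: "d / N' \<le> d / N" "N * d \<le> N' * d" if "d \<ge> 0" for d :: real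
    using assms that by (auto intro!: divide_left_mono mult_right_mono)
  show ?thesis
  proof
    fix p assume p: "p \<in> secant_rel \<phi> w \<theta> N"
    obtain s x t y where "p = ((s, x), (t, y))" by (metis surj_pair)
    then show "p \<in> secant_rel \<phi> w \<theta> N'"
      using p le[OF zero_le_dist[of s t]] by (simp add: secant_rel_def)
  qed
qed

section \<open>From derivatives in a cone to secants in a wider cone\<close>

text \<open>The strict inequality \<open>\<theta> < \<theta>'\<close> leaves room for difference
  quotients close to the derivative. A single integer \<open>m\<close> controls the neighbourhood
  and all constants, so countably many relations cover every case.\<close>

lemma locally_secant_of_derivative:
  fixes \<phi> :: "'a::metric_space \<Rightarrow> real ^ 'n"
  assumes g: "lipschitz_extension g \<phi> \<gamma>" and D: "(g has_vector_derivative D) (at t)"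
    and cone: "D \<in> closed_cone w \<theta> - {0}" and \<theta>: "\<theta> < \<theta>'" and t: "t \<in> curve_dom \<gamma>"
  obtains m :: nat where "\<And>s. s \<in> curve_dom \<gamma> \<Longrightarrow> \<bar>s - t\<bar> < 1 / (real m + 1) \<Longrightarrow>
    ((t, curve_fun \<gamma> t), (s, curve_fun \<gamma> s)) \<in> secant_rel \<phi> w \<theta>' (real m + 1)"
proof -
  obtain L where L: "L > 0" "L-lipschitz_on (curve_dom \<gamma>) (curve_fun \<gamma>)"
    "\<And>s t. s \<in> curve_dom \<gamma> \<Longrightarrow> t \<in> curve_dom \<gamma> \<Longrightarrow> dist s t \<le> L * dist (curve_fun \<gamma> s) (curve_fun \<gamma> t)"
    using curve_lipschitz[of \<gamma>] by metis
  let ?q = "\<lambda>s. (g s - g t) /\<^sub>R (s - t)"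
  have lim: "(?q \<longlongrightarrow> D) (at t)" by (rule has_vector_derivative_slope[OF D])
  have D0: "norm D > 0" using cone by simp
  have "(1 - \<theta>') * norm D < (1 - \<theta>) * norm D" using D0 \<theta> by (intro mult_strict_right_mono) auto
  also have "\<dots> \<le> D \<bullet> w" using cone by (simp add: closed_cone_def)
  finally have Dw: "0 < D \<bullet> w - (1 - \<theta>') * norm D" by simp
  have "((\<lambda>s. ?q s \<bullet> w - (1 - \<theta>') * norm (?q s)) \<longlongrightarrow> D \<bullet> w - (1 - \<theta>') * norm D) (at t)"
    by (intro tendsto_intros lim)
  then have "\<forall>\<^sub>F s in at t. 0 < ?q s \<bullet> w - (1 - \<theta>') * norm (?q s)"
    using Dw order_tendstoD(1) by blast
  moreover have "\<forall>\<^sub>F s in at t. norm D / 2 < norm (?q s)"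
    by (rule order_tendstoD(1)[OF tendsto_norm[OF lim]]) (use D0 in simp)
  ultimately have "\<forall>\<^sub>F s in at t. norm D / 2 < norm (?q s) \<and> ?q s \<in> closed_cone w \<theta>'"
    by eventually_elim (simp add: closed_cone_def)
  then obtain r where r: "r > 0" "\<And>s. s \<noteq> t \<Longrightarrow> \<bar>s - t\<bar> < r \<Longrightarrow>
      norm D / 2 < norm (?q s) \<and> ?q s \<in> closed_cone w \<theta>'"
    unfolding eventually_at by (auto simp: dist_real_def)
  \<comment> \<open>\<open>L\<close> is for the bi-Lipschitz bounds, \<open>1 / r\<close> for the
    neighbourhood, and \<open>2 / norm D\<close> for the lower bound on the slopes.\<close>
  obtain m :: nat where m: "real m > max L (max (1 / r) (2 / norm D))" using reals_Archimedean2 by blast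
  then have m': "L \<le> real m + 1" "1 / r \<le> real m + 1" "2 / norm D \<le> real m + 1" by auto
  have mr: "1 / (real m + 1) \<le> r" "1 / (real m + 1) \<le> norm D / 2"
    using m'(2,3) r(1) D0 by (simp_all add: field_simps)
  show ?thesis
  proof (rule that[of m])
    fix s assume s: "s \<in> curve_dom \<gamma>" "\<bar>s - t\<bar> < 1 / (real m + 1)"
    show "((t, curve_fun \<gamma> t), (s, curve_fun \<gamma> s)) \<in> secant_rel \<phi> w \<theta>' (real m + 1)"
    proof (cases "s = t")
      case True
      then show ?thesis by (simp add: secant_rel_refl)
    next
      case False
      have q: "norm D / 2 < norm (?q s)" "?q s \<in> closed_cone w \<theta>'" using r(2)[OF False] s(2) mr(1) by auto
      have gs: "g s = \<phi> (curve_fun \<gamma> s)" "g t = \<phi> (curve_fun \<gamma> t)"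
        using g s(1) t by (auto simp: lipschitz_extension_def)
      have "dist t s \<le> L * dist (curve_fun \<gamma> t) (curve_fun \<gamma> s)" using L(3) s t by blast
      also have "\<dots> \<le> (real m + 1) * dist (curve_fun \<gamma> t) (curve_fun \<gamma> s)"
        using m'(1) by (intro mult_right_mono) auto
      finally have 1: "dist t s / (real m + 1) \<le> dist (curve_fun \<gamma> t) (curve_fun \<gamma> s)"
        by (simp add: pos_divide_le_eq mult.commute)
      have "dist (curve_fun \<gamma> t) (curve_fun \<gamma> s) \<le> L * dist t s"
        using lipschitz_onD[OF L(2) t s(1)] .
      also have "\<dots> \<le> (real m + 1) * dist t s" using m'(1) by (intro mult_right_mono) auto
      finally have 2: "dist (curve_fun \<gamma> t) (curve_fun \<gamma> s) \<le> (real m + 1) * dist t s" .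
      show ?thesis
        using 1 2 q mr(2) unfolding gs by (subst secant_rel_iff_slope[OF False]) auto
    qed
  qed
qed

text \<open>A closed relation passes from \<open>T\<close> to its closure. This produces a compact
  domain from a set of times about which only the secant bounds are known.\<close>

lemma subcurve_on_closure:
  fixes \<gamma> :: "'a::metric_space curve"
  assumes R: "closed R" and T: "T \<subseteq> curve_dom \<gamma>" "T \<noteq> {}"
    and rel: "\<And>s t. s \<in> T \<Longrightarrow> t \<in> T \<Longrightarrow> ((s, curve_fun \<gamma> s), (t, curve_fun \<gamma> t)) \<in> R"
  obtains \<eta> where "curve_dom \<eta> = closure T" "closure T \<subseteq> curve_dom \<gamma>"
    "\<And>t. t \<in> closure T \<Longrightarrow> curve_fun \<eta> t = curve_fun \<gamma> t" "curve_graph \<eta> \<times> curve_graph \<eta> \<subseteq> R"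
proof -
  have cl: "closed (curve_dom \<gamma>)" by (intro compact_imp_closed curve_props)
  have sub: "closure T \<subseteq> curve_dom \<gamma>" using T(1) cl by (rule closure_minimal)
  have "compact (closure T)" using sub curve_props(1)[of \<gamma>]
    by (metis closed_closure compact_Int_closed inf.absorb2)
  then obtain \<eta> where \<eta>: "curve_dom \<eta> = (*) 1 ` closure T"
      "\<And>t. t \<in> closure T \<Longrightarrow> curve_fun \<eta> (1 * t) = curve_fun \<gamma> t"
    using subcurve_exists[of "closure T" \<gamma> 1] sub T(2) by (metis closure_eq_empty)
  have dom: "curve_dom \<eta> = closure T" using \<eta>(1) by simp
  have "\<And>p. p \<in> closure (T \<times> T) \<Longrightarrow> ((fst p, curve_fun \<gamma> (fst p)), (snd p, curve_fun \<gamma> (snd p))) \<in> R"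
  proof -
    let ?h = "\<lambda>p. ((fst p, curve_fun \<gamma> (fst p)), (snd p, curve_fun \<gamma> (snd p)))"
    have "continuous_on (closure T \<times> closure T) ?h"
      by (intro continuous_intros continuous_on_compose2[OF curve_continuous_on]) (use sub in auto)
    then have "closed ((closure T \<times> closure T) \<inter> ?h -` R)"
      by (intro continuous_closed_preimage closed_Times R) auto
    moreover have "T \<times> T \<subseteq> (closure T \<times> closure T) \<inter> ?h -` R"
      using rel closure_subset by fastforce
    ultimately have "closure (T \<times> T) \<subseteq> (closure T \<times> closure T) \<inter> ?h -` R" by (intro closure_minimal)
    then show "?h p \<in> R" if "p \<in> closure (T \<times> T)" for p using that by blast
  qed
  then have "((s, curve_fun \<gamma> s), (t, curve_fun \<gamma> t)) \<in> R" if "s \<in> closure T" "t \<in> closure T" for s t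
    using that by (force simp: closure_Times)
  then have "curve_graph \<eta> \<times> curve_graph \<eta> \<subseteq> R"
    unfolding curve_graph_def dom using \<eta>(2) by auto
  then show ?thesis using that[of \<eta>] dom sub \<eta>(2) by simp
qed

text \<open>After exhaustion no subset of \<open>S\<close> of positive measure is represented, so
  the dichotomy supplies one null set for each compact family \<open>G n\<close>. For any curve,
  almost all times with derivative in the narrow cone are covered by subcurves from these
  families.\<close>

lemma cone_decomposition:
  fixes \<mu> :: "'a::polish_space measure" and \<phi> :: "'a \<Rightarrow> real ^ 'n"
  assumes \<mu>: "finite_measure \<mu>" "sets \<mu> = sets borel" and U: "compact U"
    and lip: "M-lipschitz_on UNIV \<phi>" and \<theta>: "\<theta> < \<theta>'"
  obtains A :: "nat \<Rightarrow> 'a set" and N where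
    "\<And>k. A k \<in> sets borel" "\<And>k. A k \<subseteq> U"
    "\<And>k. represented_in_direction \<mu> (A k) \<phi> (closed_cone w \<theta>')" "N \<in> null_sets \<mu>"
    "\<And>\<gamma>. AE t in lborel. t \<in> curve_dom \<gamma> \<longrightarrow> curve_fun \<gamma> t \<in> U - (\<Union>k. A k) - N \<longrightarrow>
        curve_deriv \<phi> \<gamma> t \<notin> closed_cone w \<theta> - {0}"
proof -
  define \<A> where "\<A> = {A \<in> sets borel. A \<subseteq> U \<and> represented_in_direction \<mu> A \<phi> (closed_cone w \<theta>')}"
  have \<A>: "\<A> \<subseteq> sets \<mu>" "\<A> \<noteq> {}"
    using represented_in_direction_null[OF null_sets.empty_sets \<mu>(2)] \<mu>(2) by (auto simp: \<A>_def)
  obtain A :: "nat \<Rightarrow> 'a set" where A: "\<And>k. A k \<in> \<A>" "\<And>B. B \<in> \<A> \<Longrightarrow> emeasure \<mu> (B - (\<Union>k. A k)) = 0"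
    using exhaustion_by_sequence[OF \<mu>(1) \<A>] by metis
  define S where "S = U - (\<Union>k. A k)"
  have Ub: "U \<in> sets borel" using U by (intro borel_closed compact_imp_closed)
  have S: "S \<in> sets borel" using A(1) Ub unfolding S_def by (intro sets.Diff sets.countable_UN) (auto simp: \<A>_def)
  have cont: "continuous_on UNIV \<phi>" using lip by (rule lipschitz_on_continuous_on)
  define R where "R n = secant_rel \<phi> w \<theta>' (real n + 1)" for n :: nat
  define G where "G n = {\<gamma>. curve_graph \<gamma> \<subseteq> {- real n..real n} \<times> U \<and> curve_graph \<gamma> \<times> curve_graph \<gamma> \<subseteq> R n}" for n
  have Rcl: "closed (R n)" for n unfolding R_def by (rule closed_secant_rel[OF cont]) simp
  have "\<exists>N\<in>null_sets \<mu>. N \<subseteq> S \<and> (\<forall>\<gamma>\<in>G n. emeasure (curve_measure \<gamma>) (S - N) = 0)" for n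
  proof (rule curve_family_dichotomy[OF \<mu> S _ Rcl _ _ G_def])
    show "compact ({- real n..real n} \<times> U)" using U by (intro compact_Times compact_Icc)
    show "0 < real n + 1" by simp
    show "dist s t / (real n + 1) \<le> dist x y \<and> dist x y \<le> (real n + 1) * dist s t"
      if "((s, x), (t, y)) \<in> R n" for s x t y
      using that by (simp add: R_def secant_rel_def)
    fix B P f
    assume B: "B \<in> sets borel" "B \<subseteq> S" and P: "prob_space P" "sets P = sets borel" "AE \<gamma> in P. \<gamma> \<in> G n"
      and f: "f \<in> borel_measurable borel"
      and rep: "\<And>Y. Y \<in> sets borel \<Longrightarrow> Y \<subseteq> B \<Longrightarrow>
          emeasure \<mu> Y = (\<integral>\<^sup>+\<gamma>. emeasure (density (curve_measure \<gamma>) f) Y \<partial>P)"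
    have relP: "AE \<gamma> in P. curve_graph \<gamma> \<times> curve_graph \<gamma> \<subseteq> secant_rel \<phi> w \<theta>' (real n + 1)"
      using P(3) by eventually_elim (auto simp: G_def R_def)
    have "represented_in_direction \<mu> B \<phi> (closed_cone w \<theta>')"
    proof (rule secant_family_represents[OF lip _ P(1,2) relP f])
      show "emeasure \<mu> Y = (\<integral>\<^sup>+\<gamma>. emeasure (density (curve_measure \<gamma>) f) Y \<partial>P)"
        if "Y \<in> sets borel" "Y \<subseteq> B" for Y by (rule rep[OF that])
    qed simp_all
    then have "B \<in> \<A>" using B by (auto simp: \<A>_def S_def)
    moreover have "B - (\<Union>k. A k) = B" using B by (auto simp: S_def)
    ultimately show "emeasure \<mu> B = 0" using A(2)[of B] by simp
  qed
  then obtain NN where NN: "\<And>n. NN n \<in> null_sets \<mu>"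
      "\<And>n \<gamma>. \<gamma> \<in> G n \<Longrightarrow> emeasure (curve_measure \<gamma>) (S - NN n) = 0" by metis
  define N where "N = (\<Union>n::nat. NN n)"
  have N: "N \<in> null_sets \<mu>" unfolding N_def by (intro null_sets_UN NN)
  have NNb: "NN n \<in> sets borel" for n using NN(1)[of n] \<mu>(2) by auto
  have "AE t in lborel. t \<in> curve_dom \<gamma> \<longrightarrow> curve_fun \<gamma> t \<in> S - N \<longrightarrow>
      curve_deriv \<phi> \<gamma> t \<notin> closed_cone w \<theta> - {0}" for \<gamma>
  proof -
    obtain g where g: "lipschitz_extension g \<phi> \<gamma>" using lipschitz_extension_exists[OF lip] by blast
    \<comment> \<open>\<open>m\<close> is the scale at which the secant bounds hold near
      \<open>t\<close>. Times in one cell \<open>j\<close> of length \<open>1 / (m + 1)\<close> are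
      within that scale of each other, so the local bounds become bounds for all pairs.\<close>
    define T where "T m j = {t \<in> curve_dom \<gamma>. curve_fun \<gamma> t \<in> U \<and> \<lfloor>(real m + 1) * t\<rfloor> = j \<and>
      (\<forall>s\<in>curve_dom \<gamma>. \<bar>s - t\<bar> < 1 / (real m + 1) \<longrightarrow>
        ((t, curve_fun \<gamma> t), (s, curve_fun \<gamma> s)) \<in> R m)}" for m :: nat and j :: int
    have null: "{t \<in> closure (T m j). curve_fun \<gamma> t \<in> S - N} \<subseteq> curve_dom \<gamma> \<and>
       (\<exists>E\<in>null_sets lborel. {t \<in> closure (T m j). curve_fun \<gamma> t \<in> S - N} \<subseteq> E)" for m j
    proof (cases "T m j = {}")
      case True
      then show ?thesis by auto
    next
      case False
      have TT: "((t, curve_fun \<gamma> t), (s, curve_fun \<gamma> s)) \<in> R m" if st: "t \<in> T m j" "s \<in> T m j" for s t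
      proof -
        have "\<lfloor>(real m + 1) * t\<rfloor> = \<lfloor>(real m + 1) * s\<rfloor>" using st by (simp add: T_def)
        then have "\<bar>(real m + 1) * s - (real m + 1) * t\<bar> < 1" by linarith
        then have "(real m + 1) * \<bar>s - t\<bar> < 1"
          by (metis abs_mult abs_of_nonneg add_nonneg_nonneg of_nat_0_le_iff right_diff_distrib zero_le_one)
        then have "\<bar>s - t\<bar> < 1 / (real m + 1)" by (simp add: pos_less_divide_eq mult.commute)
        then show ?thesis using st by (simp add: T_def)
      qed
      have Tdom: "T m j \<subseteq> curve_dom \<gamma>" by (auto simp: T_def)
      obtain \<eta> where \<eta>: "curve_dom \<eta> = closure (T m j)" "closure (T m j) \<subseteq> curve_dom \<gamma>"
          "\<And>t. t \<in> closure (T m j) \<Longrightarrow> curve_fun \<eta> t = curve_fun \<gamma> t"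
          "curve_graph \<eta> \<times> curve_graph \<eta> \<subseteq> R m"
        using subcurve_on_closure[OF Rcl Tdom False TT] by metis
      have imU: "curve_fun \<eta> t \<in> U" if t: "t \<in> curve_dom \<eta>" for t
      proof -
        have "curve_fun \<eta> ` closure (T m j) \<subseteq> closure (curve_fun \<eta> ` T m j)"
          using curve_continuous_on[of \<eta>] \<eta>(1) by (intro image_closure_subset[OF _ closed_closure closure_subset]) auto
        also have "\<dots> \<subseteq> U"
          using \<eta>(3) closure_subset[of "T m j"]
          by (intro closure_minimal compact_imp_closed[OF U]) (auto simp: T_def subset_iff)
        finally show ?thesis using t \<eta>(1) by blast
      qed
      obtain b :: nat where b: "\<And>t. t \<in> curve_dom \<gamma> \<Longrightarrow> \<bar>t\<bar> \<le> real b"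
      proof -
        obtain c where c: "\<And>t. t \<in> curve_dom \<gamma> \<Longrightarrow> norm t \<le> c"
          using compact_imp_bounded[OF curve_props(1)[of \<gamma>]] unfolding bounded_iff by blast
        obtain b :: nat where "c \<le> real b" using real_arch_simple by blast
        then show ?thesis using c by (intro that[of b]) (force intro: order_trans)
      qed
      \<comment> \<open>Increasing the index weakens the secant bounds and widens the time window,
        so one \<open>n\<close> accommodates both requirements.\<close>
      define n where "n = max b m"
      have "R m \<subseteq> R n" unfolding R_def n_def by (intro secant_rel_mono) auto
      moreover have "curve_graph \<eta> \<subseteq> {- real n..real n} \<times> U"
        using imU b \<eta>(1,2) by (force simp: curve_graph_def n_def abs_le_iff)
      ultimately have "\<eta> \<in> G n" using \<eta>(4) by (auto simp: G_def)
      then have "emeasure (curve_measure \<eta>) (S - NN n) = 0" by (rule NN(2))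
      then have "{t \<in> curve_dom \<eta>. curve_fun \<eta> t \<in> S - NN n} \<in> null_sets lborel"
        using S NNb[of n] emeasure_curve_measure[of "S - NN n" \<eta>] borel_curve_vimage[of "S - NN n" \<eta>]
        by (simp add: null_sets_def)
      moreover have "{t \<in> closure (T m j). curve_fun \<gamma> t \<in> S - N} \<subseteq> {t \<in> curve_dom \<eta>. curve_fun \<eta> t \<in> S - NN n}"
        using \<eta> by (auto simp: N_def)
      ultimately show ?thesis using \<eta>(2) by blast
    qed
    have "AE t in lborel. t \<notin> {t \<in> closure (T m j). curve_fun \<gamma> t \<in> S - N}" for m j
    proof -
      obtain E where E: "E \<in> null_sets lborel" "{t \<in> closure (T m j). curve_fun \<gamma> t \<in> S - N} \<subseteq> E"
        using null[of m j] by blast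
      show ?thesis using AE_not_in[OF E(1)] by eventually_elim (use E(2) in blast)
    qed
    then have "AE t in lborel. \<forall>m j. t \<notin> {t \<in> closure (T m j). curve_fun \<gamma> t \<in> S - N}"
      by (subst AE_all_countable, subst AE_all_countable) blast
    with curve_deriv_AE[OF g] show ?thesis
    proof eventually_elim
      case (elim t)
      show ?case
      proof (intro impI notI)
        assume t: "t \<in> curve_dom \<gamma>" "curve_fun \<gamma> t \<in> S - N" "curve_deriv \<phi> \<gamma> t \<in> closed_cone w \<theta> - {0}"
        obtain m :: nat where m: "\<And>s. s \<in> curve_dom \<gamma> \<Longrightarrow> \<bar>s - t\<bar> < 1 / (real m + 1) \<Longrightarrow>
            ((t, curve_fun \<gamma> t), (s, curve_fun \<gamma> s)) \<in> secant_rel \<phi> w \<theta>' (real m + 1)"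
          using locally_secant_of_derivative[OF g _ t(3) \<theta> t(1)] elim t(1) by metis
        then have "t \<in> T m \<lfloor>(real m + 1) * t\<rfloor>" using t by (auto simp: T_def R_def S_def)
        then have "t \<in> closure (T m \<lfloor>(real m + 1) * t\<rfloor>)" using closure_subset by blast
        then show False using elim t(2) by blast
      qed
    qed
  qed
  then show ?thesis
    using that[of A N] A(1) N unfolding S_def \<A>_def by blast
qed

subsection \<open>Independent representations annihilate the sets of the class\<close>

text \<open>Inner regularity of Lebesgue measure. It bridges the gap between curves, which have
  compact domains, and sets of times that are only Borel.\<close>

lemma negligible_if_compact_subsets_negligible:
  fixes S :: "real set"
  assumes S: "S \<in> sets borel" and "bounded S"
    and null: "\<And>K. compact K \<Longrightarrow> K \<subseteq> S \<Longrightarrow> negligible K"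
  shows "negligible S"
  unfolding negligible_outer_le
proof (intro allI impI)
  fix e :: real assume e: "e > 0"
  have "S \<in> sets lebesgue" using S by simp
  then obtain T where T: "closed T" "T \<subseteq> S" "S - T \<in> lmeasurable" "emeasure lebesgue (S - T) < ennreal e"
    using sets_lebesgue_inner_closed[OF _ e] by metis
  have "compact T" using T(1,2) \<open>bounded S\<close> by (metis bounded_subset compact_eq_bounded_closed)
  then have nT: "negligible T" using null T(2) by blast
  have "measure lebesgue (S - T) \<le> e"
    using T(4) e by (simp add: measure_def enn2real_leI less_imp_le)
  moreover have "S = (S - T) \<union> T" using T(2) by blast
  moreover have "measure lebesgue ((S - T) \<union> T) = measure lebesgue (S - T)"
    using nT T(3) by (intro measure_Un_null_set) (auto simp: negligible_iff_null_sets fmeasurableD)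
  ultimately show "\<exists>T'. S \<subseteq> T' \<and> T' \<in> lmeasurable \<and> measure lebesgue T' \<le> e"
    using T(3) nT by (intro exI[of _ S]) (metis fmeasurable.Un negligible_imp_measurable order_refl)
qed

lemma Lip_on_le:
  assumes "L-lipschitz_on D f" "x \<in> D"
  shows "Lip_on D f x \<le> ennreal L"
  unfolding Lip_on_def
proof (rule Limsup_bounded)
  have "dist (f x) (f y) / dist x y \<le> L" if "y \<in> D" "y \<noteq> x" for y
    using lipschitz_onD[OF assms(1) assms(2) that(1)] that(2) by (simp add: pos_divide_le_eq)
  then show "\<forall>\<^sub>F y in at x within D. ennreal (dist (f x) (f y) / dist x y) \<le> ennreal L"
    by (auto simp: eventually_at_filter intro!: always_eventually ennreal_leI)
qed

lemma AE_lebesgue_on_iff: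
  fixes K :: "real set"
  assumes "K \<in> sets borel"
  shows "(AE t in lebesgue_on K. P t) \<longleftrightarrow> (AE t in lborel. t \<in> K \<longrightarrow> P t)"
  using assms by (subst AE_restrict_space_iff) (auto simp: AE_completion_iff)

text \<open>A unit vector orthogonal to one nonzero vector from each cone would be orthogonal to a
  basis. By compactness the sum of the numbers \<open>\<bar>v i \<bullet> u\<bar>\<close> over unit
  vectors has a positive lower bound, so for every \<open>u\<close> some cone stays uniformly away
  from its orthogonal hyperplane.\<close>

lemma independent_cones_detect_direction:
  fixes C :: "nat \<Rightarrow> (real ^ 'n) set"
  assumes ind: "independent_cones CARD('n) C"
  obtains \<theta> where "0 < \<theta>" "\<theta> < 1"
    "\<And>w. norm w = 1 \<Longrightarrow> \<exists>j<CARD('n). \<forall>v\<in>C j. \<theta> * norm v \<le> \<bar>v \<bullet> w\<bar>"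
proof -
  obtain b :: "'n \<Rightarrow> nat" where b: "bij_betw b UNIV {..<CARD('n)}"
    using ex_bij_betw_finite_nat[of "UNIV :: 'n set"] by (auto simp: atLeast0LessThan)
  have bi: "b i < CARD('n)" for i using b by (auto simp: bij_betw_def)
  obtain \<theta>c w where cone: "\<And>j. j < CARD('n) \<Longrightarrow> C j = closed_cone (w j) (\<theta>c j)"
    using ind unfolding independent_cones_def is_closed_cone_of_width_def by metis
  define S where "S = {p :: ((real ^ 'n) ^ 'n) \<times> (real ^ 'n).
     norm (snd p) = 1 \<and> (\<forall>i. norm (fst p $ i) = 1 \<and> fst p $ i \<in> C (b i))}"
  have "closed S"
    unfolding S_def cone[OF bi] closed_cone_def mem_Collect_eq
    by (intro closed_Collect_conj closed_Collect_all closed_Collect_le closed_Collect_eq continuous_intros)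
  moreover have "bounded S"
  proof (rule boundedI)
    fix p assume p: "p \<in> S"
    have "norm p \<le> norm (fst p) + norm (snd p)" by (metis norm_Pair_le prod.collapse)
    moreover have "norm (fst p) \<le> (\<Sum>i\<in>UNIV. norm (fst p $ i))"
      unfolding norm_vec_def by (rule L2_set_le_sum) simp
    ultimately show "norm p \<le> real CARD('n) + 1" using p by (simp add: S_def)
  qed
  ultimately have "compact S" using compact_eq_bounded_closed by blast
  define f where "f p = (\<Sum>i\<in>UNIV. \<bar>(fst p $ i) \<bullet> snd p\<bar>)" for p :: "((real ^ 'n) ^ 'n) \<times> (real ^ 'n)"
  have fpos: "f p > 0" if p: "p \<in> S" for p
  proof (rule ccontr)
    assume "\<not> f p > 0"
    moreover have "f p \<ge> 0" unfolding f_def by (intro sum_nonneg) auto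
    ultimately have "f p = 0" by simp
    then have 0: "(fst p $ i) \<bullet> snd p = 0" for i
      unfolding f_def by (subst (asm) sum_nonneg_eq_0_iff) auto
    define v where "v j = fst p $ inv b j" for j
    have vb: "v (b i) = fst p $ i" for i
      using bij_betw_imp_inj_on[OF b] by (simp add: v_def)
    have "\<forall>j<CARD('n). v j \<in> C j - {0}"
    proof (intro allI impI)
      fix j assume "j < CARD('n)"
      then obtain i where "j = b i" using b by (auto simp: bij_betw_def)
      moreover have "norm (fst p $ i) = 1" "fst p $ i \<in> C (b i)" using p by (auto simp: S_def)
      ultimately show "v j \<in> C j - {0}" by (metis DiffI norm_zero singletonD vb zero_neq_one)
    qed
    then have v: "inj_on v {..<CARD('n)}" "independent (v ` {..<CARD('n)})"
      using ind unfolding independent_cones_def by blast+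
    have "(UNIV :: (real ^ 'n) set) \<subseteq> span (v ` {..<CARD('n)})"
      using v by (intro card_ge_dim_independent) (auto simp: card_image)
    then have "snd p \<in> span (v ` {..<CARD('n)})" by blast
    then have "orthogonal (snd p) (snd p)"
    proof (rule orthogonal_to_span)
      fix y assume "y \<in> v ` {..<CARD('n)}"
      then obtain i where "y = fst p $ i" by (auto simp: v_def)
      then show "orthogonal (snd p) y" using 0[of i] by (simp add: orthogonal_def inner_commute)
    qed
    then show False using p by (auto simp: S_def orthogonal_def)
  qed
  have contf: "continuous_on S f" unfolding f_def by (intro continuous_intros)
  obtain m where m: "m > 0" "\<And>p. p \<in> S \<Longrightarrow> m \<le> f p"
  proof (cases "S = {}")
    case True then show ?thesis using that[of 1] by simp
  next
    case False
    then obtain p where "p \<in> S" "\<And>q. q \<in> S \<Longrightarrow> f p \<le> f q"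
      using continuous_attains_inf[OF \<open>compact S\<close> _ contf] by blast
    then show ?thesis using that[of "f p"] fpos by blast
  qed
  \<comment> \<open>If every term were below \<open>\<theta>\<close>, the sum would be at most
    \<open>CARD('n) * \<theta> < m\<close>. The bound \<open>1/2\<close> keeps
    \<open>\<theta>\<close> below 1.\<close>
  define \<theta> where "\<theta> = min (m / (2 * CARD('n))) (1/2)"
  have \<theta>: "0 < \<theta>" "\<theta> < 1" "CARD('n) * \<theta> < m"
    using m(1) by (auto simp: \<theta>_def min_def field_simps)
  show ?thesis
  proof (rule that[OF \<theta>(1,2)], rule ccontr)
    fix u :: "real ^ 'n" assume u: "norm u = 1"
    assume "\<not> (\<exists>j<CARD('n). \<forall>v\<in>C j. \<theta> * norm v \<le> \<bar>v \<bullet> u\<bar>)"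
    then have "\<forall>j. \<exists>v. j < CARD('n) \<longrightarrow> v \<in> C j \<and> \<bar>v \<bullet> u\<bar> < \<theta> * norm v" by (meson not_le)
    then obtain v where v: "\<And>j. j < CARD('n) \<Longrightarrow> v j \<in> C j" "\<And>j. j < CARD('n) \<Longrightarrow> \<bar>v j \<bullet> u\<bar> < \<theta> * norm (v j)"
      by metis
    define V where "V = (\<chi> i. v (b i) /\<^sub>R norm (v (b i)))"
    have nz: "norm (v (b i)) > 0" for i using v(2)[OF bi[of i]] by auto
    have "(V, u) \<in> S"
    proof -
      have "norm (V $ i) = 1" for i using nz[of i] by (simp add: V_def)
      moreover have "V $ i \<in> C (b i)" for i
        using v(1)[OF bi[of i]] nz[of i] unfolding cone[OF bi] closed_cone_def
        by (simp add: V_def field_simps)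
      ultimately show ?thesis using u by (simp add: S_def)
    qed
    then have "m \<le> f (V, u)" by (rule m(2))
    also have "\<dots> \<le> (\<Sum>i\<in>(UNIV::'n set). \<theta>)"
      unfolding f_def
    proof (rule sum_mono)
      fix i
      have "\<bar>v (b i) \<bullet> u\<bar> / norm (v (b i)) \<le> \<theta>"
        using v(2)[OF bi[of i]] nz[of i] by (simp add: pos_divide_le_eq less_imp_le)
      then show "\<bar>fst (V, u) $ i \<bullet> snd (V, u)\<bar> \<le> \<theta>"
        by (simp add: V_def abs_mult divide_inverse mult.commute)
    qed
    finally show False using \<theta>(3) by simp
  qed
qed

text \<open>A compact set of such times, with orientation \<open>\<sigma>\<close>, is the domain of
  a curve to which \<open>null\<close> applies. Its speed is checked by bounding both pointwise
  constants by the global ones, \<open>M\<close> for \<open>\<phi>\<close> and \<open>L\<close> for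
  the curve.\<close>

lemma direction_set_negligible:
  fixes \<phi> :: "'a::polish_space \<Rightarrow> real ^ 'n"
  assumes lip: "M-lipschitz_on UNIV \<phi>" and L: "L-lipschitz_on (curve_dom \<gamma>) (curve_fun \<gamma>)"
    and \<sigma>: "\<sigma> = 1 \<or> \<sigma> = (- 1 :: real)"
    and null: "\<And>\<eta>. in_direction (lebesgue_on (curve_dom \<eta>)) \<phi> (closed_cone w (1 - \<theta>)) \<eta> \<Longrightarrow>
       has_speed (lebesgue_on (curve_dom \<eta>)) \<phi> \<delta> \<eta> \<Longrightarrow> hausdorff1 (curve_image \<eta> \<inter> B) = 0"
    and T: "T \<in> sets borel" "T \<subseteq> curve_dom \<gamma>" "\<And>t. t \<in> T \<Longrightarrow> curve_fun \<gamma> t \<in> B"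
    and dir: "\<And>t. t \<in> T \<Longrightarrow> \<theta> * norm (curve_deriv \<phi> \<gamma> t) \<le> \<sigma> * (curve_deriv \<phi> \<gamma> t \<bullet> w)"
    and speed: "\<And>t. t \<in> T \<Longrightarrow> \<delta> * M * L \<le> norm (curve_deriv \<phi> \<gamma> t)"
    and nz: "\<And>t. t \<in> T \<Longrightarrow> curve_deriv \<phi> \<gamma> t \<noteq> 0" and "\<delta> > 0"
  shows "negligible T"
proof (rule negligible_if_compact_subsets_negligible[OF T(1)])
  show "bounded T" using T(2) curve_props(1)[of \<gamma>] by (meson bounded_subset compact_imp_bounded)
  fix K assume K: "compact K" "K \<subseteq> T"
  show "negligible K"
  proof (cases "K = {}")
    case False
    have Kd: "K \<subseteq> curve_dom \<gamma>" using K(2) T(2) by blast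
    obtain \<eta> where \<eta>: "curve_dom \<eta> = (*) \<sigma> ` K" "\<And>t. t \<in> K \<Longrightarrow> curve_fun \<eta> (\<sigma> * t) = curve_fun \<gamma> t"
      "curve_image \<eta> = curve_fun \<gamma> ` K"
      using subcurve_exists[OF K(1) False Kd \<sigma>] by metis
    have inv: "\<sigma> * (\<sigma> * t) = t" for t using \<sigma> by auto
    have inK: "\<sigma> * t \<in> K" if "t \<in> curve_dom \<eta>" for t
      using that unfolding \<eta>(1) by (metis imageE inv)
    have fun_eq: "curve_fun \<eta> t = curve_fun \<gamma> (\<sigma> * t)" if "t \<in> curve_dom \<eta>" for t
      using \<eta>(2)[OF inK[OF that]] inv by simp
    have L\<eta>: "L-lipschitz_on (curve_dom \<eta>) (curve_fun \<eta>)"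
    proof (rule lipschitz_onI[OF _ lipschitz_on_nonneg[OF L]])
      fix s t assume st: "s \<in> curve_dom \<eta>" "t \<in> curve_dom \<eta>"
      have "dist (curve_fun \<gamma> (\<sigma> * s)) (curve_fun \<gamma> (\<sigma> * t)) \<le> L * dist (\<sigma> * s) (\<sigma> * t)"
        using lipschitz_onD[OF L] inK[OF st(1)] inK[OF st(2)] Kd by blast
      moreover have "dist (\<sigma> * s) (\<sigma> * t) = dist s t" using \<sigma> by (auto simp: dist_real_def)
      ultimately show "dist (curve_fun \<eta> s) (curve_fun \<eta> t) \<le> L * dist s t" by (simp add: fun_eq st)
    qed
    have ae: "AE t in lborel. t \<in> curve_dom \<eta> \<longrightarrow> curve_deriv \<phi> \<eta> t = \<sigma> *\<^sub>R curve_deriv \<phi> \<gamma> (\<sigma> * t)"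
      by (rule subcurve_deriv_AE[OF lip \<sigma> Kd \<eta>(1,2)])
    have "in_direction (lebesgue_on (curve_dom \<eta>)) \<phi> (closed_cone w (1 - \<theta>)) \<eta>"
      unfolding in_direction_def AE_lebesgue_on_iff[OF borel_curve_dom] using ae
    proof eventually_elim
      case (elim t)
      show ?case
      proof
        assume t: "t \<in> curve_dom \<eta>"
        then have "\<sigma> * t \<in> T" using inK K(2) by blast
        then show "curve_deriv \<phi> \<eta> t \<in> closed_cone w (1 - \<theta>) - {0}"
          using elim t dir[of "\<sigma> * t"] nz[of "\<sigma> * t"] \<sigma> by (auto simp: closed_cone_def)
      qed
    qed
    moreover have "has_speed (lebesgue_on (curve_dom \<eta>)) \<phi> \<delta> \<eta>"
      unfolding has_speed_def AE_lebesgue_on_iff[OF borel_curve_dom] using ae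
    proof eventually_elim
      case (elim t)
      show ?case
      proof
        assume t: "t \<in> curve_dom \<eta>"
        then have tT: "\<sigma> * t \<in> T" using inK K(2) by blast
        have "ennreal \<delta> * Lip \<phi> (curve_fun \<eta> t) * Lip_on (curve_dom \<eta>) (curve_fun \<eta>) t
            \<le> ennreal \<delta> * ennreal M * ennreal L"
          using Lip_on_le[OF lip UNIV_I] Lip_on_le[OF L\<eta> t] by (intro mult_mono) auto
        also have "\<dots> = ennreal (\<delta> * M * L)"
          using \<open>\<delta> > 0\<close> lipschitz_on_nonneg[OF lip] lipschitz_on_nonneg[OF L] by (simp add: ennreal_mult)
        also have "\<dots> \<le> ennreal (norm (curve_deriv \<phi> \<eta> t))"
          using elim t speed[OF tT] \<sigma> by (intro ennreal_leI) auto
        finally show "ennreal \<delta> * Lip \<phi> (curve_fun \<eta> t) * Lip_on (curve_dom \<eta>) (curve_fun \<eta>) t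
            \<le> ennreal (norm (curve_deriv \<phi> \<eta> t))" .
      qed
    qed
    ultimately have "hausdorff1 (curve_image \<eta> \<inter> B) = 0" by (rule null)
    moreover have "curve_image \<eta> \<inter> B = curve_fun \<gamma> ` K" using \<eta>(3) T(3) K(2) by auto
    ultimately show ?thesis using curve_image_hausdorff1_null_imp_negligible[OF Kd] by simp
  qed simp
qed

text \<open>\<open>curve_deriv\<close> comes from an arbitrary choice and from
  \<open>vector_derivative\<close>, so measurability is obtained through a limit of difference
  quotients that agrees with it almost everywhere.\<close>

lemma curve_deriv_AE_eq_borel:
  fixes \<phi> :: "'a::metric_space \<Rightarrow> real ^ 'n"
  assumes lip: "M-lipschitz_on UNIV \<phi>"
  obtains D N where "D \<in> borel_measurable borel" "N \<in> null_sets lborel"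
    "\<And>t. t \<in> curve_dom \<gamma> \<Longrightarrow> t \<notin> N \<Longrightarrow> curve_deriv \<phi> \<gamma> t = D t"
proof -
  obtain g where g: "lipschitz_extension g \<phi> \<gamma>" using lipschitz_extension_exists[OF lip] by blast
  then obtain K where "K-lipschitz_on UNIV g" unfolding lipschitz_extension_def by blast
  then have gm[measurable]: "g \<in> borel_measurable borel"
    by (intro borel_measurable_continuous_onI lipschitz_on_continuous_on)
  define D where "D t = lim (\<lambda>n. (g (t + 1 / real (Suc n)) - g t) /\<^sub>R (1 / real (Suc n)))" for t
  have "D \<in> borel_measurable borel" unfolding D_def by measurable
  obtain N where N: "N \<in> null_sets lborel"
    "{t. \<not> (t \<in> curve_dom \<gamma> \<longrightarrow> (g has_vector_derivative curve_deriv \<phi> \<gamma> t) (at t))} \<subseteq> N"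
    using curve_deriv_AE[OF g] by (auto simp: eventually_ae_filter)
  have "curve_deriv \<phi> \<gamma> t = D t" if t: "t \<in> curve_dom \<gamma>" "t \<notin> N" for t
  proof -
    have "(g has_vector_derivative curve_deriv \<phi> \<gamma> t) (at t)" using N(2) t by blast
    from has_vector_derivative_slope[OF this]
    have sl: "((\<lambda>y. (g y - g t) /\<^sub>R (y - t)) \<longlongrightarrow> curve_deriv \<phi> \<gamma> t) (at t)" .
    have "(\<lambda>n. t + 1 / real (Suc n)) \<longlonglongrightarrow> t + 0"
      by (intro tendsto_add tendsto_const) (use LIMSEQ_inverse_real_of_nat in \<open>simp add: inverse_eq_divide\<close>)
    then have "filterlim (\<lambda>n. t + 1 / real (Suc n)) (at t) sequentially"
      by (auto simp: filterlim_at)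
    from filterlim_compose[OF sl this]
    have "(\<lambda>n. (g (t + 1 / real (Suc n)) - g t) /\<^sub>R (1 / real (Suc n))) \<longlonglongrightarrow> curve_deriv \<phi> \<gamma> t" by simp
    then show ?thesis unfolding D_def by (rule limI[symmetric])
  qed
  with \<open>D \<in> _\<close> N(1) show ?thesis by (rule that)
qed

text \<open>Along a fixed curve the derivative is nonzero at almost every time, so a small enough
  \<delta> makes the speed condition hold there. By \<open>cover\<close> such \<delta> are available
  at each point of \<open>T\<close>, and each of the countably many resulting pieces is null for the
  curve.\<close>

lemma representation_null:
  fixes \<phi> :: "'a::polish_space \<Rightarrow> real ^ 'n" and w :: "nat \<times> nat \<Rightarrow> real ^ 'n"
  assumes rep: "alberti_representation \<mu> V P M" and dir: "alberti_in_direction P M \<phi> C"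
    and lip: "K-lipschitz_on UNIV \<phi>" and T: "T \<in> sets borel" "T \<subseteq> V"
    and B: "\<And>q. q \<in> Q \<Longrightarrow> B q \<in> sets borel"
    and w: "\<And>q v. q \<in> Q \<Longrightarrow> v \<in> C \<Longrightarrow> \<theta> * norm v \<le> \<bar>v \<bullet> w q\<bar>" and \<delta>: "\<And>q. \<delta> q > 0"
    and null: "\<And>q \<eta>. q \<in> Q \<Longrightarrow> in_direction (lebesgue_on (curve_dom \<eta>)) \<phi> (closed_cone (w q) (1 - \<theta>)) \<eta> \<Longrightarrow>
       has_speed (lebesgue_on (curve_dom \<eta>)) \<phi> (\<delta> q) \<eta> \<Longrightarrow> hausdorff1 (curve_image \<eta> \<inter> B q) = 0"
    and cover: "\<And>x e. x \<in> T \<Longrightarrow> e > 0 \<Longrightarrow> \<exists>q\<in>Q. x \<in> B q \<and> \<delta> q < e"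
  shows "emeasure \<mu> T = 0"
proof -
  have M: "sets (M \<gamma>) = sets borel"
      "\<And>E. E \<in> sets borel \<Longrightarrow> hausdorff1 (curve_image \<gamma> \<inter> E) = 0 \<Longrightarrow> emeasure (M \<gamma>) E = 0" for \<gamma>
    using rep unfolding alberti_representation_def by blast+
  have "AE \<gamma> in P. emeasure (M \<gamma>) T = 0"
    using dir unfolding alberti_in_direction_def
  proof eventually_elim
    case (elim \<gamma>)
    have sp: "sets (pullback_measure \<gamma> (M \<gamma>)) = sets borel" by (simp add: pullback_measure_def)
    obtain N1 where N1: "N1 \<in> null_sets (pullback_measure \<gamma> (M \<gamma>))"
        "{t. curve_deriv \<phi> \<gamma> t \<notin> C - {0}} \<subseteq> N1"
      using elim unfolding in_direction_def eventually_ae_filter by (auto simp: pullback_measure_def)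
    have N1b: "N1 \<in> sets borel" using N1(1) sp by auto
    have n1: "curve_fun \<gamma> ` (N1 \<inter> curve_dom \<gamma>) \<in> null_sets (M \<gamma>)"
      using N1(1) N1b M(1) borel_curve_fun_image[OF N1b]
      by (auto simp: null_sets_def emeasure_pullback_measure[OF M(1) N1b])
    have imnull: "curve_fun \<gamma> ` (E \<inter> curve_dom \<gamma>) \<in> null_sets (M \<gamma>)"
      if E: "E \<in> sets borel" "negligible (E \<inter> curve_dom \<gamma>)" for E
    proof -
      have "hausdorff1 (curve_fun \<gamma> ` (E \<inter> curve_dom \<gamma>)) = 0"
        using E(2) by (intro curve_image_negligible_imp_hausdorff1_null) auto
      moreover have "curve_image \<gamma> \<inter> curve_fun \<gamma> ` (E \<inter> curve_dom \<gamma>) = curve_fun \<gamma> ` (E \<inter> curve_dom \<gamma>)"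
        by (auto simp: curve_image_def)
      ultimately show ?thesis
        using M(1) M(2)[OF borel_curve_fun_image[OF E(1)]] borel_curve_fun_image[OF E(1)]
        by (auto simp: null_sets_def)
    qed
    obtain D N2 where D: "D \<in> borel_measurable borel" "N2 \<in> null_sets lborel"
        "\<And>t. t \<in> curve_dom \<gamma> \<Longrightarrow> t \<notin> N2 \<Longrightarrow> curve_deriv \<phi> \<gamma> t = D t"
      using curve_deriv_AE_eq_borel[OF lip] by metis
    have N2: "N2 \<in> sets borel" "negligible (N2 \<inter> curve_dom \<gamma>)"
    proof -
      show "N2 \<in> sets borel" using D(2) by auto
      have "negligible N2" using D(2) by (simp add: negligible_iff_null_sets null_sets_completionI)
      then show "negligible (N2 \<inter> curve_dom \<gamma>)" by (rule negligible_subset) auto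
    qed
    obtain L where L: "L > 0" "L-lipschitz_on (curve_dom \<gamma>) (curve_fun \<gamma>)"
      by (rule curve_lipschitz[of \<gamma>])
    have K: "K \<ge> 0" using lip by (rule lipschitz_on_nonneg)
    \<comment> \<open>The sign resolves an absolute value: each time with
      \<open>\<theta> * norm (D t) \<le> \<bar>D t \<bullet> w q\<bar>\<close> falls under one of
      the two orientations.\<close>
    define H where "H q \<sigma> = {t \<in> curve_dom \<gamma>. curve_fun \<gamma> t \<in> B q} \<inter> (- N1 \<inter> - N2) \<inter>
       ({t. \<theta> * norm (D t) \<le> \<sigma> * (D t \<bullet> w q)} \<inter> {t. \<delta> q * K * L \<le> norm (D t)})" for q \<sigma>
    have Hb: "H q \<sigma> \<in> sets borel" if "q \<in> Q" for q \<sigma>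
    proof -
      have "{t \<in> curve_dom \<gamma>. curve_fun \<gamma> t \<in> B q} \<in> sets borel" by (rule borel_curve_vimage[OF B[OF that]])
      moreover have "{t \<in> space borel. \<theta> * norm (D t) \<le> \<sigma> * (D t \<bullet> w q)} \<in> sets borel"
        "{t \<in> space borel. \<delta> q * K * L \<le> norm (D t)} \<in> sets borel"
        using D(1) by measurable
      ultimately show ?thesis unfolding H_def using N1b N2(1) by auto
    qed
    have Hneg: "negligible (H q \<sigma> \<inter> curve_dom \<gamma>)" if q: "q \<in> Q" and \<sigma>: "\<sigma> = 1 \<or> \<sigma> = - 1" for q \<sigma>
    proof -
      have "negligible (H q \<sigma>)"
      proof (rule direction_set_negligible[OF lip L(2) \<sigma> null[OF q] Hb[OF q] _ _ _ _ _ \<delta>])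
        show "H q \<sigma> \<subseteq> curve_dom \<gamma>" by (auto simp: H_def)
        show "curve_fun \<gamma> t \<in> B q" if "t \<in> H q \<sigma>" for t using that by (auto simp: H_def)
        show "\<theta> * norm (curve_deriv \<phi> \<gamma> t) \<le> \<sigma> * (curve_deriv \<phi> \<gamma> t \<bullet> w q)"
          "\<delta> q * K * L \<le> norm (curve_deriv \<phi> \<gamma> t)" if "t \<in> H q \<sigma>" for t
          using that D(3)[of t] by (auto simp: H_def)
        show "curve_deriv \<phi> \<gamma> t \<noteq> 0" if "t \<in> H q \<sigma>" for t
          using that N1(2) by (auto simp: H_def)
      qed
      then show ?thesis by (rule negligible_subset) auto
    qed
    define Z where "Z q \<sigma> = (if q \<in> Q then curve_fun \<gamma> ` (H q \<sigma> \<inter> curve_dom \<gamma>) else {})" for q \<sigma>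
    have Z: "Z q \<sigma> \<in> null_sets (M \<gamma>)" if "\<sigma> = 1 \<or> \<sigma> = - 1" for q \<sigma>
      using imnull[OF Hb Hneg] that by (auto simp: Z_def)
    have imb: "curve_image \<gamma> \<in> sets borel" by (intro borel_closed compact_imp_closed compact_curve_image)
    have "- curve_image \<gamma> \<in> null_sets (M \<gamma>)"
    proof -
      have "hausdorff1 (curve_fun \<gamma> ` {}) = 0"
        by (rule curve_image_negligible_imp_hausdorff1_null) auto
      then show ?thesis using M(1) M(2)[of "- curve_image \<gamma>" \<gamma>] imb by (auto simp: null_sets_def)
    qed
    then have "- curve_image \<gamma> \<union> curve_fun \<gamma> ` (N1 \<inter> curve_dom \<gamma>) \<union> curve_fun \<gamma> ` (N2 \<inter> curve_dom \<gamma>)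
       \<union> (\<Union>q. Z q 1) \<union> (\<Union>q. Z q (- 1)) \<in> null_sets (M \<gamma>)"
      using n1 imnull[OF N2] Z by (intro null_sets.Un null_sets_UN') auto
    moreover have "T \<subseteq> - curve_image \<gamma> \<union> curve_fun \<gamma> ` (N1 \<inter> curve_dom \<gamma>) \<union> curve_fun \<gamma> ` (N2 \<inter> curve_dom \<gamma>)
       \<union> (\<Union>q. Z q 1) \<union> (\<Union>q. Z q (- 1))"
    proof
      fix x assume x: "x \<in> T"
      show "x \<in> - curve_image \<gamma> \<union> curve_fun \<gamma> ` (N1 \<inter> curve_dom \<gamma>) \<union> curve_fun \<gamma> ` (N2 \<inter> curve_dom \<gamma>)
       \<union> (\<Union>q. Z q 1) \<union> (\<Union>q. Z q (- 1))"
      proof (cases "x \<in> curve_image \<gamma>")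
        case True
        then obtain t where t: "t \<in> curve_dom \<gamma>" "x = curve_fun \<gamma> t" by (auto simp: curve_image_def)
        show ?thesis
        proof (cases "t \<in> N1 \<or> t \<in> N2")
          case True then show ?thesis using t by blast
        next
          case False
          then have d: "curve_deriv \<phi> \<gamma> t \<in> C" "curve_deriv \<phi> \<gamma> t \<noteq> 0" "curve_deriv \<phi> \<gamma> t = D t"
            using N1(2) D(3)[OF t(1)] by blast+
          \<comment> \<open>The summand 1 keeps the quotient meaningful when
            \<open>K = 0\<close>.\<close>
          obtain q where q: "q \<in> Q" "x \<in> B q" "\<delta> q < norm (D t) / (K * L + 1)"
            using cover[OF x, of "norm (D t) / (K * L + 1)"] d(2,3) K L(1) by (auto simp: add_nonneg_pos)
          have KL: "0 < K * L + 1" using K L(1) by (simp add: add_nonneg_pos)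
          have "\<delta> q * K * L \<le> \<delta> q * (K * L + 1)" using \<delta>[of q] by (simp add: algebra_simps)
          also have "\<dots> \<le> norm (D t)" using q(3) KL by (simp add: pos_less_divide_eq less_imp_le)
          finally have s: "\<delta> q * K * L \<le> norm (D t)" .
          have "\<theta> * norm (D t) \<le> \<bar>D t \<bullet> w q\<bar>" using w[OF q(1) d(1)] d(3) by simp
          then have "t \<in> H q 1 \<or> t \<in> H q (- 1)"
            using t q(2) False s by (auto simp: H_def abs_if split: if_splits)
          then have "x \<in> Z q 1 \<or> x \<in> Z q (- 1)" using t q(1) by (auto simp: Z_def)
          then show ?thesis by blast
        qed
      qed simp
    qed
    moreover have "T \<in> sets (M \<gamma>)" using T(1) M(1) by simp
    ultimately have "T \<in> null_sets (M \<gamma>)" by (meson null_sets_subset)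
    then show ?case by (rule null_setsD1)
  qed
  then have "(\<integral>\<^sup>+\<gamma>. emeasure (M \<gamma>) T \<partial>P) = (\<integral>\<^sup>+\<gamma>. 0 \<partial>P)" by (rule nn_integral_cong_AE)
  then show ?thesis using rep T unfolding alberti_representation_def by simp
qed

text \<open>The decompositions for different speeds are unrelated, so each piece chooses its own
  \<open>j\<close>. As there are finitely many representations, every point meets some
  \<open>j\<close> for infinitely many \<open>m\<close>, that is, for arbitrarily small speeds; the
  sets \<open>T j\<close> are these upper limits.\<close>

lemma independent_representations_imp_null:
  fixes \<mu> :: "'a::polish_space measure" and \<phi> :: "'a \<Rightarrow> real ^ 'n"
  assumes rep: "has_independent_alberti_representations \<mu> V \<phi> CARD('n)" and V: "V \<in> sets borel"
    and lip: "K-lipschitz_on UNIV \<phi>" and S: "S \<in> A_tilde \<phi>" and \<mu>: "sets \<mu> = sets borel"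
  shows "emeasure \<mu> (S \<inter> V) = 0"
proof -
  obtain P M C where ind: "independent_cones CARD('n) C"
    and PM: "\<And>j. j < CARD('n) \<Longrightarrow> alberti_representation \<mu> V (P j) (M j)"
      "\<And>j. j < CARD('n) \<Longrightarrow> alberti_in_direction (P j) (M j) \<phi> (C j)"
    using rep unfolding has_independent_alberti_representations_def by blast
  obtain \<theta> where \<theta>: "0 < \<theta>" "\<theta> < 1"
    and detect: "\<And>w. norm w = 1 \<Longrightarrow> \<exists>j<CARD('n). \<forall>v\<in>C j. \<theta> * norm v \<le> \<bar>v \<bullet> w\<bar>"
    using independent_cones_detect_direction[OF ind] by metis
  obtain l where l: "l > 0" "\<And>\<delta>. \<delta> > 0 \<Longrightarrow> S \<in> A_tilde_param \<phi> \<delta> \<theta> l"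
    using S \<theta> unfolding A_tilde_def by blast
  define \<delta> where "\<delta> m = 1 / (real m + 1)" for m :: nat
  have \<delta>0: "\<delta> m > 0" for m by (simp add: \<delta>_def)
  have "\<exists>B w. borel_decomposition S B \<and> (\<forall>k. norm (w k) = 1 \<and>
      (\<forall>\<gamma>. in_direction (lebesgue_on (curve_dom \<gamma>)) \<phi> (closed_cone (w k) (1 - \<theta>)) \<gamma> \<and>
         has_speed (lebesgue_on (curve_dom \<gamma>)) \<phi> (\<delta> m) \<gamma> \<longrightarrow> hausdorff1 (curve_image \<gamma> \<inter> B k) = 0))" for m
  proof -
    obtain B C' where B: "borel_decomposition S B"
      and C': "\<And>k. is_closed_cone_of_width (1 - \<theta>) (C' k)"
      and null: "\<And>k \<gamma>. in_direction (lebesgue_on (curve_dom \<gamma>)) \<phi> (C' k) \<gamma> \<and>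
         has_speed (lebesgue_on (curve_dom \<gamma>)) \<phi> (\<delta> m) \<gamma> \<Longrightarrow> hausdorff1 (curve_image \<gamma> \<inter> B k) = 0"
      using l(2)[OF \<delta>0[of m]] unfolding A_tilde_param_def by blast
    obtain w where "\<And>k. norm (w k) = 1 \<and> C' k = closed_cone (w k) (1 - \<theta>)"
      using C' unfolding is_closed_cone_of_width_def by metis
    then show ?thesis using B null by (intro exI[of _ B] exI[of _ w]) auto
  qed
  then obtain B w where B: "\<And>m. borel_decomposition S (B m)" and w: "\<And>m k. norm (w m k) = 1"
    and null: "\<And>m k \<gamma>. in_direction (lebesgue_on (curve_dom \<gamma>)) \<phi> (closed_cone (w m k) (1 - \<theta>)) \<gamma> \<Longrightarrow>
       has_speed (lebesgue_on (curve_dom \<gamma>)) \<phi> (\<delta> m) \<gamma> \<Longrightarrow> hausdorff1 (curve_image \<gamma> \<inter> B m k) = 0"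
    by metis
  have Bb: "B m k \<in> sets borel" for m k using B unfolding borel_decomposition_def by blast
  have BS: "(\<Union>k. B m k) = S" for m using B unfolding borel_decomposition_def by blast
  obtain J where J: "\<And>m k. J m k < CARD('n)" "\<And>m k v. v \<in> C (J m k) \<Longrightarrow> \<theta> * norm v \<le> \<bar>v \<bullet> w m k\<bar>"
    using detect[OF w] by metis
  define T where "T j = V \<inter> (\<Inter>m0. \<Union>m\<in>{m0..}. \<Union>k\<in>{k. J m k = j}. B m k)" for j
  have Tb: "T j \<in> sets borel" for j
    unfolding T_def using V Bb by (intro sets.Int sets.countable_INT' sets.countable_UN') auto
  have "T j \<in> null_sets \<mu>" if j: "j < CARD('n)" for j
  proof -
    have "emeasure \<mu> (T j) = 0"
    proof (rule representation_null[OF PM(1)[OF j] PM(2)[OF j] lip Tb,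
          where Q = "{q. J (fst q) (snd q) = j}" and B = "\<lambda>q. B (fst q) (snd q)"
            and w = "\<lambda>q. w (fst q) (snd q)" and \<delta> = "\<lambda>q. \<delta> (fst q)" and \<theta> = \<theta>])
      show "T j \<subseteq> V" by (auto simp: T_def)
      fix x and e :: real assume x: "x \<in> T j" and e: "e > 0"
      obtain m0 :: nat where m0: "1 / e < real m0" using reals_Archimedean2 by blast
      obtain m k where m: "m \<ge> m0" "J m k = j" "x \<in> B m k" using x unfolding T_def by blast
      have "1 / e < real m + 1" using m0 m(1) by linarith
      then have "\<delta> m < e" using e by (simp add: \<delta>_def field_simps)
      then show "\<exists>q\<in>{q. J (fst q) (snd q) = j}. x \<in> B (fst q) (snd q) \<and> \<delta> (fst q) < e"
        using m by (intro bexI[of _ "(m, k)"]) auto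
    qed (use Bb J(2) \<delta>0 null in auto)
    then show ?thesis using Tb \<mu> by (auto simp: null_sets_def)
  qed
  then have "(\<Union>j\<in>{..<CARD('n)}. T j) \<in> null_sets \<mu>" by (intro null_sets_UN') auto
  moreover have "S \<inter> V \<subseteq> (\<Union>j\<in>{..<CARD('n)}. T j)"
  proof
    fix x assume x: "x \<in> S \<inter> V"
    then have "\<forall>m. \<exists>k. x \<in> B m k" using BS by blast
    then obtain k where k: "\<And>m. x \<in> B m (k m)" by metis
    have fin: "finite ((\<lambda>m. J m (k m)) ` UNIV)" by (rule finite_subset[of _ "{..<CARD('n)}"]) (use J(1) in auto)
    obtain a where a: "\<not> finite {m. J m (k m) = J a (k a)}"
      using pigeonhole_infinite[OF infinite_UNIV_nat fin] by auto
    have "x \<in> T (J a (k a))"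
      unfolding T_def
    proof (intro IntI INT_I)
      fix m0
      obtain m where "m \<ge> m0" "J m (k m) = J a (k a)"
        using a unfolding infinite_nat_iff_unbounded_le by blast
      then show "x \<in> (\<Union>m\<in>{m0..}. \<Union>k\<in>{k'. J m k' = J a (k a)}. B m k)" using k by blast
    qed (use x in blast)
    then show "x \<in> (\<Union>j\<in>{..<CARD('n)}. T j)" using J(1) by blast
  qed
  moreover have "S \<inter> V \<in> sets \<mu>"
  proof -
    have "S \<in> sets borel" using BS[of 0] Bb by (metis sets.countable_UN rangeI image_subsetI)
    then show ?thesis using V \<mu> by auto
  qed
  ultimately have "S \<inter> V \<in> null_sets \<mu>" by (meson null_sets_subset)
  then show ?thesis by (rule null_setsD1)
qed

subsection \<open>Frames of cones\<close>

lemma span_range_UNIV_iff_det: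
  fixes V :: "'n::finite \<Rightarrow> real ^ 'n"
  shows "span (range V) = UNIV \<longleftrightarrow> det (\<chi> i. V i) \<noteq> 0"
proof -
  have "row i (\<chi> i. V i) = V i" for i by (simp add: row_def vec_lambda_eta)
  then have "rows (\<chi> i. V i) = range V" by (auto simp: rows_def)
  then show ?thesis
    using matrix_left_invertible_span_rows[of "\<chi> i. V i"] invertible_left_inverse[of "\<chi> i. V i"]
      invertible_det_nz[of "\<chi> i. V i"] by simp
qed

lemma det_nonzero_imp_independent:
  fixes V :: "'n::finite \<Rightarrow> real ^ 'n"
  assumes "det (\<chi> i. V i) \<noteq> 0"
  shows "inj V" "independent (range V)"
proof -
  have row: "row i (\<chi> i. V i) = V i" for i by (simp add: row_def vec_lambda_eta)
  then have "rows (\<chi> i. V i) = range V" by (auto simp: rows_def)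
  then show "independent (range V)"
    using det_dependent_rows[of "\<chi> i. V i"] assms by (auto simp: dependent_vec_eq)
  show "inj V"
    using det_identical_rows[of _ _ "\<chi> i. V i"] assms unfolding row by (metis injI)
qed

lemma det_nonzero_perturbation:
  fixes V :: "'n::finite \<Rightarrow> real ^ 'n"
  assumes "det (\<chi> i. V i) \<noteq> 0"
  obtains e where "e > 0" "\<And>V'. (\<And>i. dist (V' i) (V i) < e) \<Longrightarrow> det (\<chi> i. V' i) \<noteq> 0"
proof -
  have "continuous_on UNIV (det :: real ^ 'n ^ 'n \<Rightarrow> real)"
    unfolding det_def by (intro continuous_intros)
  then have "open {A :: real ^ 'n ^ 'n. det A \<noteq> 0}" by (intro open_Collect_neq continuous_on_const)
  then obtain r where r: "r > 0" "ball (\<chi> i. V i) r \<subseteq> {A. det A \<noteq> 0}"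
    using assms open_contains_ball by blast
  show ?thesis
  proof (rule that[of "r / real CARD('n)"])
    show "r / real CARD('n) > 0" using r by simp
    fix V' :: "'n \<Rightarrow> real ^ 'n"
    assume V': "\<And>i. dist (V' i) (V i) < r / real CARD('n)"
    have "dist (\<chi> i. V i) (\<chi> i. V' i) \<le> (\<Sum>i\<in>UNIV. dist (V i) (V' i))"
      unfolding dist_vec_def by (simp add: L2_set_le_sum)
    also have "\<dots> < (\<Sum>i\<in>(UNIV :: 'n set). r / real CARD('n))"
      using V' by (intro sum_strict_mono) (auto simp: dist_commute)
    also have "\<dots> = r" by simp
    finally show "det (\<chi> i. V' i) \<noteq> 0" using r(2) by auto
  qed
qed

lemma dist_le_of_mem_closed_cone:
  assumes "u \<in> closed_cone w \<theta>" "norm u = 1" "norm w = 1"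
  shows "dist u w \<le> sqrt (2 * \<theta>)"
proof -
  have "(dist u w)\<^sup>2 = (norm u)\<^sup>2 + (norm w)\<^sup>2 - 2 * (u \<bullet> w)"
    by (simp add: dist_norm power2_norm_eq_inner inner_diff_left inner_diff_right inner_commute)
  also have "\<dots> \<le> 2 * \<theta>" using assms by (simp add: closed_cone_def)
  finally show ?thesis by (rule real_le_rsqrt)
qed

lemma closed_cone_scale:
  assumes "v \<in> closed_cone w \<theta>" "c > 0" shows "c *\<^sub>R v \<in> closed_cone w \<theta>"
  using assms by (simp add: closed_cone_def mult.left_commute)

text \<open>Determinants have rows indexed by the type \<open>'n\<close>, while
  \<open>independent_cones\<close> counts with natural numbers; \<open>b\<close> translates between
  the two.\<close>

lemma independent_cones_reindex:
  fixes C :: "'n::finite \<Rightarrow> (real ^ 'n) set"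
  assumes b: "bij_betw b (UNIV :: 'n set) {..<CARD('n)}"
    and cone: "\<And>i. is_closed_cone_of_width (\<theta> i) (C i)"
    and ind: "\<And>v. (\<And>i. v i \<in> C i - {0}) \<Longrightarrow> det (\<chi> i. v i) \<noteq> 0"
  shows "independent_cones CARD('n) (\<lambda>j. C (inv b j))"
proof -
  have bi: "b i < CARD('n)" "inv b (b i) = i" for i
    using b bij_betw_imp_inj_on[OF b] by (auto simp: bij_betw_def)
  have "inj_on v {..<CARD('n)} \<and> independent (v ` {..<CARD('n)})"
    if v: "\<forall>j<CARD('n). v j \<in> C (inv b j) - {0}" for v :: "nat \<Rightarrow> real ^ 'n"
  proof -
    have "v (b i) \<in> C i - {0}" for i using v bi by metis
    then have "det (\<chi> i. v (b i)) \<noteq> 0" by (rule ind)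
    from det_nonzero_imp_independent[OF this]
    have inj: "inj (\<lambda>i. v (b i))" and indep: "independent (range (\<lambda>i. v (b i)))" .
    have im: "b ` UNIV = {..<CARD('n)}" using b by (simp add: bij_betw_def)
    have "inj_on v (b ` UNIV)" using inj by (auto intro!: inj_onI dest: injD)
    moreover have "range (\<lambda>i. v (b i)) = v ` {..<CARD('n)}" unfolding im[symmetric] by auto
    ultimately show ?thesis using indep im by simp
  qed
  then show ?thesis unfolding independent_cones_def using cone by blast
qed

text \<open>Rescaling the rows to unit length changes the determinant by a nonzero factor, and unit
  vectors of the cones are near the frame \<open>V\<close>.\<close>

lemma cones_in_small_balls_independent:
  fixes C :: "'n::finite \<Rightarrow> (real ^ 'n) set" and V :: "'n \<Rightarrow> real ^ 'n"
  assumes cone: "\<And>i. C i = closed_cone (w i) (\<theta> i)"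
    and pert: "\<And>V'. (\<And>i. dist (V' i) (V i) < e) \<Longrightarrow> det (\<chi> i. V' i) \<noteq> 0"
    and ball: "\<And>i. C i \<inter> {u. norm u = 1} \<subseteq> ball (V i) e"
    and v: "\<And>i. v i \<in> C i - {0}"
  shows "det (\<chi> i. v i) \<noteq> 0"
proof -
  define u where "u i = v i /\<^sub>R norm (v i)" for i
  have "dist (u i) (V i) < e" for i
  proof -
    have "u i \<in> C i" unfolding u_def cone using v[of i] by (intro closed_cone_scale) (auto simp: cone)
    moreover have "norm (u i) = 1" using v[of i] by (simp add: u_def)
    ultimately show ?thesis using ball[of i] by (auto simp: dist_commute)
  qed
  then have "det (\<chi> i. u i) \<noteq> 0" by (rule pert)
  moreover have "(\<chi> i. v i) = (\<chi> i. norm (v i) *s u i)"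
    using v by (simp add: vec_eq_iff u_def)
  ultimately show ?thesis using v det_rows_mul[of "\<lambda>i. norm (v i)" u] by simp
qed

section \<open>Representations indexed by frames\<close>

lemma alberti_representation_subset:
  assumes "alberti_representation \<mu> A P M" "V \<subseteq> A"
  shows "alberti_representation \<mu> V P M"
  using assms(1) order_trans[OF _ assms(2)] unfolding alberti_representation_def by blast

lemma has_independent_alberti_representations_subset:
  assumes "has_independent_alberti_representations \<mu> A \<phi> m" "V \<subseteq> A"
  shows "has_independent_alberti_representations \<mu> V \<phi> m"
  using assms(1) alberti_representation_subset[OF _ assms(2)]
  unfolding has_independent_alberti_representations_def by blast

lemma represented_tuple_imp_independent_representations:
  fixes C :: "'n::finite \<Rightarrow> (real ^ 'n) set"
  assumes cone: "\<And>i. is_closed_cone_of_width (\<theta> i) (C i)"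
    and ind: "\<And>v. (\<And>i. v i \<in> C i - {0}) \<Longrightarrow> det (\<chi> i. v i) \<noteq> 0"
    and rep: "\<And>i. represented_in_direction \<mu> (A i) \<phi> (C i)"
    and V: "\<And>i. V \<subseteq> A i"
  shows "has_independent_alberti_representations \<mu> V \<phi> CARD('n)"
proof -
  obtain b :: "'n \<Rightarrow> nat" where b: "bij_betw b UNIV {..<CARD('n)}"
    using ex_bij_betw_finite_nat[of "UNIV :: 'n set"] by (auto simp: atLeast0LessThan)
  obtain P M where PM: "\<And>i. alberti_representation \<mu> (A i) (P i) (M i)"
      "\<And>i. alberti_in_direction (P i) (M i) \<phi> (C i)"
    using rep unfolding represented_in_direction_def by metis
  have "alberti_representation \<mu> V (P i) (M i)" for i
    by (rule alberti_representation_subset[OF PM(1) V])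
  moreover have "independent_cones CARD('n) (\<lambda>j. C (inv b j))"
  proof (rule independent_cones_reindex[OF b cone])
    fix v :: "'n \<Rightarrow> real ^ 'n" assume "\<And>i. v i \<in> C i - {0}"
    then show "det (\<chi> i. v i) \<noteq> 0" by (rule ind)
  qed
  ultimately show ?thesis
    unfolding has_independent_alberti_representations_def using PM(2)
    by (intro exI[of _ "\<lambda>j. P (inv b j)"] exI[of _ "\<lambda>j. M (inv b j)"] exI[of _ "\<lambda>j. C (inv b j)"]) auto
qed

lemma spanning_set_contains_frame:
  fixes D :: "(real ^ 'n) set"
  assumes "span D = UNIV"
  obtains V :: "'n::finite \<Rightarrow> real ^ 'n" where "range V \<subseteq> D" "det (\<chi> i. V i) \<noteq> 0"
proof -
  obtain B where B: "B \<subseteq> D" "independent B" "D \<subseteq> span B" "card B = dim D"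
    by (rule basis_exists)
  have spB: "span B = UNIV" using B(3) assms by (metis span_mono span_span top.extremum_uniqueI)
  have "card B = CARD('n)" using B(4) assms by (metis dim_span dim_UNIV DIM_cart DIM_real mult.right_neutral)
  moreover have "finite B" by (rule independent_imp_finite[OF B(2)])
  ultimately obtain V where V: "bij_betw V (UNIV :: 'n set) B"
    by (metis finite finite_same_card_bij)
  then have "range V = B" by (simp add: bij_betw_def)
  then show ?thesis using that[of V] B(1) spB span_range_UNIV_iff_det[of V] by simp
qed

section \<open>Lower Lipschitz bounds and countably many cones\<close>

text \<open>Every neighbourhood of \<open>x0\<close> contains points where the quotient reaches
  \<open>l\<close>, hence so does the upper limit. This feeds the first condition in
  \<open>A_tilde_param\<close>.\<close>

lemma structured_chart_Lip_ge:
  fixes \<phi> :: "'a::metric_space \<Rightarrow> real ^ 'n" and x0 :: 'a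
  assumes near: "\<And>R. R > 0 \<Longrightarrow> \<exists>x :: 'n \<Rightarrow> 'a. (\<forall>i. x i \<noteq> x0 \<and> dist (x i) x0 < R) \<and>
       (MAX i\<in>UNIV. \<bar>(\<phi> (x i) - \<phi> x0) \<bullet> v\<bar> / dist (x i) x0) \<ge> l"
  shows "Lip (\<lambda>x. v \<bullet> \<phi> x) x0 \<ge> ennreal l"
  unfolding Lip_on_def Limsup_def
proof (rule INF_greatest)
  fix Q assume "Q \<in> {Q. eventually Q (at x0)}"
  then obtain R where R: "R > 0" "\<And>y. y \<noteq> x0 \<Longrightarrow> dist y x0 < R \<Longrightarrow> Q y"
    by (auto simp: eventually_at)
  obtain x :: "'n \<Rightarrow> 'a" where x: "\<And>i. x i \<noteq> x0" "\<And>i. dist (x i) x0 < R"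
      "(MAX i\<in>UNIV. \<bar>(\<phi> (x i) - \<phi> x0) \<bullet> v\<bar> / dist (x i) x0) \<ge> l"
    using near[OF R(1)] by blast
  then obtain i where i: "\<bar>(\<phi> (x i) - \<phi> x0) \<bullet> v\<bar> / dist (x i) x0 \<ge> l"
    by (subst (asm) Max_ge_iff) auto
  have "Q (x i)" using R(2) x by blast
  then have "ennreal (dist (v \<bullet> \<phi> x0) (v \<bullet> \<phi> (x i)) / dist x0 (x i))
      \<le> (SUP y\<in>Collect Q. ennreal (dist (v \<bullet> \<phi> x0) (v \<bullet> \<phi> y) / dist x0 y))"
    by (intro SUP_upper) simp
  moreover have "dist (v \<bullet> \<phi> x0) (v \<bullet> \<phi> (x i)) = \<bar>(\<phi> (x i) - \<phi> x0) \<bullet> v\<bar>"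
    unfolding inner_commute[of _ v] inner_diff_right dist_real_def by (rule abs_minus_commute)
  ultimately show "ennreal l \<le> (SUP y\<in>Collect Q. ennreal (dist (v \<bullet> \<phi> x0) (v \<bullet> \<phi> y) / dist x0 y))"
    using order_trans[OF ennreal_leI[OF i]] by (simp add: dist_commute[of x0])
qed

text \<open>Countably many centres approximate all directions, so that almost everywhere statements
  can hold for all cones simultaneously.\<close>

lemma dense_sphere_sequence:
  obtains e :: "nat \<Rightarrow> real ^ 'n" where "\<And>p. norm (e p) = 1"
    "\<And>v r. norm v = 1 \<Longrightarrow> r > 0 \<Longrightarrow> \<exists>p. dist v (e p) < r"
proof -
  let ?S = "{v :: real ^ 'n. norm v = 1}"
  obtain T where T: "countable T" "T \<subseteq> ?S" "?S \<subseteq> closure T" by (rule separable)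
  obtain u :: "real ^ 'n" where "norm u = 1" using vector_choose_size[of 1] by auto
  then have "T \<noteq> {}" using T(3) by auto
  show ?thesis
  proof (rule that[of "from_nat_into T"])
    show "norm (from_nat_into T p) = 1" for p using from_nat_into[OF \<open>T \<noteq> {}\<close>, of p] T(2) by auto
    fix v :: "real ^ 'n" and r :: real assume "norm v = 1" "r > 0"
    then obtain y where "y \<in> T" "dist y v < r" using T(3) closure_approachable by blast
    then show "\<exists>p. dist v (from_nat_into T p) < r"
      using from_nat_into_surj[OF T(1)] by (metis dist_commute)
  qed
qed

text \<open>
  With a dense sequence \<open>e\<close> of unit vectors, \<open>q = (p, m)\<close> indexes two cones around \<open>e p\<close>: the narrow one
  (\<open>c = 1\<close>) tests which sets are null for curves, the wide one (\<open>c = 2\<close>) contains the directions of the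
  representations. The offset \<open>3\<close> keeps both widths below \<open>1\<close>.
\<close>

abbreviation indexed_cone :: "real \<Rightarrow> (nat \<Rightarrow> real ^ 'n) \<Rightarrow> nat \<times> nat \<Rightarrow> (real ^ 'n) set" where
  "indexed_cone c e q \<equiv> closed_cone (e (fst q)) (c / (real (snd q) + 3))"

lemma small_cone_index:
  fixes e :: real
  assumes "e > 0"
  obtains m :: nat where "sqrt (2 * (2 / (real m + 3))) < e"
proof -
  obtain m :: nat where m: "4 / e\<^sup>2 < real m" using reals_Archimedean2 by blast
  have "4 < e\<^sup>2 * (real m + 3)"
  proof -
    have "4 < real m * e\<^sup>2" using m assms by (simp add: pos_divide_less_eq)
    also have "\<dots> \<le> e\<^sup>2 * (real m + 3)" by (simp add: algebra_simps)
    finally show ?thesis .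
  qed
  then have "2 * (2 / (real m + 3)) < e\<^sup>2" by (simp add: pos_divide_less_eq)
  then have "sqrt (2 * (2 / (real m + 3))) < e" using assms by (intro real_less_lsqrt) auto
  then show ?thesis by (rule that)
qed

text \<open>
  The limit directions of the wide cones with \<open>q \<in> I\<close> contain no frame, so they lie in a hyperplane
  \<open>w\<^sub>0\<^sup>\<bottom>\<close>. The unit vectors \<open>v\<close> with \<open>v \<bullet> w\<^sub>0 \<ge> \<theta> / 2\<close> stay away from it, and by compactness finitely many
  narrow cones with \<open>q \<notin> I\<close> cover them.
\<close>

lemma dependent_directions_avoid_cone:
  fixes e :: "nat \<Rightarrow> real ^ 'n" and I :: "(nat \<times> nat) set"
  assumes e: "\<And>p. norm (e p) = 1" and dense: "\<And>v r. norm v = 1 \<Longrightarrow> r > 0 \<Longrightarrow> \<exists>p. dist v (e p) < r"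
    and noframe: "\<And>Q :: 'n \<Rightarrow> nat \<times> nat. range Q \<subseteq> I \<Longrightarrow>
      \<exists>v. (\<forall>i. v i \<in> indexed_cone 2 e (Q i) - {0}) \<and> det (\<chi> i. v i) = 0"
    and \<theta>: "0 < \<theta>" "\<theta> < 1"
  obtains p qs where "set qs \<inter> I = {}"
    "closed_cone (e p) (1 - \<theta>) - {0} \<subseteq> (\<Union>q\<in>set qs. indexed_cone 1 e q)"
proof -
  define C' where "C' q = indexed_cone 2 e q" for q :: "nat \<times> nat"
  \<comment> \<open>A frame inside \<open>D\<close> could be perturbed into a frame of cones from
    \<open>I\<close>, which \<open>noframe\<close> rules out; hence \<open>D\<close> does not
    span.\<close>
  define D where "D = {v. \<forall>r>0. \<exists>q\<in>I. C' q \<inter> {u. norm u = 1} \<subseteq> ball v r}"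
  have "span D \<noteq> UNIV"
  proof
    assume "span D = UNIV"
    then obtain V :: "'n \<Rightarrow> real ^ 'n" where V: "range V \<subseteq> D" "det (\<chi> i. V i) \<noteq> 0"
      by (rule spanning_set_contains_frame)
    obtain r where r: "r > 0" "\<And>V'. (\<And>i. dist (V' i) (V i) < r) \<Longrightarrow> det (\<chi> i. V' i) \<noteq> 0"
      using det_nonzero_perturbation[OF V(2)] by metis
    have "\<exists>q\<in>I. C' q \<inter> {u. norm u = 1} \<subseteq> ball (V i) r" for i
      using V(1) r(1) unfolding D_def by blast
    then obtain Q where Q: "\<And>i. Q i \<in> I" "\<And>i. C' (Q i) \<inter> {u. norm u = 1} \<subseteq> ball (V i) r" by metis
    have "range Q \<subseteq> I" using Q(1) by blast
    then obtain v where v: "\<And>i. v i \<in> C' (Q i) - {0}" "det (\<chi> i. v i) = 0"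
      using noframe[of Q] unfolding C'_def by blast
    have "det (\<chi> i. v i) \<noteq> 0"
    proof (rule cones_in_small_balls_independent[where C = "\<lambda>i. C' (Q i)"])
      show "C' (Q i) = indexed_cone 2 e (Q i)" for i
        by (simp add: C'_def)
      show "det (\<chi> i. V' i) \<noteq> 0" if "\<And>i. dist (V' i) (V i) < r" for V' using r(2)[OF that] .
    qed (use Q(2) v(1) in auto)
    then show False using v(2) by simp
  qed
  then obtain w1 where w1: "w1 \<noteq> 0" "\<And>x. x \<in> span D \<Longrightarrow> w1 \<bullet> x = 0"
    using span_not_UNIV_orthogonal by blast
  define w0 where "w0 = w1 /\<^sub>R norm w1"
  have w0: "norm w0 = 1" "\<And>x. x \<in> D \<Longrightarrow> x \<bullet> w0 = 0"
    using w1 span_base by (auto simp: w0_def inner_commute)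
  \<comment> \<open>Replacing \<open>w0\<close> by a centre \<open>e p\<close> at distance below
    \<open>\<theta> / 2\<close> costs half of the bound \<open>\<theta>\<close>.\<close>
  define K where "K = {v. norm v = 1 \<and> \<theta> / 2 \<le> v \<bullet> w0}"
  have "closed K" unfolding K_def by (intro closed_Collect_conj closed_Collect_eq closed_Collect_le continuous_intros)
  moreover have "bounded K" by (rule boundedI[of _ 1]) (auto simp: K_def)
  ultimately have "compact K" using compact_eq_bounded_closed by blast
  have "\<exists>q. q \<notin> I \<and> 1 - 1 / (real (snd q) + 3) < v \<bullet> e (fst q)" if v: "v \<in> K" for v
  proof -
    have "v \<notin> D" using v w0(2)[of v] \<theta>(1) by (auto simp: K_def)
    then obtain r where r: "r > 0" "\<And>q. q \<in> I \<Longrightarrow> \<not> C' q \<inter> {u. norm u = 1} \<subseteq> ball v r"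
      unfolding D_def by blast
    obtain m :: nat where m: "sqrt (2 * (2 / (real m + 3))) < r / 2"
      using small_cone_index[of "r / 2"] r(1) by auto
    have nv: "norm v = 1" using v by (simp add: K_def)
    \<comment> \<open>The first radius puts the unit vectors of the wide cone inside
      \<open>ball v r\<close>, so \<open>(p, m)\<close> is not in \<open>I\<close>; the second puts
      \<open>v\<close> in the interior of the narrow cone.\<close>
    have "min (r / 2) (sqrt (1 / (real m + 3))) > 0" using r(1) by simp
    from dense[OF nv this] obtain p where p: "dist v (e p) < r / 2" "dist v (e p) < sqrt (1 / (real m + 3))"
      by auto
    have "C' (p, m) \<inter> {u. norm u = 1} \<subseteq> ball v r"
    proof
      fix u assume u: "u \<in> C' (p, m) \<inter> {u. norm u = 1}"
      then have "u \<in> closed_cone (e p) (2 / (real m + 3))" "norm u = 1" by (simp_all add: C'_def)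
      then have "dist u (e p) \<le> sqrt (2 * (2 / (real m + 3)))"
        using e by (rule dist_le_of_mem_closed_cone)
      then have "dist v u < r" using m p(1) dist_triangle2[of v u "e p"] by linarith
      then show "u \<in> ball v r" by simp
    qed
    then have "(p, m) \<notin> I" using r(2) by blast
    moreover have "1 - 1 / (real m + 3) < v \<bullet> e p"
    proof -
      have "(dist v (e p))\<^sup>2 < (sqrt (1 / (real m + 3)))\<^sup>2" using p(2) by (intro power_strict_mono) auto
      then have "(dist v (e p))\<^sup>2 < 1 / (real m + 3)" by simp
      moreover have "(dist v (e p))\<^sup>2 = (norm v)\<^sup>2 + (norm (e p))\<^sup>2 - 2 * (v \<bullet> e p)"
        by (simp add: dist_norm power2_norm_eq_inner inner_diff_left inner_diff_right inner_commute)
      moreover have "1 / (real m + 3) > 0" by simp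
      ultimately show ?thesis unfolding nv e power_one by linarith
    qed
    ultimately show ?thesis by (intro exI[of _ "(p, m)"]) simp
  qed
  then obtain q where q: "\<And>v. v \<in> K \<Longrightarrow> q v \<notin> I"
      "\<And>v. v \<in> K \<Longrightarrow> 1 - 1 / (real (snd (q v)) + 3) < v \<bullet> e (fst (q v))" by metis
  \<comment> \<open>The strict inequality gives open sets, as the covering argument requires; their
    unit vectors belong to the narrow cones.\<close>
  define W where "W v = {u. 1 - 1 / (real (snd (q v)) + 3) < u \<bullet> e (fst (q v))}" for v
  have Wo: "open (W v)" if "v \<in> K" for v unfolding W_def by (intro open_Collect_less continuous_intros)
  have cov: "K \<subseteq> (\<Union>v\<in>K. W v)" using q(2) by (auto simp: W_def)
  obtain F where F: "F \<subseteq> K" "finite F" "K \<subseteq> (\<Union>v\<in>F. W v)"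
    by (rule compactE_image[OF \<open>compact K\<close> Wo cov])
  obtain qs where qs: "set qs = q ` F" using finite_list[of "q ` F"] F(2) by auto
  obtain p where p: "dist w0 (e p) < \<theta> / 2" using dense[OF w0(1), of "\<theta> / 2"] \<theta>(1) by auto
  show ?thesis
  proof (rule that[of qs p])
    show "set qs \<inter> I = {}" unfolding qs using q(1) F(1) by blast
    show "closed_cone (e p) (1 - \<theta>) - {0} \<subseteq> (\<Union>q\<in>set qs. indexed_cone 1 e q)"
    proof
      fix u assume u: "u \<in> closed_cone (e p) (1 - \<theta>) - {0}"
      define u' where "u' = u /\<^sub>R norm u"
      have n: "norm u > 0" "norm u' = 1" using u by (auto simp: u'_def)
      have "u' \<in> closed_cone (e p) (1 - \<theta>)" unfolding u'_def using u n(1) by (intro closed_cone_scale) auto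
      then have "\<theta> \<le> u' \<bullet> e p" using n(2) by (simp add: closed_cone_def)
      moreover have "u' \<bullet> (e p - w0) \<le> \<theta> / 2"
      proof -
        have "u' \<bullet> (e p - w0) \<le> norm u' * norm (e p - w0)" by (rule norm_cauchy_schwarz)
        also have "\<dots> \<le> \<theta> / 2" using p n(2) by (simp add: dist_norm norm_minus_commute)
        finally show ?thesis .
      qed
      ultimately have "u' \<in> K" using n(2) by (simp add: K_def inner_diff_right)
      then obtain v where v: "v \<in> F" "u' \<in> W v" using F(3) by blast
      have "u' \<in> indexed_cone 1 e (q v)"
        using v(2) n(2) by (simp add: W_def closed_cone_def)
      then have "norm u *\<^sub>R u' \<in> indexed_cone 1 e (q v)"
        using n(1) by (rule closed_cone_scale)
      moreover have "norm u *\<^sub>R u' = u" using n(1) by (simp add: u'_def)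
      ultimately show "u \<in> (\<Union>q\<in>set qs. indexed_cone 1 e q)"
        using v(1) qs by auto
    qed
  qed
qed

text \<open>With \<open>I = UNIV\<close>, a lack of frames would produce a cone covered, apart from
  0, by an empty family, but the cone contains its own axis. The frame serves to give null sets a
  formal independent representation.\<close>

lemma standard_frame_of_cones:
  fixes e :: "nat \<Rightarrow> real ^ 'n"
  assumes e: "\<And>p. norm (e p) = 1" and dense: "\<And>v r. norm v = 1 \<Longrightarrow> r > 0 \<Longrightarrow> \<exists>p. dist v (e p) < r"
  obtains Q :: "'n \<Rightarrow> nat \<times> nat" where
    "\<And>v. (\<And>i. v i \<in> indexed_cone 2 e (Q i) - {0}) \<Longrightarrow> det (\<chi> i. v i) \<noteq> 0"
proof (rule ccontr)
  assume no: "\<not> thesis"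
  have "\<exists>v. (\<forall>i. v i \<in> indexed_cone 2 e (Q i) - {0}) \<and> det (\<chi> i. v i) = 0"
    for Q :: "'n \<Rightarrow> nat \<times> nat"
  proof (rule ccontr)
    assume "\<not> ?thesis"
    then show False using no that[of Q] by blast
  qed
  note no_frame = this
  have "\<exists>p qs. set qs \<inter> (UNIV :: (nat \<times> nat) set) = {} \<and>
    closed_cone (e p) (1 - 1/2) - {0} \<subseteq> (\<Union>q\<in>set qs. indexed_cone 1 e q)"
  proof (rule dependent_directions_avoid_cone[of e UNIV "1/2"])
    show "\<exists>p. dist v (e p) < r" if "norm v = 1" "r > 0" for v r by (rule dense[OF that])
    show "\<exists>v. (\<forall>i. v i \<in> indexed_cone 2 e (Q i) - {0}) \<and> det (\<chi> i. v i) = 0"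
      for Q :: "'n \<Rightarrow> nat \<times> nat" by (rule no_frame)
  qed (rule e, simp, simp, blast)
  then obtain p and qs :: "(nat \<times> nat) list" where "set qs \<inter> UNIV = {}"
    "closed_cone (e p) (1 - 1/2) - {0} \<subseteq> (\<Union>q\<in>set qs. indexed_cone 1 e q)"
    by blast
  moreover have "e p \<in> closed_cone (e p) (1 - 1/2) - {0}"
    using e[of p] by (auto simp: closed_cone_def dot_square_norm)
  ultimately show False by auto
qed

subsection \<open>The theorem\<close>

lemma null_for_wide_cone_directions:
  fixes \<phi> :: "'a::polish_space \<Rightarrow> real ^ 'n" and C :: "'q \<Rightarrow> (real ^ 'n) set"
  assumes "finite F" and null: "\<And>q. q \<in> F \<Longrightarrow> AE t in lborel. t \<in> curve_dom \<gamma> \<longrightarrow> curve_fun \<gamma> t \<in> B \<longrightarrow>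
        curve_deriv \<phi> \<gamma> t \<notin> C q - {0}"
    and cover: "C0 - {0} \<subseteq> (\<Union>q\<in>F. C q)"
    and dir: "in_direction (lebesgue_on (curve_dom \<gamma>)) \<phi> C0 \<gamma>"
  shows "hausdorff1 (curve_image \<gamma> \<inter> B) = 0"
proof -
  have "AE t in lborel. \<forall>q\<in>F. t \<in> curve_dom \<gamma> \<longrightarrow> curve_fun \<gamma> t \<in> B \<longrightarrow> curve_deriv \<phi> \<gamma> t \<notin> C q - {0}"
    using null by (intro AE_finite_allI \<open>finite F\<close>)
  moreover have "AE t in lborel. t \<in> curve_dom \<gamma> \<longrightarrow> curve_deriv \<phi> \<gamma> t \<in> C0 - {0}"
    using dir unfolding in_direction_def AE_lebesgue_on_iff[OF borel_curve_dom] .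
  ultimately have "AE t in lborel. t \<notin> {t \<in> curve_dom \<gamma>. curve_fun \<gamma> t \<in> B}"
  proof eventually_elim
    case (elim t)
    then show ?case using cover by blast
  qed
  then obtain N where N: "N \<in> null_sets lborel" "{t \<in> curve_dom \<gamma>. curve_fun \<gamma> t \<in> B} \<subseteq> N"
    by (auto simp: eventually_ae_filter)
  have "negligible N" using N(1) by (simp add: negligible_iff_null_sets null_sets_completionI)
  then have "negligible {t \<in> curve_dom \<gamma>. curve_fun \<gamma> t \<in> B}" using N(2) by (rule negligible_subset)
  then have "hausdorff1 (curve_fun \<gamma> ` {t \<in> curve_dom \<gamma>. curve_fun \<gamma> t \<in> B}) = 0"
    by (intro curve_image_negligible_imp_hausdorff1_null) auto
  moreover have "curve_fun \<gamma> ` {t \<in> curve_dom \<gamma>. curve_fun \<gamma> t \<in> B} = curve_image \<gamma> \<inter> B"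
    by (auto simp: curve_image_def)
  ultimately show ?thesis by simp
qed

text \<open>For fixed \<open>\<theta>\<close> there are countably many pairs of a wide cone and a
  finite list of narrow cones covering it. On the points of \<open>B\<close> outside the
  corresponding sets \<open>A q\<close>, curves cannot run in the narrow cones, hence not in the
  wide one.\<close>

lemma A_tilde_memI:
  fixes \<phi> :: "'a::polish_space \<Rightarrow> real ^ 'n" and A :: "nat \<times> nat \<Rightarrow> 'a set" and e :: "nat \<Rightarrow> real ^ 'n"
  assumes B: "B \<in> sets borel" and l: "l > 0"
    and Lip: "\<And>x v. x \<in> B \<Longrightarrow> norm v = 1 \<Longrightarrow> Lip (\<lambda>x. v \<bullet> \<phi> x) x > ennreal l * Lip \<phi> x"
    and e: "\<And>p. norm (e p) = 1"
    and A: "\<And>q. A q \<in> sets borel"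
    and null: "\<And>q \<gamma>. AE t in lborel. t \<in> curve_dom \<gamma> \<longrightarrow> curve_fun \<gamma> t \<in> B - A q \<longrightarrow>
        curve_deriv \<phi> \<gamma> t \<notin> indexed_cone 1 e q - {0}"
    and avoid: "\<And>x \<theta>. x \<in> B \<Longrightarrow> 0 < \<theta> \<Longrightarrow> \<theta> < 1 \<Longrightarrow> \<exists>p qs. (\<forall>q\<in>set qs. x \<notin> A q) \<and>
      closed_cone (e p) (1 - \<theta>) - {0} \<subseteq> (\<Union>q\<in>set qs. indexed_cone 1 e q)"
  shows "B \<in> A_tilde \<phi>"
proof -
  have "B \<in> A_tilde_param \<phi> \<delta> \<theta> l" if \<theta>: "0 < \<theta>" "\<theta> < 1" for \<delta> \<theta>
  proof -
    define adm where "adm p qs \<longleftrightarrow> closed_cone (e p) (1 - \<theta>) - {0} \<subseteq>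
      (\<Union>q\<in>set qs. indexed_cone 1 e q)" for p and qs :: "(nat \<times> nat) list"
    define pq where "pq k = (from_nat k :: nat \<times> (nat \<times> nat) list)" for k
    \<comment> \<open>Inadmissible codes contribute the empty set, so every index still carries a
      cone of the right width.\<close>
    define raw where "raw k = (if adm (fst (pq k)) (snd (pq k)) then B - (\<Union>q\<in>set (snd (pq k)). A q) else {})" for k
    define C where "C k = closed_cone (e (fst (pq k))) (1 - \<theta>)" for k
    have raw: "raw k \<in> sets borel" for k using B A by (auto simp: raw_def intro!: sets.Diff sets.finite_UN)
    have "B \<subseteq> (\<Union>k. raw k)"
    proof
      fix x assume "x \<in> B"
      then obtain p qs where pqs: "\<forall>q\<in>set qs. x \<notin> A q" "adm p qs" 
        using avoid[OF \<open>x \<in> B\<close> \<theta>] unfolding adm_def by blast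
      have "pq (to_nat (p, qs)) = (p, qs)" by (simp add: pq_def)
      then have "x \<in> raw (to_nat (p, qs))" using pqs \<open>x \<in> B\<close> by (simp add: raw_def)
      then show "x \<in> (\<Union>k. raw k)" by blast
    qed
    then have "(\<Union>k. disjointed raw k) = B" unfolding UN_disjointed_eq by (auto simp: raw_def split: if_splits)
    moreover have "range (disjointed raw) \<subseteq> sets borel" using raw by (intro sets.range_disjointed_sets) auto
    ultimately have dec: "borel_decomposition B (disjointed raw)"
      by (auto simp: borel_decomposition_def disjoint_family_disjointed)
    have width: "is_closed_cone_of_width (1 - \<theta>) (C k)" for k
      unfolding is_closed_cone_of_width_def C_def using \<theta> e by auto
    have "hausdorff1 (curve_image \<gamma> \<inter> disjointed raw k) = 0"
      if dir: "in_direction (lebesgue_on (curve_dom \<gamma>)) \<phi> (C k) \<gamma>" for k \<gamma>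
    proof (cases "adm (fst (pq k)) (snd (pq k))")
      case True
      show ?thesis
      proof (rule null_for_wide_cone_directions[OF finite_set _ True[unfolded adm_def] dir[unfolded C_def]])
        fix q assume "q \<in> set (snd (pq k))"
        then have sub: "disjointed raw k \<subseteq> B - A q" using disjointed_subset[of raw k] by (auto simp: raw_def split: if_splits)
        show "AE t in lborel. t \<in> curve_dom \<gamma> \<longrightarrow> curve_fun \<gamma> t \<in> disjointed raw k \<longrightarrow>
            curve_deriv \<phi> \<gamma> t \<notin> indexed_cone 1 e q - {0}"
          using null[where q = q and \<gamma> = \<gamma>] by eventually_elim (use sub in blast)
      qed
    next
      case False
      then have "disjointed raw k = {}" using disjointed_subset[of raw k] by (auto simp: raw_def)
      then show ?thesis using curve_image_negligible_imp_hausdorff1_null[of "{}" \<gamma>] by simp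
    qed
    then show ?thesis
      unfolding A_tilde_param_def using Lip dec width by blast
  qed
  then show ?thesis unfolding A_tilde_def using l by blast
qed

text \<open>Exhausting by sets with independent representations leaves a part of \<open>U\<close>
  whose points, off a null set, lie in no intersection of represented sets along a frame. Such
  points satisfy the criterion \<open>A_tilde_memI\<close>, so the remainder is null and can itself
  be added as a represented piece.\<close>

lemma null_sets_imp_independent_representations:
  fixes \<mu> :: "'a::polish_space measure" and \<phi> :: "'a \<Rightarrow> real ^ 'n"
  assumes \<mu>: "finite_measure \<mu>" "sets \<mu> = sets borel" and "l > 0"
    and chart: "structured_chart \<mu> l U \<phi>"
    and null: "\<And>S. S \<in> A_tilde \<phi> \<Longrightarrow> S \<subseteq> U \<Longrightarrow> emeasure \<mu> S = 0"
  shows "\<exists>V. borel_decomposition U V \<and> (\<forall>i. has_independent_alberti_representations \<mu> (V i) \<phi> CARD('n))"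
proof -
  interpret finite_measure \<mu> by fact
  have U: "compact U" using chart by (simp add: structured_chart_def)
  then have Ub: "U \<in> sets borel" by (intro borel_closed compact_imp_closed)
  obtain K where lip: "K-lipschitz_on UNIV \<phi>" using chart unfolding structured_chart_def by blast
  have K0: "K \<ge> 0" using lip by (rule lipschitz_on_nonneg)
  obtain U' where U': "AE x in \<mu>. x \<in> U \<longrightarrow> x \<in> U'" and near:
     "\<And>R. R > 0 \<Longrightarrow> \<exists>r>0. \<forall>x0\<in>U'. \<exists>x :: 'n \<Rightarrow> 'a.
           (\<forall>i. x i \<in> U \<and> r < dist (x i) x0 \<and> dist (x i) x0 < R) \<and>
           (\<forall>v. norm v = 1 \<longrightarrow> (MAX i\<in>UNIV. \<bar>(\<phi> (x i) - \<phi> x0) \<bullet> v\<bar> / dist (x i) x0) \<ge> l)"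
    using chart unfolding structured_chart_def by blast
  have LipU': "Lip (\<lambda>x. v \<bullet> \<phi> x) x0 \<ge> ennreal l" if x0: "x0 \<in> U'" and v: "norm v = 1" for x0 v
  proof (rule structured_chart_Lip_ge)
    fix R :: real assume "R > 0"
    from near[OF this] obtain r where r: "r > 0" and rx: "\<forall>x0\<in>U'. \<exists>x :: 'n \<Rightarrow> 'a.
           (\<forall>i. x i \<in> U \<and> r < dist (x i) x0 \<and> dist (x i) x0 < R) \<and>
           (\<forall>v. norm v = 1 \<longrightarrow> (MAX i\<in>UNIV. \<bar>(\<phi> (x i) - \<phi> x0) \<bullet> v\<bar> / dist (x i) x0) \<ge> l)"
      by blast
    obtain x :: "'n \<Rightarrow> 'a" where x: "\<forall>i. x i \<in> U \<and> r < dist (x i) x0 \<and> dist (x i) x0 < R"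
      "\<forall>v. norm v = 1 \<longrightarrow> (MAX i\<in>UNIV. \<bar>(\<phi> (x i) - \<phi> x0) \<bullet> v\<bar> / dist (x i) x0) \<ge> l"
      using bspec[OF rx x0] by blast
    have "x i \<noteq> x0" for i using x(1) r by (metis dist_self less_asym)
    then show "\<exists>x :: 'n \<Rightarrow> 'a. (\<forall>i. x i \<noteq> x0 \<and> dist (x i) x0 < R) \<and>
       (MAX i\<in>UNIV. \<bar>(\<phi> (x i) - \<phi> x0) \<bullet> v\<bar> / dist (x i) x0) \<ge> l"
      using x v by (intro exI[of _ x]) auto
  qed
  obtain e :: "nat \<Rightarrow> real ^ 'n" where e: "\<And>p. norm (e p) = 1"
    and dense: "\<And>v r. norm v = 1 \<Longrightarrow> r > 0 \<Longrightarrow> \<exists>p. dist v (e p) < r"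
    by (rule dense_sphere_sequence) blast
  define C where "C q = indexed_cone 1 e q" for q :: "nat \<times> nat"
  define C' where "C' q = indexed_cone 2 e q" for q :: "nat \<times> nat"
  have width: "is_closed_cone_of_width (2 / (real (snd q) + 3)) (C' q)" for q
    unfolding is_closed_cone_of_width_def C'_def using e by auto
  define good where "good q A N \<longleftrightarrow>
      (\<forall>k. A k \<in> sets borel \<and> A k \<subseteq> U \<and> represented_in_direction \<mu> (A k) \<phi> (C' q)) \<and>
      N \<in> null_sets \<mu> \<and> (\<forall>\<gamma>. AE t in lborel. t \<in> curve_dom \<gamma> \<longrightarrow> curve_fun \<gamma> t \<in> U - (\<Union>k. A k) - N \<longrightarrow>
        curve_deriv \<phi> \<gamma> t \<notin> C q - {0})" for q and A :: "nat \<Rightarrow> 'a set" and N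
  have "\<exists>A N. good q A N" for q
  proof (rule cone_decomposition[OF \<mu> U lip, of "1 / (real (snd q) + 3)" "2 / (real (snd q) + 3)" "e (fst q)"])
    show "1 / (real (snd q) + 3) < 2 / (real (snd q) + 3)" by (simp add: divide_strict_right_mono)
    fix A :: "nat \<Rightarrow> 'a set" and N
    assume "\<And>k. A k \<in> sets borel" "\<And>k. A k \<subseteq> U"
      "\<And>k. represented_in_direction \<mu> (A k) \<phi> (indexed_cone 2 e q)"
      "N \<in> null_sets \<mu>"
      "\<And>\<gamma>. AE t in lborel. t \<in> curve_dom \<gamma> \<longrightarrow> curve_fun \<gamma> t \<in> U - (\<Union>k. A k) - N \<longrightarrow>
        curve_deriv \<phi> \<gamma> t \<notin> indexed_cone 1 e q - {0}"
    then have "good q A N" unfolding good_def C_def C'_def by blast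
    then show ?thesis by blast
  qed
  then obtain A N where AN: "\<And>q. good q (A q) (N q)" by metis
  have A: "A q k \<in> sets borel" "A q k \<subseteq> U" "represented_in_direction \<mu> (A q k) \<phi> (C' q)" for q k
    using AN[of q] unfolding good_def by blast+
  have N: "N q \<in> null_sets \<mu>" for q using AN[of q] unfolding good_def by blast
  have dnull: "AE t in lborel. t \<in> curve_dom \<gamma> \<longrightarrow> curve_fun \<gamma> t \<in> U - (\<Union>k. A q k) - N q \<longrightarrow>
        curve_deriv \<phi> \<gamma> t \<notin> C q - {0}" for q \<gamma>
    using AN[of q] unfolding good_def by blast
  have AU: "(\<Union>k. A q k) \<in> sets borel" for q using A(1) by auto
  define frame where "frame Q \<longleftrightarrow> (\<forall>v. (\<forall>i. v i \<in> C' (Q i) - {0}) \<longrightarrow> det (\<chi> i. v i) \<noteq> 0)"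
    for Q :: "'n \<Rightarrow> nat \<times> nat"
  define \<V> where "\<V> = {V \<in> sets borel. V \<subseteq> U \<and> has_independent_alberti_representations \<mu> V \<phi> CARD('n)}"
  have tuple: "(\<Inter>i. A (Q i) (k i)) \<in> \<V>" if Q: "frame Q" for Q :: "'n \<Rightarrow> nat \<times> nat" and k
  proof -
    have "has_independent_alberti_representations \<mu> (\<Inter>i. A (Q i) (k i)) \<phi> CARD('n)"
      by (rule represented_tuple_imp_independent_representations[where C = "\<lambda>i. C' (Q i)" and A = "\<lambda>i. A (Q i) (k i)"
            and \<theta> = "\<lambda>i. 2 / (real (snd (Q i)) + 3)"])
         (use width A(3) Q in \<open>auto simp: frame_def\<close>)
    moreover have "(\<Inter>i. A (Q i) (k i)) \<in> sets borel" using A(1) by (intro sets.finite_INT) auto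
    moreover have "(\<Inter>i. A (Q i) (k i)) \<subseteq> U" using A(2)[of "Q undefined" "k undefined"] by blast
    ultimately show ?thesis by (simp add: \<V>_def)
  qed
  have nullV: "V \<in> \<V>" if V: "V \<in> null_sets \<mu>" "V \<subseteq> U" for V
  proof -
    obtain Q :: "'n \<Rightarrow> nat \<times> nat" where Q: "frame Q"
    proof (rule standard_frame_of_cones[of e])
      show "\<exists>p. dist v (e p) < r" if "norm v = 1" "r > 0" for v r by (rule dense[OF that])
    qed (use e in \<open>auto simp: frame_def C'_def\<close>)
    have "has_independent_alberti_representations \<mu> V \<phi> CARD('n)"
      by (rule represented_tuple_imp_independent_representations[where C = "\<lambda>i. C' (Q i)" and A = "\<lambda>_. V"
            and \<theta> = "\<lambda>i. 2 / (real (snd (Q i)) + 3)"])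
         (use width represented_in_direction_null[OF V(1) \<mu>(2)] Q in \<open>auto simp: frame_def\<close>)
    then show ?thesis using V \<mu>(2) by (auto simp: \<V>_def)
  qed
  have \<V>: "\<V> \<subseteq> sets \<mu>" "\<V> \<noteq> {}" using nullV[of "{}"] \<mu>(2) by (auto simp: \<V>_def)
  obtain V :: "nat \<Rightarrow> 'a set" where V: "\<And>k. V k \<in> \<V>" "\<And>B. B \<in> \<V> \<Longrightarrow> emeasure \<mu> (B - (\<Union>k. V k)) = 0"
    using exhaustion_by_sequence[OF \<mu>(1) \<V>] by metis
  define T where "T = (\<Union>k. V k)"
  have Tb: "T \<in> sets borel" "T \<subseteq> U" using V(1) by (auto simp: T_def \<V>_def)
  have "AE x in \<mu>. x \<notin> (\<Inter>i. A (Q i) (k i)) - T" if "frame Q" for Q :: "'n \<Rightarrow> nat \<times> nat" and k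
  proof -
    have "(\<Inter>i. A (Q i) (k i)) - T \<in> null_sets \<mu>"
      using tuple[OF that, of k] V(2) Tb(1) \<mu>(2) by (auto simp: null_sets_def T_def \<V>_def)
    then show ?thesis by (rule AE_not_in)
  qed
  then have "AE x in \<mu>. frame Q \<longrightarrow> x \<notin> (\<Inter>i. A (Q i) (k i)) - T" for Q :: "'n \<Rightarrow> nat \<times> nat" and k
    by (cases "frame Q") auto
  \<comment> \<open>The functions \<open>Q\<close> and \<open>k\<close> on the finite type
    \<open>'n\<close> form countable types, so all exceptional sets are discarded together.\<close>
  then have ae1: "AE x in \<mu>. \<forall>(Q :: 'n \<Rightarrow> nat \<times> nat) k. frame Q \<longrightarrow> x \<notin> (\<Inter>i. A (Q i) (k i)) - T"
    by (simp only: AE_all_countable) blast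
  have ae2: "AE x in \<mu>. \<forall>q. x \<notin> N q" using N by (simp add: AE_all_countable AE_not_in)
  have "AE x in \<mu>. (\<forall>(Q :: 'n \<Rightarrow> nat \<times> nat) k. frame Q \<longrightarrow> x \<notin> (\<Inter>i. A (Q i) (k i)) - T) \<and>
      (\<forall>q. x \<notin> N q) \<and> (x \<in> U \<longrightarrow> x \<in> U')"
    using ae1 ae2 U' by eventually_elim blast
  then obtain Z where Z: "Z \<in> null_sets \<mu>"
    "{x. \<not> ((\<forall>(Q :: 'n \<Rightarrow> nat \<times> nat) k. frame Q \<longrightarrow> x \<notin> (\<Inter>i. A (Q i) (k i)) - T) \<and>
      (\<forall>q. x \<notin> N q) \<and> (x \<in> U \<longrightarrow> x \<in> U'))} \<subseteq> Z"
    using sets_eq_imp_space_eq[OF \<mu>(2)] unfolding eventually_ae_filter by auto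
  define B where "B = U - T - Z"
  have Zb: "Z \<in> sets borel" using Z(1) \<mu>(2) by auto
  have Bb: "B \<in> sets borel" using Ub Tb Zb by (auto simp: B_def)
  have Bx: "x \<in> U'" "\<And>q. x \<notin> N q"
    "\<And>(Q :: 'n \<Rightarrow> nat \<times> nat) k. frame Q \<Longrightarrow> x \<notin> (\<Inter>i. A (Q i) (k i))" if "x \<in> B" for x
    using that Z(2) unfolding B_def by blast+
  \<comment> \<open>The class demands a strict inequality, and \<open>Lip \<phi> x\<close> is
    bounded by \<open>K\<close>; the factor 2 and the summand 1 give \<open>l' * K < l\<close> even
    when \<open>K = 0\<close>.\<close>
  define l' where "l' = l / (2 * (K + 1))"
  have l': "l' > 0" "l' * K < l"
    using \<open>l > 0\<close> K0 by (auto simp: l'_def field_simps intro: add_nonneg_pos)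
  have "B \<in> A_tilde \<phi>"
  proof (rule A_tilde_memI[OF Bb l'(1) _ e AU])
    fix x and v :: "real ^ 'n" assume x: "x \<in> B" and v: "norm v = 1"
    have "ennreal l' * Lip \<phi> x \<le> ennreal l' * ennreal K" by (intro mult_left_mono Lip_on_le[OF lip]) auto
    also have "\<dots> = ennreal (l' * K)" using l'(1) K0 by (simp add: ennreal_mult)
    also have "\<dots> < ennreal l" using l'(2) \<open>l > 0\<close> by (intro ennreal_lessI)
    also have "\<dots> \<le> Lip (\<lambda>x. v \<bullet> \<phi> x) x" by (rule LipU'[OF Bx(1)[OF x] v])
    finally show "Lip (\<lambda>x. v \<bullet> \<phi> x) x > ennreal l' * Lip \<phi> x" .
  next
    fix q :: "nat \<times> nat" and \<gamma>
    show "AE t in lborel. t \<in> curve_dom \<gamma> \<longrightarrow> curve_fun \<gamma> t \<in> B - (\<Union>k. A q k) \<longrightarrow>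
        curve_deriv \<phi> \<gamma> t \<notin> indexed_cone 1 e q - {0}"
      using dnull[of \<gamma> q]
    proof eventually_elim
      case (elim t)
      then show ?case using Bx(2)[of "curve_fun \<gamma> t" q] unfolding C_def B_def by blast
    qed
  next
    fix x and \<theta> :: real assume x: "x \<in> B" and \<theta>: "0 < \<theta>" "\<theta> < 1"
    \<comment> \<open>A frame with indices in \<open>I\<close> would place \<open>x\<close> in an
      intersection already exhausted by \<open>T\<close>, so \<open>I\<close> contains no
      frame.\<close>
    define I where "I = {q. x \<in> (\<Union>k. A q k)}"
    have "\<exists>p qs. set qs \<inter> I = {} \<and>
      closed_cone (e p) (1 - \<theta>) - {0} \<subseteq> (\<Union>q\<in>set qs. indexed_cone 1 e q)"
    proof (rule dependent_directions_avoid_cone[of e I \<theta>])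
      show "\<exists>p. dist v (e p) < r" if "norm v = 1" "r > 0" for v r by (rule dense[OF that])
      fix Q :: "'n \<Rightarrow> nat \<times> nat" assume Q: "range Q \<subseteq> I"
      then have "\<forall>i. \<exists>k. x \<in> A (Q i) k" by (auto simp: I_def)
      then obtain k where "\<And>i. x \<in> A (Q i) (k i)" by metis
      then have "\<not> frame Q" using Bx(3)[OF x, of Q k] by blast
      then show "\<exists>v. (\<forall>i. v i \<in> indexed_cone 2 e (Q i) - {0}) \<and> det (\<chi> i. v i) = 0"
        unfolding frame_def C'_def by blast
    qed (use e \<theta> in blast)+
    then show "\<exists>p qs. (\<forall>q\<in>set qs. x \<notin> (\<Union>k. A q k)) \<and>
      closed_cone (e p) (1 - \<theta>) - {0} \<subseteq> (\<Union>q\<in>set qs. indexed_cone 1 e q)"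
      unfolding I_def by blast
  qed
  then have "emeasure \<mu> B = 0" by (rule null) (auto simp: B_def)
  then have "B \<in> null_sets \<mu>" using Bb \<mu>(2) by (simp add: null_sets_def)
  then have "B \<union> Z \<in> null_sets \<mu>" using Z(1) by (rule null_sets.Un)
  moreover have "U - T \<in> sets \<mu>" using Ub Tb \<mu>(2) by auto
  moreover have "U - T \<subseteq> B \<union> Z" by (auto simp: B_def)
  ultimately have "U - T \<in> null_sets \<mu>" by (rule null_sets_subset)
  then have UT: "U - T \<in> \<V>" by (rule nullV) blast
  \<comment> \<open>Index 0 holds the leftover null set \<open>U - T\<close>, which
    \<open>nullV\<close> admits to \<open>\<V>\<close>.\<close>
  define W where "W k = (case k of 0 \<Rightarrow> U - T | Suc k \<Rightarrow> V k)" for k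
  have W: "W k \<in> \<V>" for k using UT V(1) by (auto simp: W_def split: nat.split)
  have "(\<Union>k. W k) = U"
  proof (intro equalityI subsetI)
    fix x assume x: "x \<in> U"
    show "x \<in> (\<Union>k. W k)"
    proof (cases "x \<in> T")
      case True
      then obtain k where "x \<in> V k" by (auto simp: T_def)
      then have "x \<in> W (Suc k)" by (simp add: W_def)
      then show ?thesis by blast
    next
      case False
      then have "x \<in> W 0" using x by (simp add: W_def)
      then show ?thesis by blast
    qed
  qed (use W in \<open>auto simp: \<V>_def\<close>)
  then have "(\<Union>k. disjointed W k) = U" by (simp add: UN_disjointed_eq)
  moreover have "range (disjointed W) \<subseteq> sets borel" using W by (intro sets.range_disjointed_sets) (auto simp: \<V>_def)
  ultimately have "borel_decomposition U (disjointed W)"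
    by (auto simp: borel_decomposition_def disjoint_family_disjointed)
  moreover have "has_independent_alberti_representations \<mu> (disjointed W k) \<phi> CARD('n)" for k
  proof -
    have "has_independent_alberti_representations \<mu> (W k) \<phi> CARD('n)" using W by (simp add: \<V>_def)
    then show ?thesis by (rule has_independent_alberti_representations_subset) (rule disjointed_subset)
  qed
  ultimately show ?thesis by blast
qed

theorem theorem5p14:
  fixes \<mu> :: "'a::polish_space measure"
    and U :: "'a set"
    and \<phi> :: "'a \<Rightarrow> real ^ 'n"
    and l :: real
  assumes "metric_measure_space \<mu>"
    and "l > 0"
    and "structured_chart \<mu> l U \<phi>"
  shows "(\<exists>V. borel_decomposition U V \<and>
            (\<forall>i. has_independent_alberti_representations \<mu> (V i) \<phi> CARD('n)))
         \<longleftrightarrow> (\<forall>S\<in>A_tilde \<phi>. S \<subseteq> U \<longrightarrow> emeasure \<mu> S = 0)"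
proof
  have \<mu>: "finite_measure \<mu>" "sets \<mu> = sets borel"
    using assms(1) by (simp_all add: metric_measure_space_def)
  {
    assume "\<exists>V. borel_decomposition U V \<and>
            (\<forall>i. has_independent_alberti_representations \<mu> (V i) \<phi> CARD('n))"
    then obtain V where dec: "borel_decomposition U V"
      and rep: "\<And>i. has_independent_alberti_representations \<mu> (V i) \<phi> CARD('n)" by blast
    have V: "\<And>k. V k \<in> sets borel" "(\<Union>k. V k) = U"
      using dec by (simp_all add: borel_decomposition_def)
    obtain K where lip: "K-lipschitz_on UNIV \<phi>" using assms(3) unfolding structured_chart_def by blast
    show "\<forall>S\<in>A_tilde \<phi>. S \<subseteq> U \<longrightarrow> emeasure \<mu> S = 0"
    proof (intro ballI impI)
      fix S assume S: "S \<in> A_tilde \<phi>" "S \<subseteq> U"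
      obtain l' where "\<forall>\<delta>>0. \<forall>\<theta>. 0 < \<theta> \<and> \<theta> < 1 \<longrightarrow> S \<in> A_tilde_param \<phi> \<delta> \<theta> l'"
        using S(1) unfolding A_tilde_def by blast
      \<comment> \<open>Arbitrary parameters: the purpose is a Borel decomposition, which shows that
        \<open>S\<close> is Borel.\<close>
      then have "S \<in> A_tilde_param \<phi> 1 (1/2) l'" by simp
      then obtain B where "borel_decomposition S B" unfolding A_tilde_param_def by blast
      then have Sb: "S \<in> sets borel" unfolding borel_decomposition_def by auto
      have "S \<inter> V k \<in> null_sets \<mu>" for k
        using independent_representations_imp_null[OF rep V(1) lip S(1) \<mu>(2), of k] Sb V(1) \<mu>(2)
        by (auto simp: null_sets_def)
      then have "(\<Union>k. S \<inter> V k) \<in> null_sets \<mu>" by (rule null_sets_UN)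
      moreover have "(\<Union>k. S \<inter> V k) = S" using S(2) V(2) by blast
      ultimately show "emeasure \<mu> S = 0" by (simp add: null_setsD1)
    qed
  }
  assume "\<forall>S\<in>A_tilde \<phi>. S \<subseteq> U \<longrightarrow> emeasure \<mu> S = 0"
  then show "\<exists>V. borel_decomposition U V \<and>
            (\<forall>i. has_independent_alberti_representations \<mu> (V i) \<phi> CARD('n))"
    using null_sets_imp_independent_representations[OF \<mu> assms(2,3)] by blast
qed

end
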